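(* Let $\mu$ be a finite (positive) Borel measure on $\mathbb{R}^n$ and assume that $\mu$ is not absolutely continuous with respect to the Lebesgue measure. Then there exists a sequence $\{g_h\}_{h\in\mathbb{N}}$ of continuously differentiable, equi-Lipschitz maps $g_h:\mathbb{R}^n\to\mathbb{R}^n$ (i.e. there is a constant $L$ such that every $g_h$ is $L$-Lipschitz) converging pointwise to the identity map of $\mathbb{R}^n$ and such that $$\limsup_{h\to\infty}\int_{\mathbb{R}^n}\det(\nabla g_h)\,d\mu<\mu(\mathbb{R}^n).$$
   Context: $\nabla g_h$ denotes the Jacobian matrix of $g_h$. *)

theory Defs
  imports "HOL-Analysis.Analysis"
begin

(* Differentiability is required separately: jacobian g (at x) is a total function and is
   unspecified where g is not differentiable. *)
definition continuously_differentiable :: "(real ^ 'n \<Rightarrow> real ^ 'm) \<Rightarrow> bool"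
  where "continuously_differentiable g \<longleftrightarrow>
    (\<forall>x. g differentiable (at x)) \<and> continuous_on UNIV (\<lambda>x. jacobian g (at x))"

end

theory Submission
  imports Defs
begin

text \<open>
  A compact Lebesgue-null set \<open>K\<close> with \<open>\<mu> K > 0\<close> exists. It suffices to find, for arbitrarily small
  \<open>\<rho>\<close>, a \<open>C\<^sup>1\<close> vector field \<open>u\<close> with \<open>\<bar>u\<bar> \<le> D \<rho>\<close>, \<open>\<bar>\<nabla>u\<bar> \<le> L\<close>, divergence at least \<open>- D \<rho>\<close>
  everywhere and at least \<open>c > 0\<close> on \<open>K\<close>, where \<open>L\<close>, \<open>D\<close> and \<open>c\<close> depend on the dimension only: then the
  maps \<open>x - t u(x)\<close> with a small fixed \<open>t\<close> work, because the determinant is \<open>1 - t div u + O(t\<^sup>2)\<close>.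

  The field is an average of the Newtonian fields \<open>x \<mapsto> \<integral>\<^sub>B (x - y) / \<bar>x - y\<bar>\<^sup>n dy\<close>, regularised at a
  small scale, of sets \<open>B\<close> of small measure that contain a neighbourhood \<open>U\<close> of \<open>K\<close>. Their divergence is
  nonnegative, and bounded below on \<open>K\<close>; only the full gradient, a singular integral of the indicator of \<open>B\<close>,
  may be large. By the minimax principle it is enough to control it on average against each given finite
  weight. This is the dual of the weak-type (1,1) inequality: adding to \<open>U\<close> the balls on which the
  weight has large density makes the gradient nearly constant there, so the weight may be spread out
  over these balls, and the \<open>L\<^sup>2\<close> bound of the gradient by the divergence finishes the estimate.
\<close>

section \<open>The regularised radial field\<close>

text \<open>One fixed set \<open>B\<close> would not do: the gradient of its field is a singular
  integral of a bounded function, an operation bounded on L^2 but not in the sup norm. Duality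
  replaces the bound at all points by one bound for each weight, and \<open>B\<close> may then be
  adapted to the weight.

  The scale \<open>e\<close> is chosen after \<open>U\<close>, so small that the
  \<open>e\<close>-balls about points of \<open>K\<close> lie in \<open>U\<close>. It can be
  arbitrarily small compared with \<rho>, so every quantitative estimate has to be uniform in
  \<open>e\<close>. This is possible because the kernel and its gradient are dominated by |x|^(1-n)
  and |x|^(-n), and its divergence is an approximate identity, so the powers of \<open>e\<close>
  cancel. Constants that do depend on \<open>e\<close> enter only through differentiability,
  integrability and the mesh of a finite net.

  The net reduces the minimax to finitely many points, entries and signs. It covers only a ball, so
  a cut-off follows; the derivative of the cut-off multiplies \<open>u\<close>, which is O(\<rho>).

  The step \<open>t\<close> stays fixed while \<rho> tends to 0: the gain of order t c \<mu>(K) must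
  beat the error of order t^2 \<mu>(R^n), whose constant depends on \<open>L\<close> and the
  dimension.\<close>

definition regnorm :: "real \<Rightarrow> 'a::euclidean_space \<Rightarrow> real"
  where "regnorm e x = sqrt (x \<bullet> x + e\<^sup>2)"

text \<open>Up to a factor, the Newtonian field x / |x|^n with |x| smoothed in the denominator only.
  It remains the gradient of a radial function, and its divergence becomes a positive bump whose
  total mass does not depend on \<open>e\<close>.\<close>

definition rfield :: "real \<Rightarrow> 'a::euclidean_space \<Rightarrow> 'a"
  where "rfield e x = (1 / regnorm e x ^ DIM('a)) *\<^sub>R x"

definition rfield_deriv :: "real \<Rightarrow> 'a::euclidean_space \<Rightarrow> 'a \<Rightarrow> 'a"
  where "rfield_deriv e x v = (1 / regnorm e x ^ DIM('a)) *\<^sub>R v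
    - (real DIM('a) * (x \<bullet> v) / regnorm e x ^ (DIM('a) + 2)) *\<^sub>R x"

lemma regnorm_pos: "e > 0 \<Longrightarrow> regnorm e x > 0"
  unfolding regnorm_def by (simp add: add_nonneg_pos)

lemma regnorm_sq: "(regnorm e x)\<^sup>2 = x \<bullet> x + e\<^sup>2"
  unfolding regnorm_def by simp

lemma norm_le_regnorm: "norm x \<le> regnorm e x"
  unfolding regnorm_def norm_eq_sqrt_inner by simp

lemma e_le_regnorm: "e \<le> regnorm e x"
  unfolding regnorm_def by (simp add: real_le_rsqrt)

lemma regnorm_le: "e \<ge> 0 \<Longrightarrow> regnorm e x \<le> norm x + e"
  unfolding regnorm_def by (rule real_le_lsqrt) (auto simp: power2_norm_eq_inner[symmetric] power2_sum)

lemma has_derivative_regnorm: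
  assumes "e > 0"
  shows "(regnorm e has_derivative (\<lambda>v. (x \<bullet> v) / regnorm e x)) (at x)"
proof -
  have p: "x \<bullet> x + e\<^sup>2 > 0" using assms by (simp add: add_nonneg_pos)
  show ?thesis unfolding regnorm_def
    by (rule derivative_eq_intros refl p)+
      (auto simp: inner_commute field_simps)
qed

lemma has_derivative_inverse_regnorm_power:
  fixes x :: "'a::euclidean_space"
  assumes "e > 0"
  shows "((\<lambda>x. 1 / regnorm e x ^ m) has_derivative (\<lambda>v. - (real m * (x \<bullet> v) / regnorm e x ^ (m + 2)))) (at x)"
proof -
  have r: "regnorm e x > 0" using regnorm_pos[OF assms] .
  show ?thesis
  proof (cases m)
    case 0
    then show ?thesis by simp
  next
    case (Suc k)
    have 1: "((\<lambda>x. regnorm e x ^ m) has_derivative (\<lambda>v. real m * ((x \<bullet> v) / regnorm e x) * regnorm e x ^ (m - 1))) (at x)"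
      using has_derivative_power[OF has_derivative_regnorm[OF assms, of x], of m] by (simp add: mult_ac)
    have 2: "regnorm e x ^ m \<noteq> 0" using r by simp
    have 3: "(\<lambda>v. - (inverse (regnorm e x ^ m) * (real m * ((x \<bullet> v) / regnorm e x) * regnorm e x ^ (m - 1)) * inverse (regnorm e x ^ m)))
       = (\<lambda>v. - (real m * (x \<bullet> v) / regnorm e x ^ (m + 2)))"
      using r Suc by (simp add: fun_eq_iff field_simps)
    show ?thesis
      using Deriv.has_derivative_inverse[OF 2 1] unfolding 3 by (simp add: inverse_eq_divide)
  qed
qed

lemma has_derivative_rfield:
  fixes x :: "'a::euclidean_space"
  assumes "e > 0"
  shows "(rfield e has_derivative rfield_deriv e x) (at x)"
proof -
  have "((\<lambda>x. (1 / regnorm e x ^ DIM('a)) *\<^sub>R x) has_derivative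
      (\<lambda>v. (1 / regnorm e x ^ DIM('a)) *\<^sub>R v + (- (real DIM('a) * (x \<bullet> v) / regnorm e x ^ (DIM('a) + 2))) *\<^sub>R x)) (at x)"
    by (rule has_derivative_scaleR has_derivative_inverse_regnorm_power assms has_derivative_ident)+
  then show ?thesis
    by (simp add: rfield_def[abs_def] rfield_deriv_def[abs_def])
qed

lemma rfield_deriv_linear: "linear (rfield_deriv e x)"
  by (rule linearI) (simp_all add: rfield_deriv_def algebra_simps inner_add_right add_divide_distrib)

lemma rfield_deriv_add: "rfield_deriv e x (v + w) = rfield_deriv e x v + rfield_deriv e x w"
  and rfield_deriv_scale: "rfield_deriv e x (c *\<^sub>R v) = c *\<^sub>R rfield_deriv e x v"
  using rfield_deriv_linear[of e x] by (simp_all add: linear_add linear_scale)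

text \<open>The derivative of a gradient is symmetric. The energy identity needs this to write a
  squared entry as a product of two mirrored entries.\<close>

lemma rfield_deriv_sym: "rfield_deriv e x v \<bullet> w = rfield_deriv e x w \<bullet> v"
  by (simp add: rfield_deriv_def inner_diff_left) (simp add: inner_commute)

text \<open>The two parts of the trace would cancel for \<open>e = 0\<close>; what survives is the
  difference \<open>e\<^sup>2\<close> between the squares of \<open>regnorm e x\<close> and
  \<open>norm x\<close>.\<close>

lemma rfield_deriv_trace:
  fixes x :: "'a::euclidean_space"
  assumes "e > 0"
  shows "(\<Sum>b\<in>Basis. rfield_deriv e x b \<bullet> b) = real DIM('a) * e\<^sup>2 / regnorm e x ^ (DIM('a) + 2)"
proof -
  have r: "regnorm e x > 0" using regnorm_pos[OF assms] .
  have "(\<Sum>b\<in>Basis. rfield_deriv e x b \<bullet> b) =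
    (\<Sum>b\<in>Basis. 1 / regnorm e x ^ DIM('a) - real DIM('a) / regnorm e x ^ (DIM('a) + 2) * ((x \<bullet> b) * (x \<bullet> b)))"
    by (rule sum.cong) (auto simp: rfield_deriv_def inner_diff_left)
  also have "\<dots> = real DIM('a) / regnorm e x ^ DIM('a) - real DIM('a) / regnorm e x ^ (DIM('a) + 2) * (x \<bullet> x)"
    by (simp only: sum_subtractf sum_distrib_left[symmetric] euclidean_inner[of x x, symmetric]) simp
  also have "\<dots> = real DIM('a) / regnorm e x ^ (DIM('a) + 2) * ((regnorm e x)\<^sup>2 - x \<bullet> x)"
    using r by (simp add: field_simps power_add power2_eq_square)
  finally show ?thesis by (simp add: regnorm_sq)
qed

lemma norm_rfield_le:
  fixes x :: "'a::euclidean_space"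
  assumes "e > 0"
  shows "norm (rfield e x) \<le> 1 / regnorm e x ^ (DIM('a) - 1)"
proof -
  have r: "regnorm e x > 0" using regnorm_pos[OF assms] .
  have d: "DIM('a) = Suc (DIM('a) - 1)" by simp
  have "norm (rfield e x) = norm x / (regnorm e x * regnorm e x ^ (DIM('a) - 1))"
    using r d by (simp add: rfield_def flip: power_Suc)
  also have "\<dots> \<le> regnorm e x / (regnorm e x * regnorm e x ^ (DIM('a) - 1))"
    by (rule divide_right_mono) (use r norm_le_regnorm in auto)
  finally show ?thesis using r by simp
qed

lemma norm_rfield_deriv_le:
  fixes x :: "'a::euclidean_space"
  assumes "e > 0"
  shows "norm (rfield_deriv e x v) \<le> (real DIM('a) + 1) * norm v / regnorm e x ^ DIM('a)"
proof -
  define r where "r = regnorm e x"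
  have r: "r > 0" using regnorm_pos[OF assms] by (simp add: r_def)
  have xr: "norm x \<le> r" using norm_le_regnorm by (simp add: r_def)
  have "\<bar>x \<bullet> v\<bar> * norm x \<le> (norm x * norm v) * norm x"
    by (intro mult_right_mono Cauchy_Schwarz_ineq2) auto
  also have "\<dots> \<le> (r * norm v) * r"
    using xr r by (intro mult_mono) auto
  finally have k: "\<bar>x \<bullet> v\<bar> * norm x \<le> r\<^sup>2 * norm v" by (simp add: power2_eq_square mult_ac)
  have "norm (rfield_deriv e x v) \<le> norm v / r ^ DIM('a) + real DIM('a) * (\<bar>x \<bullet> v\<bar> * norm x) / r ^ (DIM('a) + 2)"
    unfolding rfield_deriv_def r_def[symmetric]
    by (rule norm_triangle_le_diff) (use r in \<open>simp add: abs_mult mult_ac\<close>)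
  also have "\<dots> \<le> norm v / r ^ DIM('a) + real DIM('a) * (r\<^sup>2 * norm v) / r ^ (DIM('a) + 2)"
    using k r by (intro add_left_mono divide_right_mono mult_left_mono) auto
  also have "\<dots> = (real DIM('a) + 1) * norm v / r ^ DIM('a)"
    using r by (simp add: field_simps power_add power2_eq_square)
  finally show ?thesis by (simp add: r_def)
qed

lemma has_derivative_rfield_deriv:
  fixes x :: "'a::euclidean_space"
  assumes "e > 0"
  defines "N \<equiv> real DIM('a)"
  shows "((\<lambda>x. rfield_deriv e x v) has_derivative (\<lambda>w.
     - (N * (x \<bullet> w) / regnorm e x ^ (DIM('a) + 2)) *\<^sub>R v
     - ((N * (x \<bullet> v) / regnorm e x ^ (DIM('a) + 2)) *\<^sub>R w
        + (N * (w \<bullet> v) / regnorm e x ^ (DIM('a) + 2)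
           - N * (N + 2) * (x \<bullet> v) * (x \<bullet> w) / regnorm e x ^ (DIM('a) + 4)) *\<^sub>R x))) (at x)"
proof -
  note D = has_derivative_inverse_regnorm_power[OF assms(1)]
  have 1: "((\<lambda>x. (1 / regnorm e x ^ DIM('a)) *\<^sub>R v) has_derivative
       (\<lambda>w. (- (N * (x \<bullet> w) / regnorm e x ^ (DIM('a) + 2))) *\<^sub>R v)) (at x)"
    unfolding N_def by (rule has_derivative_scaleR_left D)+
  have 2: "((\<lambda>x. (N * (x \<bullet> v)) * (1 / regnorm e x ^ (DIM('a) + 2))) has_derivative
       (\<lambda>w. (N * (x \<bullet> v)) * (- (real (DIM('a) + 2) * (x \<bullet> w) / regnorm e x ^ (DIM('a) + 2 + 2)))
           + (N * (w \<bullet> v)) * (1 / regnorm e x ^ (DIM('a) + 2)))) (at x)"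
    by (rule has_derivative_mult D has_derivative_mult_right has_derivative_inner_left has_derivative_ident)+
  have 3: "((\<lambda>x. ((N * (x \<bullet> v)) * (1 / regnorm e x ^ (DIM('a) + 2))) *\<^sub>R x) has_derivative
     (\<lambda>w. ((N * (x \<bullet> v)) * (1 / regnorm e x ^ (DIM('a) + 2))) *\<^sub>R w +
       ((N * (x \<bullet> v)) * (- (real (DIM('a) + 2) * (x \<bullet> w) / regnorm e x ^ (DIM('a) + 2 + 2)))
           + (N * (w \<bullet> v)) * (1 / regnorm e x ^ (DIM('a) + 2))) *\<^sub>R x)) (at x)"
    by (rule has_derivative_scaleR 2 has_derivative_ident)+
  have 4: "DIM('a) + 2 + 2 = DIM('a) + 4" by simp
  have 5: "(\<lambda>x. rfield_deriv e x v) = (\<lambda>x. (1 / regnorm e x ^ DIM('a)) *\<^sub>R v - ((N * (x \<bullet> v)) * (1 / regnorm e x ^ (DIM('a) + 2))) *\<^sub>R x)"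
    by (simp add: rfield_deriv_def N_def)
  show ?thesis
    unfolding 5 by (rule has_derivative_eq_rhs[OF has_derivative_diff[OF 1 3]])
       (auto simp: N_def fun_eq_iff algebra_simps power_add power_numeral_reduce)
qed

text \<open>Each of the four terms is a multiple of |v| |w| / regnorm^(n+1), with factors N, N, N
  and N (N + 2); their sum is N (N + 5).\<close>

lemma norm_deriv_rfield_deriv_le:
  fixes x v w :: "'a::euclidean_space"
  assumes "e > 0"
  defines "N \<equiv> real DIM('a)"
  shows "norm (- (N * (x \<bullet> w) / regnorm e x ^ (DIM('a) + 2)) *\<^sub>R v
     - ((N * (x \<bullet> v) / regnorm e x ^ (DIM('a) + 2)) *\<^sub>R w
        + (N * (w \<bullet> v) / regnorm e x ^ (DIM('a) + 2)
           - N * (N + 2) * (x \<bullet> v) * (x \<bullet> w) / regnorm e x ^ (DIM('a) + 4)) *\<^sub>R x))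
    \<le> N * (N + 5) * norm v / regnorm e x ^ (DIM('a) + 1) * norm w"
proof -
  define r where "r = regnorm e x"
  have r: "r > 0" using regnorm_pos[OF assms(1)] by (simp add: r_def)
  have N: "N \<ge> 0" by (simp add: N_def)
  have xr: "norm x \<le> r" using norm_le_regnorm by (simp add: r_def)
  have xi: "\<bar>x \<bullet> a\<bar> \<le> r * norm a" for a
    using Cauchy_Schwarz_ineq2[of x a] mult_right_mono[OF xr, of "norm a"] by simp
  let ?V = "norm v * norm w"
  define R where "R = r ^ (DIM('a) + 1)"
  have R: "R > 0" using r by (simp add: R_def)
  have R2: "r ^ (DIM('a) + 2) = R * r" "r ^ (DIM('a) + 4) = R * r ^ 3" by (simp_all add: R_def power_add power_numeral_reduce)
  have a: "norm ((N * (x \<bullet> w) / (R * r)) *\<^sub>R v) \<le> N * ?V / R"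
  proof -
    have "norm ((N * (x \<bullet> w) / (R * r)) *\<^sub>R v) = N * (\<bar>x \<bullet> w\<bar> * norm v) / (R * r)"
      using N R r by (simp add: abs_mult)
    also have "\<dots> \<le> N * ((r * norm w) * norm v) / (R * r)"
      using xi[of w] N R r by (intro divide_right_mono mult_left_mono mult_right_mono) auto
    finally show ?thesis using r by (simp add: field_simps)
  qed
  have b: "norm ((N * (x \<bullet> v) / (R * r)) *\<^sub>R w) \<le> N * ?V / R"
  proof -
    have "norm ((N * (x \<bullet> v) / (R * r)) *\<^sub>R w) = N * (\<bar>x \<bullet> v\<bar> * norm w) / (R * r)"
      using N R r by (simp add: abs_mult)
    also have "\<dots> \<le> N * ((r * norm v) * norm w) / (R * r)"
      using xi[of v] N R r by (intro divide_right_mono mult_left_mono mult_right_mono) auto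
    finally show ?thesis using r by (simp add: field_simps)
  qed
  have c: "\<bar>N * (w \<bullet> v) / (R * r)\<bar> \<le> N * ?V / (R * r)"
    using N R r Cauchy_Schwarz_ineq2[of w v]
    by (simp add: abs_mult mult.commute divide_right_mono mult_left_mono)
  have d: "\<bar>N * (N + 2) * (x \<bullet> v) * (x \<bullet> w) / (R * r ^ 3)\<bar> \<le> N * (N + 2) * ?V / (R * r)"
  proof -
    have "\<bar>N * (N + 2) * (x \<bullet> v) * (x \<bullet> w) / (R * r ^ 3)\<bar> = N * (N + 2) * (\<bar>x \<bullet> v\<bar> * \<bar>x \<bullet> w\<bar>) / (R * r ^ 3)"
      using N R r by (simp add: abs_mult)
    also have "\<dots> \<le> N * (N + 2) * ((r * norm v) * (r * norm w)) / (R * r ^ 3)"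
      using xi[of v] xi[of w] N R r by (intro divide_right_mono mult_left_mono mult_mono) auto
    also have "\<dots> = N * (N + 2) * ?V / (R * r)" using r R by (simp add: power_numeral_reduce)
    finally show ?thesis .
  qed
  have cd: "norm ((N * (w \<bullet> v) / (R * r) - N * (N + 2) * (x \<bullet> v) * (x \<bullet> w) / (R * r ^ 3)) *\<^sub>R x)
     \<le> (N * ?V / (R * r) + N * (N + 2) * ?V / (R * r)) * r"
    unfolding norm_scaleR using c d xr N R r by (intro mult_mono) (auto intro!: order_trans[OF abs_triangle_ineq4] add_mono)
  have "norm (- (N * (x \<bullet> w) / (R * r)) *\<^sub>R v
     - ((N * (x \<bullet> v) / (R * r)) *\<^sub>R w
        + (N * (w \<bullet> v) / (R * r)
           - N * (N + 2) * (x \<bullet> v) * (x \<bullet> w) / (R * r ^ 3)) *\<^sub>R x))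
     \<le> N * ?V / R + (N * ?V / R + (N * ?V / (R * r) + N * (N + 2) * ?V / (R * r)) * r)"
    using a b cd by (intro norm_triangle_le_diff norm_triangle_le add_mono) auto
  also have "\<dots> = N * (N + 5) * norm v / R * norm w"
    using r R by (simp add: field_simps)
  finally show ?thesis unfolding R_def r_def R2[unfolded R_def r_def, symmetric] .
qed

text \<open>The lower bound is asked only along the segment, so that \<open>\<rho>\<close> can be
  \<open>e\<close> for a global estimate, or a distance to the singularity for an estimate uniform
  in \<open>e\<close>.\<close>

lemma rfield_deriv_lipschitz:
  fixes x y v :: "'a::euclidean_space"
  assumes "e > 0" "\<rho> > 0" and "\<And>z. z \<in> closed_segment x y \<Longrightarrow> \<rho> \<le> regnorm e z"
  shows "norm (rfield_deriv e x v - rfield_deriv e y v)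
    \<le> real DIM('a) * (real DIM('a) + 5) * norm v / \<rho> ^ (DIM('a) + 1) * norm (x - y)"
proof (rule differentiable_bound)
  show "convex (closed_segment x y)" by simp
  show "((\<lambda>x. rfield_deriv e x v) has_derivative (\<lambda>w.
     - (real DIM('a) * (z \<bullet> w) / regnorm e z ^ (DIM('a) + 2)) *\<^sub>R v
     - ((real DIM('a) * (z \<bullet> v) / regnorm e z ^ (DIM('a) + 2)) *\<^sub>R w
        + (real DIM('a) * (w \<bullet> v) / regnorm e z ^ (DIM('a) + 2)
           - real DIM('a) * (real DIM('a) + 2) * (z \<bullet> v) * (z \<bullet> w) / regnorm e z ^ (DIM('a) + 4)) *\<^sub>R z)))
     (at z within closed_segment x y)" for z
    using has_derivative_rfield_deriv[OF assms(1)] by (rule has_derivative_at_withinI)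
  show "onorm (\<lambda>w. - (real DIM('a) * (z \<bullet> w) / regnorm e z ^ (DIM('a) + 2)) *\<^sub>R v
     - ((real DIM('a) * (z \<bullet> v) / regnorm e z ^ (DIM('a) + 2)) *\<^sub>R w
        + (real DIM('a) * (w \<bullet> v) / regnorm e z ^ (DIM('a) + 2)
           - real DIM('a) * (real DIM('a) + 2) * (z \<bullet> v) * (z \<bullet> w) / regnorm e z ^ (DIM('a) + 4)) *\<^sub>R z))
     \<le> real DIM('a) * (real DIM('a) + 5) * norm v / \<rho> ^ (DIM('a) + 1)" if "z \<in> closed_segment x y" for z
  proof (rule onorm_le)
    fix w :: 'a
    have "real DIM('a) * (real DIM('a) + 5) * norm v / regnorm e z ^ (DIM('a) + 1)
       \<le> real DIM('a) * (real DIM('a) + 5) * norm v / \<rho> ^ (DIM('a) + 1)"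
      using assms(2) assms(3)[of z] that by (intro divide_left_mono power_mono) (auto intro!: mult_pos_pos regnorm_pos assms(1) zero_less_power)
    from mult_right_mono[OF this, of "norm w"] norm_deriv_rfield_deriv_le[OF assms(1), where x=z and v=v and w=w]
    show "norm (- (real DIM('a) * (z \<bullet> w) / regnorm e z ^ (DIM('a) + 2)) *\<^sub>R v
     - ((real DIM('a) * (z \<bullet> v) / regnorm e z ^ (DIM('a) + 2)) *\<^sub>R w
        + (real DIM('a) * (w \<bullet> v) / regnorm e z ^ (DIM('a) + 2)
           - real DIM('a) * (real DIM('a) + 2) * (z \<bullet> v) * (z \<bullet> w) / regnorm e z ^ (DIM('a) + 4)) *\<^sub>R z))
       \<le> real DIM('a) * (real DIM('a) + 5) * norm v / \<rho> ^ (DIM('a) + 1) * norm w" by simp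
  qed
qed auto

lemma rfield_deriv_lipschitz_global:
  fixes x y v :: "'a::euclidean_space"
  assumes "e > 0"
  shows "norm (rfield_deriv e x v - rfield_deriv e y v)
    \<le> real DIM('a) * (real DIM('a) + 5) * norm v / e ^ (DIM('a) + 1) * norm (x - y)"
  by (rule rfield_deriv_lipschitz) (auto simp: assms e_le_regnorm)

text \<open>The remainder is quadratic with a constant independent of \<open>x\<close>, so it can be
  integrated over \<open>B\<close>; this takes the place of differentiation under the integral
  sign.\<close>

lemma rfield_taylor:
  fixes x v :: "'a::euclidean_space"
  assumes "e > 0"
  shows "norm (rfield e (x + v) - rfield e x - rfield_deriv e x v)
    \<le> real DIM('a) * (real DIM('a) + 5) / e ^ (DIM('a) + 1) * (norm v)\<^sup>2"
proof -
  define M where "M = real DIM('a) * (real DIM('a) + 5) / e ^ (DIM('a) + 1)"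
  have M: "M \<ge> 0" using assms by (simp add: M_def)
  \<comment> \<open>The mean value inequality is applied to the field minus its linear part at
    \<open>x\<close>; on the segment the derivative of this difference is at most
    \<open>M * norm v\<close>.\<close>
  have "norm ((rfield e (x + v) - rfield_deriv e x (x + v)) - (rfield e x - rfield_deriv e x x)) \<le> (M * norm v) * norm ((x + v) - x)"
  proof (rule differentiable_bound[where S="closed_segment x (x + v)" and f'="\<lambda>z h. rfield_deriv e z h - rfield_deriv e x h"])
    show "convex (closed_segment x (x + v))" by simp
    fix z assume z: "z \<in> closed_segment x (x + v)"
    have bl: "bounded_linear (rfield_deriv e x)" using rfield_deriv_linear linear_conv_bounded_linear by blast
    show "((\<lambda>x'. rfield e x' - rfield_deriv e x x') has_derivative (\<lambda>h. rfield_deriv e z h - rfield_deriv e x h))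
       (at z within closed_segment x (x + v))"
      by (intro has_derivative_diff has_derivative_at_withinI[OF has_derivative_rfield[OF assms]]
          bounded_linear_imp_has_derivative bl)
    have zx: "norm (z - x) \<le> norm v"
      using segment_bound(1)[OF z] by simp
    show "onorm (\<lambda>h. rfield_deriv e z h - rfield_deriv e x h) \<le> M * norm v"
    proof (rule onorm_le)
      fix h
      have "norm (rfield_deriv e z h - rfield_deriv e x h) \<le> M * norm h * norm (z - x)"
        using rfield_deriv_lipschitz_global[OF assms, where x=z and v=h and y=x] by (simp add: M_def)
      also have "\<dots> \<le> M * norm h * norm v" using zx M by (intro mult_left_mono) auto
      finally show "norm (rfield_deriv e z h - rfield_deriv e x h) \<le> M * norm v * norm h" by (simp add: mult_ac)
    qed
  qed auto
  moreover have "(rfield e (x + v) - rfield_deriv e x (x + v)) - (rfield e x - rfield_deriv e x x) = rfield e (x + v) - rfield e x - rfield_deriv e x v"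
    by (simp add: rfield_deriv_add)
  ultimately show ?thesis by (simp add: M_def power2_eq_square mult_ac)
qed

section \<open>Radial integrals\<close>

lemma one_divide_le:
  fixes A B c :: real
  shows "0 < A \<Longrightarrow> 0 < B \<Longrightarrow> B \<le> c * A \<Longrightarrow> 1 / A \<le> c / B"
  by (simp add: field_simps)

lemma ennreal_le_suminf: "(f k :: ennreal) \<le> (\<Sum>k. f k)"
  using sum_le_suminf[of f "{k}"] by simp

lemma nn_integral_suminf_indicator:
  fixes c :: "nat \<Rightarrow> ennreal"
  assumes "\<And>k. A k \<in> sets M"
  shows "(\<integral>\<^sup>+x. (\<Sum>k. c k * indicator (A k) x) \<partial>M) = (\<Sum>k. c k * emeasure M (A k))"
  using assms by (subst nn_integral_suminf) (auto simp: nn_integral_cmult_indicator)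

lemma lborel_distr_isometry:
  fixes t :: "'a::euclidean_space"
  assumes "\<bar>c\<bar> = 1"
  shows "distr lborel borel (\<lambda>x. t + c *\<^sub>R x) = lborel"
proof -
  have "c \<noteq> 0" using assms by auto
  from lborel_affine[OF this, of t] show ?thesis using assms by (simp add: density_1)
qed

lemma nn_integral_affine_euclidean:
  fixes f :: "'a::euclidean_space \<Rightarrow> ennreal"
  assumes [measurable]: "f \<in> borel_measurable borel" and "c \<noteq> 0"
  shows "(\<integral>\<^sup>+x. f x \<partial>lborel) = ennreal (\<bar>c\<bar> ^ DIM('a)) * (\<integral>\<^sup>+x. f (t + c *\<^sub>R x) \<partial>lborel)"
  by (subst lborel_affine[OF assms(2), of t])
     (simp add: nn_integral_density nn_integral_distr nn_integral_cmult)

lemma lborel_integral_isometry: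
  fixes f :: "'a::euclidean_space \<Rightarrow> 'b::{banach, second_countable_topology}"
  assumes [measurable]: "f \<in> borel_measurable borel" and "\<bar>c\<bar> = 1"
  shows "(\<integral>x. f (t + c *\<^sub>R x) \<partial>lborel) = (\<integral>x. f x \<partial>lborel)"
  by (subst (2) lborel_distr_isometry[OF assms(2), of t, symmetric]) (simp add: integral_distr)

lemma lborel_integrable_isometry:
  fixes f :: "'a::euclidean_space \<Rightarrow> 'b::{banach, second_countable_topology}"
  assumes [measurable]: "f \<in> borel_measurable borel" and "\<bar>c\<bar> = 1"
  shows "integrable lborel (\<lambda>x. f (t + c *\<^sub>R x)) \<longleftrightarrow> integrable lborel f"
  by (subst (2) lborel_distr_isometry[OF assms(2), of t, symmetric]) (simp add: integrable_distr_eq)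

lemma emeasure_cball_euclidean:
  fixes c :: "'a::euclidean_space"
  assumes "r \<ge> 0"
  shows "emeasure lborel (cball c r) = ennreal (unit_ball_vol (real DIM('a)) * r ^ DIM('a))"
  using emeasure_cball[OF assms, of c] assms by simp

text \<open>The integrand is dominated by a sum over balls of radius 2^k: volume grows like 2^(k n),
  the coefficient decays like 2^(-k (n+1)), and a geometric series remains.\<close>

lemma nn_integral_decay_finite:
  "(\<integral>\<^sup>+x. ennreal (1 / (1 + norm (x::'a::euclidean_space)) ^ (DIM('a) + 1)) \<partial>lborel) < \<infinity>"
proof -
  let ?n = "DIM('a)" and ?w = "unit_ball_vol (real DIM('a))"
  have w: "?w \<ge> 0" by (simp add: less_imp_le)
  have "(\<integral>\<^sup>+x. ennreal (1 / (1 + norm (x::'a)) ^ (?n + 1)) \<partial>lborel)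
    \<le> (\<integral>\<^sup>+x. (\<Sum>k. ennreal (2 ^ (?n + 1) / (2 ^ k) ^ (?n + 1)) * indicator (cball (0::'a) (2 ^ k)) x) \<partial>lborel)"
  proof (rule nn_integral_mono)
    fix x :: 'a
    have "\<exists>k::nat. norm x \<le> 2 ^ k"
      using real_arch_pow[of 2 "norm x"] by (auto intro: less_imp_le)
    define k where "k = (LEAST k::nat. norm x \<le> 2 ^ k)"
    have k: "norm x \<le> 2 ^ k" unfolding k_def by (rule LeastI_ex) fact
    have l: "(2::real) ^ k \<le> 2 * (1 + norm x)"
    proof (cases k)
      case (Suc m)
      then have "\<not> norm x \<le> 2 ^ m" using not_less_Least[of m "\<lambda>k. norm x \<le> 2 ^ k"] by (simp add: k_def)
      with Suc show ?thesis by simp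
    qed simp
    have "1 / (1 + norm x) ^ (?n + 1) \<le> 2 ^ (?n + 1) / (2 ^ k) ^ (?n + 1)"
      using power_mono[OF l, of "?n + 1"] unfolding power_mult_distrib
      by (intro one_divide_le zero_less_power) (auto simp: add_pos_nonneg)
    then have "ennreal (1 / (1 + norm x) ^ (?n + 1)) \<le> ennreal (2 ^ (?n + 1) / (2 ^ k) ^ (?n + 1)) * indicator (cball (0::'a) (2 ^ k)) x"
      using k by (simp add: ennreal_leI)
    also have "\<dots> \<le> (\<Sum>k. ennreal (2 ^ (?n + 1) / (2 ^ k) ^ (?n + 1)) * indicator (cball (0::'a) (2 ^ k)) x)"
      by (rule ennreal_le_suminf)
    finally show "ennreal (1 / (1 + norm x) ^ (?n + 1)) \<le> (\<Sum>k. ennreal (2 ^ (?n + 1) / (2 ^ k) ^ (?n + 1)) * indicator (cball (0::'a) (2 ^ k)) x)" .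
  qed
  also have "\<dots> = (\<Sum>k. ennreal (2 ^ (?n + 1) / (2 ^ k) ^ (?n + 1)) * ennreal (?w * (2 ^ k) ^ ?n))"
    by (subst nn_integral_suminf_indicator) (auto simp: emeasure_cball_euclidean)
  also have "\<dots> = (\<Sum>k. ennreal (2 ^ (?n + 1) * ?w * (1 / 2) ^ k))"
    using w by (intro suminf_cong) (simp add: ennreal_mult[symmetric] divide_simps power_add)
  also have "\<dots> < \<infinity>"
    using w by (subst suminf_ennreal2)
      (auto intro!: summable_mult summable_geometric)
  finally show ?thesis .
qed

definition decay_integral :: "'a::euclidean_space itself \<Rightarrow> real"
  where "decay_integral _ = (\<integral>x. 1 / (1 + norm (x::'a)) ^ (DIM('a) + 1) \<partial>lborel)"

lemma integrable_decay:
  "integrable lborel (\<lambda>x::'a::euclidean_space. 1 / (1 + norm x) ^ (DIM('a) + 1))"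
  using nn_integral_decay_finite[where 'a='a]
  by (intro integrableI_bounded) (simp_all add: abs_of_nonneg)

lemma decay_integral_nonneg: "decay_integral TYPE('a::euclidean_space) \<ge> 0"
  unfolding decay_integral_def by (rule Bochner_Integration.integral_nonneg) simp

lemma nn_integral_decay:
  "(\<integral>\<^sup>+x. ennreal (1 / (1 + norm (x::'a::euclidean_space)) ^ (DIM('a) + 1)) \<partial>lborel) = ennreal (decay_integral TYPE('a))"
  unfolding decay_integral_def by (rule nn_integral_eq_integral[OF integrable_decay]) simp

text \<open>Scale invariance: substituting e x for x cancels all powers of \<open>e\<close>. The
  estimates uniform in \<open>e\<close> rest on this.\<close>

lemma nn_integral_decay_scaled:
  assumes "e > 0"
  shows "(\<integral>\<^sup>+x. ennreal (e / (e + norm (x::'a::euclidean_space)) ^ (DIM('a) + 1)) \<partial>lborel) = ennreal (decay_integral TYPE('a))"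
proof -
  have "(\<integral>\<^sup>+x. ennreal (e / (e + norm (x::'a)) ^ (DIM('a) + 1)) \<partial>lborel)
     = ennreal (\<bar>e\<bar> ^ DIM('a)) * (\<integral>\<^sup>+x. ennreal (e / (e + norm (0 + e *\<^sub>R x::'a)) ^ (DIM('a) + 1)) \<partial>lborel)"
    by (rule nn_integral_affine_euclidean) (use assms in auto)
  also have "\<dots> = (\<integral>\<^sup>+x. ennreal (e ^ DIM('a)) * ennreal (e / (e + norm (e *\<^sub>R x::'a)) ^ (DIM('a) + 1)) \<partial>lborel)"
    using assms by (subst nn_integral_cmult) auto
  also have "\<dots> = (\<integral>\<^sup>+x. ennreal (1 / (1 + norm (x::'a)) ^ (DIM('a) + 1)) \<partial>lborel)"
  proof (rule nn_integral_cong)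
    fix x :: 'a
    have "e + norm (e *\<^sub>R x) = e * (1 + norm x)" using assms by (simp add: algebra_simps)
    then show "ennreal (e ^ DIM('a)) * ennreal (e / (e + norm (e *\<^sub>R x)) ^ (DIM('a) + 1)) = ennreal (1 / (1 + norm x) ^ (DIM('a) + 1))"
      using assms by (simp add: ennreal_mult[symmetric] power_mult_distrib)
  qed
  finally show ?thesis unfolding nn_integral_decay .
qed

text \<open>Outside the ball, \<rho> + |y| is at most 2 |y|, which reduces to the scaled decay
  integral. The factor 1 / \<rho> is what later cancels the diameter of a ball.\<close>

lemma nn_integral_outside_ball:
  fixes c :: "'a::euclidean_space"
  assumes "\<rho> > 0"
  shows "(\<integral>\<^sup>+y. ennreal (1 / norm (y - c) ^ (DIM('a) + 1)) * indicator {y. \<rho> \<le> norm (y - c)} y \<partial>lborel)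
    \<le> ennreal (2 ^ (DIM('a) + 1) * decay_integral TYPE('a) / \<rho>)"
proof -
  let ?n = "DIM('a)"
  have "(\<integral>\<^sup>+y. ennreal (1 / norm (y - c) ^ (?n + 1)) * indicator {y. \<rho> \<le> norm (y - c)} y \<partial>lborel)
    = (\<integral>\<^sup>+y. ennreal (1 / norm (y::'a) ^ (?n + 1)) * indicator {y. \<rho> \<le> norm y} y \<partial>lborel)"
    by (subst nn_integral_affine_euclidean[where c=1 and t=c])
       (auto intro!: nn_integral_cong simp: indicator_def)
  also have "\<dots> \<le> (\<integral>\<^sup>+y. ennreal (2 ^ (?n + 1) / \<rho>) * ennreal (\<rho> / (\<rho> + norm (y::'a)) ^ (?n + 1)) \<partial>lborel)"
  proof (rule nn_integral_mono)
    fix y :: 'a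
    show "ennreal (1 / norm y ^ (?n + 1)) * indicator {y. \<rho> \<le> norm y} y
      \<le> ennreal (2 ^ (?n + 1) / \<rho>) * ennreal (\<rho> / (\<rho> + norm y) ^ (?n + 1))"
    proof (cases "\<rho> \<le> norm y")
      case True
      then have y: "norm y > 0" using assms by linarith
      have "(\<rho> + norm y) ^ (?n + 1) \<le> (2 * norm y) ^ (?n + 1)"
        using True assms by (intro power_mono) auto
      then have "1 / norm y ^ (?n + 1) \<le> 2 ^ (?n + 1) / (\<rho> + norm y) ^ (?n + 1)"
        unfolding power_mult_distrib using assms y by (intro one_divide_le zero_less_power) (auto simp: add_pos_nonneg)
      then show ?thesis using True assms
        by (simp add: ennreal_mult[symmetric] ennreal_leI)
    qed simp
  qed
  also have "\<dots> = ennreal (2 ^ (?n + 1) / \<rho>) * ennreal (decay_integral TYPE('a))"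
    using assms by (subst nn_integral_cmult) (auto simp: nn_integral_decay_scaled[simplified])
  also have "\<dots> = ennreal (2 ^ (?n + 1) * decay_integral TYPE('a) / \<rho>)"
    using assms decay_integral_nonneg[where 'a='a] by (simp add: ennreal_mult[symmetric])
  finally show ?thesis .
qed

text \<open>Since e + |x| is at most twice the regularised norm, the divergence kernel is dominated
  by the scaled decay function; hence its mass is bounded uniformly in \<open>e\<close>.\<close>

lemma nn_integral_trace_le:
  assumes "e > 0"
  shows "(\<integral>\<^sup>+x. ennreal (real DIM('a) * e\<^sup>2 / regnorm e (x::'a::euclidean_space) ^ (DIM('a) + 2)) \<partial>lborel)
    \<le> ennreal (real DIM('a) * 2 ^ (DIM('a) + 2) * decay_integral TYPE('a))"
proof -
  let ?n = "DIM('a)"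
  have "(\<integral>\<^sup>+x. ennreal (real ?n * e\<^sup>2 / regnorm e (x::'a) ^ (?n + 2)) \<partial>lborel)
    \<le> (\<integral>\<^sup>+x. ennreal (real ?n * 2 ^ (?n + 2)) * ennreal (e / (e + norm (x::'a)) ^ (?n + 1)) \<partial>lborel)"
  proof (rule nn_integral_mono)
    fix x :: 'a
    have s: "e + norm x > 0" using assms by (simp add: add_pos_nonneg)
    have r: "(e + norm x) \<le> 2 * regnorm e x"
      using norm_le_regnorm[of x e] e_le_regnorm[of e x] by simp
    have "e * (e + norm x) ^ (?n + 1) \<le> (e + norm x) ^ (?n + 2)"
      using s assms by (simp add: mult_right_mono)
    also have "\<dots> \<le> (2 * regnorm e x) ^ (?n + 2)"
      using r s by (intro power_mono) auto
    finally have k: "e * (e + norm x) ^ (?n + 1) \<le> 2 ^ (?n + 2) * regnorm e x ^ (?n + 2)"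
      by (simp only: power_mult_distrib)
    have "e / regnorm e x ^ (?n + 2) \<le> 2 ^ (?n + 2) / (e + norm x) ^ (?n + 1)"
      using k s regnorm_pos[OF assms, of x] by (subst frac_le_eq) (auto simp: divide_simps mult_ac simp del: power_Suc)
    then have "(real ?n * e) * (e / regnorm e x ^ (?n + 2)) \<le> (real ?n * e) * (2 ^ (?n + 2) / (e + norm x) ^ (?n + 1))"
      using assms by (intro mult_left_mono) auto
    then have "real ?n * e\<^sup>2 / regnorm e x ^ (?n + 2) \<le> (real ?n * 2 ^ (?n + 2)) * (e / (e + norm x) ^ (?n + 1))"
      by (simp add: power2_eq_square mult_ac)
    then show "ennreal (real ?n * e\<^sup>2 / regnorm e x ^ (?n + 2)) \<le> ennreal (real ?n * 2 ^ (?n + 2)) * ennreal (e / (e + norm x) ^ (?n + 1))"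
      using assms s by (subst ennreal_mult[symmetric]) (auto intro: ennreal_leI)
  qed
  also have "\<dots> = ennreal (real ?n * 2 ^ (?n + 2)) * ennreal (decay_integral TYPE('a))"
    using assms by (subst nn_integral_cmult) (auto simp: nn_integral_decay_scaled[simplified])
  finally show ?thesis
    using decay_integral_nonneg[where 'a='a] by (simp add: ennreal_mult[symmetric])
qed

text \<open>Dyadic balls shrinking to the origin: the kernel grows like 2^(k (n-1)) while the volume
  shrinks like 2^(-k n), so the singularity is integrable.\<close>

lemma nn_integral_inside_ball:
  assumes "\<rho> > 0"
  shows "(\<integral>\<^sup>+z. ennreal (1 / norm (z::'a::euclidean_space) ^ (DIM('a) - 1)) * indicator (cball 0 \<rho>) z \<partial>lborel)
    \<le> ennreal (2 ^ DIM('a) * unit_ball_vol (real DIM('a)) * \<rho>)"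
proof -
  let ?n = "DIM('a)" and ?w = "unit_ball_vol (real DIM('a))"
  have w: "?w \<ge> 0" by (simp add: less_imp_le)
  have "(\<integral>\<^sup>+z. ennreal (1 / norm (z::'a) ^ (?n - 1)) * indicator (cball 0 \<rho>) z \<partial>lborel)
    \<le> (\<integral>\<^sup>+z. (\<Sum>k. ennreal ((2 ^ Suc k / \<rho>) ^ (?n - 1)) * indicator (cball (0::'a) (\<rho> / 2 ^ k)) z) \<partial>lborel)"
  proof (rule nn_integral_mono_AE)
    \<comment> \<open>At the origin no dyadic index \<open>k\<close> exists; a single point may be
      discarded.\<close>
    have "AE z in lborel. z \<noteq> (0::'a)" by (rule AE_lborel_singleton)
    then show "AE z::'a in lborel. ennreal (1 / norm z ^ (?n - 1)) * indicator (cball 0 \<rho>) z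
       \<le> (\<Sum>k. ennreal ((2 ^ Suc k / \<rho>) ^ (?n - 1)) * indicator (cball (0::'a) (\<rho> / 2 ^ k)) z)"
    proof eventually_elim
      case (elim z)
      show ?case
      proof (cases "norm z \<le> \<rho>")
        case True
        have "\<exists>k::nat. \<rho> / 2 ^ Suc k < norm z"
        proof -
          obtain k where "\<rho> / norm z < 2 ^ k" using real_arch_pow[of 2 "\<rho> / norm z"] by auto
          then have "\<rho> < 2 ^ k * norm z" using elim by (simp add: divide_simps)
          also have "\<dots> \<le> 2 ^ Suc k * norm z" by simp
          finally show ?thesis by (intro exI[of _ k]) (simp add: divide_simps mult_ac)
        qed
        define k where "k = (LEAST k::nat. \<rho> / 2 ^ Suc k < norm z)"
        have k: "\<rho> / 2 ^ Suc k < norm z" unfolding k_def by (rule LeastI_ex) fact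
        have l: "norm z \<le> \<rho> / 2 ^ k"
        proof (cases k)
          case (Suc m)
          then show ?thesis using not_less_Least[of m "\<lambda>k. \<rho> / 2 ^ Suc k < norm z"] by (simp add: k_def)
        qed (use True in simp)
        have "1 / norm z \<le> 2 ^ Suc k / \<rho>"
          using k elim assms by (simp add: divide_simps mult_ac)
        then have "(1 / norm z) ^ (?n - 1) \<le> (2 ^ Suc k / \<rho>) ^ (?n - 1)"
          by (intro power_mono) auto
        then have "ennreal (1 / norm z ^ (?n - 1)) * indicator (cball 0 \<rho>) z
           \<le> ennreal ((2 ^ Suc k / \<rho>) ^ (?n - 1)) * indicator (cball (0::'a) (\<rho> / 2 ^ k)) z"
          using l True by (simp add: ennreal_leI power_one_over del: power_Suc)
        also have "\<dots> \<le> (\<Sum>k. ennreal ((2 ^ Suc k / \<rho>) ^ (?n - 1)) * indicator (cball (0::'a) (\<rho> / 2 ^ k)) z)"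
          by (rule ennreal_le_suminf)
        finally show ?thesis .
      qed simp
    qed
  qed
  also have "\<dots> = (\<Sum>k. ennreal ((2 ^ Suc k / \<rho>) ^ (?n - 1)) * ennreal (?w * (\<rho> / 2 ^ k) ^ ?n))"
    using assms by (subst nn_integral_suminf_indicator) (auto simp: emeasure_cball_euclidean)
  also have "\<dots> = (\<Sum>k. ennreal (2 ^ (?n - 1) * ?w * \<rho> * (1 / 2) ^ k))"
  proof (rule suminf_cong)
    fix k
    have "(2 ^ Suc k / \<rho>) ^ (?n - 1) * (?w * (\<rho> / 2 ^ k) ^ ?n) = 2 ^ (?n - 1) * ?w * \<rho> * (1 / 2) ^ k"
    proof -
      obtain m where m: "?n = Suc m" using DIM_positive[where 'a='a] by (cases ?n) auto
      show ?thesis unfolding m using assms by (simp add: power_divide power_mult_distrib divide_simps)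
    qed
    then show "ennreal ((2 ^ Suc k / \<rho>) ^ (?n - 1)) * ennreal (?w * (\<rho> / 2 ^ k) ^ ?n) = ennreal (2 ^ (?n - 1) * ?w * \<rho> * (1 / 2) ^ k)"
      using assms w by (subst ennreal_mult[symmetric]) auto
  qed
  also have "\<dots> = ennreal (\<Sum>k. 2 ^ (?n - 1) * ?w * \<rho> * (1 / 2) ^ k)"
    using w assms by (intro suminf_ennreal2) (auto intro!: summable_mult summable_geometric)
  also have "(\<Sum>k. 2 ^ (?n - 1) * ?w * \<rho> * (1 / 2::real) ^ k) = 2 ^ (?n - 1) * ?w * \<rho> * 2"
    by (subst suminf_mult) (auto simp: suminf_geometric summable_geometric)
  also have "2 ^ (?n - 1) * ?w * \<rho> * 2 = 2 ^ ?n * ?w * \<rho>"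
    by (simp add: power_eq_if)
  finally show ?thesis .
qed

section \<open>The potential of a set\<close>

text \<open>Differentiability from a quadratic remainder: this suits potentials, where the remainder
  is an integral with a uniform bound.\<close>

lemma has_derivative_quadraticI:
  fixes f :: "'a::real_normed_vector \<Rightarrow> 'b::real_normed_vector"
  assumes "bounded_linear D" and bound: "\<And>v. norm (f (x + v) - f x - D v) \<le> C * (norm v)\<^sup>2"
  shows "(f has_derivative D) (at x)"
  unfolding has_derivative_at
proof (intro conjI assms(1))
  have "((\<lambda>h::'a. \<bar>C\<bar> * norm h) \<longlongrightarrow> \<bar>C\<bar> * norm (0::'a)) (at 0)"
    by (intro tendsto_intros)
  then have 1: "((\<lambda>h::'a. \<bar>C\<bar> * norm h) \<longlongrightarrow> 0) (at 0)" by simp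
  show "((\<lambda>h. norm (f (x + h) - f x - D h) / norm h) \<longlongrightarrow> 0) (at 0)"
  proof (rule tendsto_sandwich[OF _ _ tendsto_const 1])
    show "\<forall>\<^sub>F h in at 0. norm (f (x + h) - f x - D h) / norm h \<le> \<bar>C\<bar> * norm h"
    proof (rule always_eventually, rule allI)
      fix h
      have "norm (f (x + h) - f x - D h) \<le> \<bar>C\<bar> * (norm h)\<^sup>2"
        using bound[of h] mult_right_mono[OF abs_ge_self[of C], of "(norm h)\<^sup>2"] by simp
      then show "norm (f (x + h) - f x - D h) / norm h \<le> \<bar>C\<bar> * norm h"
        by (cases "h = 0") (simp_all add: divide_simps power2_eq_square mult_ac)
    qed
  qed simp
qed

text \<open>Lets the gradient of the potential of a ball be bounded through increments of the
  potential, without touching the singular kernel of the gradient.\<close>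

lemma norm_derivative_le_local_lipschitz:
  fixes f :: "'a::real_normed_vector \<Rightarrow> 'b::real_normed_vector"
  assumes D: "(f has_derivative D) (at x)" and "d > 0"
    and lip: "\<And>h. norm h \<le> d \<Longrightarrow> norm (f (x + h) - f x) \<le> C * norm h"
  shows "norm (D v) \<le> C * norm v"
proof (cases "v = 0")
  case True
  then show ?thesis using has_derivative_bounded_linear[OF D] by (simp add: linear_simps)
next
  case False
  have lin: "bounded_linear D" using D by (rule has_derivative_bounded_linear)
  have "norm (D v) / norm v \<le> C + \<epsilon>" if eps: "\<epsilon> > 0" for \<epsilon>
  proof -
    obtain d' where d': "d' > 0" "\<And>y. norm (y - x) < d' \<Longrightarrow> norm (f y - f x - D (y - x)) \<le> \<epsilon> * norm (y - x)"
      using D eps unfolding has_derivative_at_alt by meson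
    define t where "t = min d (d' / 2) / norm v"
    have t: "t > 0" "norm (t *\<^sub>R v) \<le> d" "norm (t *\<^sub>R v) < d'"
      using \<open>d > 0\<close> d'(1) False by (simp_all add: t_def)
    have "t * norm (D v) = norm (D (t *\<^sub>R v))"
      using t(1) by (simp add: linear_scale[OF bounded_linear.linear[OF lin]])
    also have "\<dots> \<le> norm (f (x + t *\<^sub>R v) - f x) + norm (f (x + t *\<^sub>R v) - f x - D (t *\<^sub>R v))"
      using norm_triangle_sub[of "D (t *\<^sub>R v)" "f (x + t *\<^sub>R v) - f x"] by (simp add: norm_minus_commute)
    also have "\<dots> \<le> C * norm (t *\<^sub>R v) + \<epsilon> * norm (t *\<^sub>R v)"
      using lip[OF t(2)] d'(2)[of "x + t *\<^sub>R v"] t(3) by (intro add_mono) auto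
    also have "\<dots> = t * ((C + \<epsilon>) * norm v)" using t(1) by (simp add: algebra_simps)
    finally show ?thesis using t(1) False by (simp add: divide_simps)
  qed
  then have "norm (D v) / norm v \<le> C" by (rule field_le_epsilon)
  then show ?thesis using False by (simp add: divide_simps)
qed

lemma norm_integral_indicator_le:
  fixes f :: "'a::euclidean_space \<Rightarrow> 'b::{banach, second_countable_topology}"
  assumes "B \<in> sets M" "emeasure M B < \<infinity>" "\<And>y. y \<in> B \<Longrightarrow> norm (f y) \<le> C"
  shows "norm (\<integral>y. indicator B y *\<^sub>R f y \<partial>M) \<le> C * measure M B"
proof (cases "integrable M (\<lambda>y. indicator B y *\<^sub>R f y)")
  case True
  have "norm (\<integral>y. indicator B y *\<^sub>R f y \<partial>M) \<le> (\<integral>y. indicator B y * C \<partial>M)"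
  proof (rule Bochner_Integration.integral_norm_bound_integral[OF True])
    show "integrable M (\<lambda>y. indicator B y * C)"
      using assms(1,2) by (intro integrable_mult_left integrable_real_indicator) auto
  qed (use assms(3) in \<open>auto simp: indicator_def\<close>)
  then show ?thesis using assms by (simp add: mult.commute)
next
  case False
  \<comment> \<open>A non-integrable integrand has integral 0 by convention, so only the sign of the
    bound matters; \<open>C\<close> is nonnegative as soon as \<open>B\<close> has a point.\<close>
  have "C * measure M B \<ge> 0"
  proof (cases "B = {}")
    case False
    then obtain y where "y \<in> B" by blast
    with assms(3)[OF this] have "C \<ge> 0" using norm_ge_zero order_trans by blast
    then show ?thesis by simp
  qed simp
  with False show ?thesis by (simp add: not_integrable_integral_eq)
qed

section \<open>Convolution of the kernel with an indicator: value, gradient and divergence\<close>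

lemma continuous_on_regnorm: "continuous_on S (regnorm e)"
  unfolding regnorm_def[abs_def] by (intro continuous_intros)

lemma borel_measurable_regnorm [measurable]: "regnorm e \<in> borel_measurable borel"
  by (rule borel_measurable_continuous_onI) (rule continuous_on_regnorm)

lemma borel_measurable_rfield [measurable]: "rfield e \<in> borel_measurable borel"
  unfolding rfield_def[abs_def] by measurable

lemma borel_measurable_rfield_deriv [measurable]: "(\<lambda>x. rfield_deriv e x v) \<in> borel_measurable borel"
  unfolding rfield_deriv_def by measurable

definition pot :: "real \<Rightarrow> 'a::euclidean_space set \<Rightarrow> 'a \<Rightarrow> 'a"
  where "pot e B x = (\<integral>y. indicator B y *\<^sub>R rfield e (x - y) \<partial>lborel)"

definition dpot :: "real \<Rightarrow> 'a::euclidean_space set \<Rightarrow> 'a \<Rightarrow> 'a \<Rightarrow> 'a"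
  where "dpot e B x v = (\<integral>y. indicator B y *\<^sub>R rfield_deriv e (x - y) v \<partial>lborel)"

text \<open>The integrand carries the trace of \<open>rfield_deriv\<close>, so this is the
  divergence of \<open>pot\<close> (see \<open>dpot_trace\<close>), written with its positive
  kernel.\<close>

definition divpot :: "real \<Rightarrow> 'a::euclidean_space set \<Rightarrow> 'a \<Rightarrow> real"
  where "divpot e B x = (\<integral>y. indicator B y *\<^sub>R (real DIM('a) * e\<^sup>2 / regnorm e (x - y) ^ (DIM('a) + 2)) \<partial>lborel)"

context
  fixes e :: real and B :: "'a::euclidean_space set"
  assumes e: "e > 0" and B [measurable]: "B \<in> sets borel" and finB: "emeasure lborel B < \<infinity>"
begin

lemma inverse_regnorm_le: "1 / regnorm e x ^ m \<le> 1 / e ^ m"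
  using e regnorm_pos[OF e, of x] by (intro divide_left_mono power_mono e_le_regnorm) auto

lemma norm_rfield_le_e: "norm (rfield e (x::'a)) \<le> 1 / e ^ (DIM('a) - 1)"
  using norm_rfield_le[OF e, of x] inverse_regnorm_le[of x "DIM('a) - 1"] by linarith

lemma integrable_pot: "integrable lborel (\<lambda>y. indicator B y *\<^sub>R rfield e (x - y))"
  by (rule integrableI_bounded_set_indicator[where B="1 / e ^ (DIM('a) - 1)"])
    (use finB norm_rfield_le_e in auto)

lemma norm_rfield_deriv_le_e: "norm (rfield_deriv e (x::'a) v) \<le> (real DIM('a) + 1) / e ^ DIM('a) * norm v"
  using norm_rfield_deriv_le[OF e, of x v] mult_left_mono[OF inverse_regnorm_le, of "(real DIM('a) + 1) * norm v" x "DIM('a)"]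
  by simp

lemma integrable_dpot: "integrable lborel (\<lambda>y. indicator B y *\<^sub>R rfield_deriv e (x - y) v)"
  by (rule integrableI_bounded_set_indicator[where B="(real DIM('a) + 1) / e ^ DIM('a) * norm v"])
    (use finB norm_rfield_deriv_le_e in auto)

lemma trace_bound: "\<bar>real DIM('a) * e\<^sup>2 / regnorm e (x::'a) ^ (DIM('a) + 2)\<bar> \<le> real DIM('a) * e\<^sup>2 / e ^ (DIM('a) + 2)"
  using mult_left_mono[OF inverse_regnorm_le, of "real DIM('a) * e\<^sup>2" x "DIM('a) + 2"] e regnorm_pos[OF e, of x]
  by simp

lemma integrable_divpot:
  "integrable lborel (\<lambda>y. indicator B y *\<^sub>R (real DIM('a) * e\<^sup>2 / regnorm e (x - y) ^ (DIM('a) + 2)))"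
  by (rule integrableI_bounded_set_indicator[where B="real DIM('a) * e\<^sup>2 / e ^ (DIM('a) + 2)"])
    (use finB trace_bound in auto)

lemma dpot_add: "dpot e B x (v + w) = dpot e B x v + dpot e B x w"
  unfolding dpot_def by (simp add: rfield_deriv_add scaleR_add_right integrable_dpot Bochner_Integration.integral_add)

lemma dpot_scale: "dpot e B x (c *\<^sub>R v) = c *\<^sub>R dpot e B x v"
  unfolding dpot_def rfield_deriv_scale integral_scaleR_right[symmetric] by (simp add: mult_ac)

lemma norm_dpot_le: "norm (dpot e B x v) \<le> (real DIM('a) + 1) / e ^ DIM('a) * norm v * measure lborel B"
  unfolding dpot_def by (rule norm_integral_indicator_le) (use finB norm_rfield_deriv_le_e in auto)

lemma bounded_linear_dpot: "bounded_linear (dpot e B x)"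
  by (rule bounded_linear_intro[where K="(real DIM('a) + 1) / e ^ DIM('a) * measure lborel B"])
    (use dpot_add dpot_scale norm_dpot_le[of x] in \<open>auto simp: mult_ac\<close>)

lemma dpot_inner: "dpot e B x v \<bullet> w = (\<integral>y. indicator B y * (rfield_deriv e (x - y) v \<bullet> w) \<partial>lborel)"
  unfolding dpot_def integral_inner_left[OF integrable_dpot, symmetric] by simp

lemma dpot_sym: "dpot e B x v \<bullet> w = dpot e B x w \<bullet> v"
  unfolding dpot_inner by (simp add: rfield_deriv_sym[of e _ v w])

lemma dpot_trace: "(\<Sum>b\<in>Basis. dpot e B x b \<bullet> b) = divpot e B x"
proof -
  have "(\<Sum>b\<in>Basis. dpot e B x b \<bullet> b) = (\<Sum>b\<in>Basis. (\<integral>y. (indicator B y *\<^sub>R rfield_deriv e (x - y) b) \<bullet> b \<partial>lborel))"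
    by (simp add: dpot_inner)
  also have "\<dots> = (\<integral>y. (\<Sum>b\<in>Basis. (indicator B y *\<^sub>R rfield_deriv e (x - y) b) \<bullet> b) \<partial>lborel)"
    by (rule Bochner_Integration.integral_sum[symmetric]) (use integrable_inner_left[OF integrable_dpot] in blast)
  also have "\<dots> = divpot e B x"
    unfolding divpot_def
    by (rule Bochner_Integration.integral_cong)
      (simp_all only: inner_scaleR_left real_scaleR_def sum_distrib_left[symmetric] rfield_deriv_trace[OF e])
  finally show ?thesis .
qed

text \<open>The uniform Taylor estimate of the kernel is integrated over \<open>B\<close>, which has
  finite measure.\<close>

lemma pot_taylor:
  "norm (pot e B (x + v) - pot e B x - dpot e B x v)
    \<le> real DIM('a) * (real DIM('a) + 5) / e ^ (DIM('a) + 1) * (norm v)\<^sup>2 * measure lborel B"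
proof -
  have "pot e B (x + v) - pot e B x - dpot e B x v
     = (\<integral>y. indicator B y *\<^sub>R (rfield e ((x - y) + v) - rfield e (x - y) - rfield_deriv e (x - y) v) \<partial>lborel)"
    unfolding pot_def dpot_def scaleR_diff_right
    using integrable_pot[of "x + v"] integrable_pot[of x] integrable_dpot[of x v]
    by (simp add: Bochner_Integration.integral_diff add_diff_eq diff_add_eq)
  moreover have "norm (\<integral>y. indicator B y *\<^sub>R (rfield e ((x - y) + v) - rfield e (x - y) - rfield_deriv e (x - y) v) \<partial>lborel)
    \<le> real DIM('a) * (real DIM('a) + 5) / e ^ (DIM('a) + 1) * (norm v)\<^sup>2 * measure lborel B"
    by (rule norm_integral_indicator_le) (use rfield_taylor[OF e, where 'a='a] finB in auto)
  ultimately show ?thesis by simp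
qed

lemma has_derivative_pot: "(pot e B has_derivative dpot e B x) (at x)"
  by (rule has_derivative_quadraticI[OF bounded_linear_dpot,
      where C="real DIM('a) * (real DIM('a) + 5) / e ^ (DIM('a) + 1) * measure lborel B"])
    (use pot_taylor in \<open>simp add: mult_ac\<close>)

lemma dpot_diff_le:
  assumes "\<And>y. y \<in> B \<Longrightarrow> norm (rfield_deriv e (x - y) v - rfield_deriv e (z - y) v) \<le> C"
  shows "norm (dpot e B x v - dpot e B z v) \<le> C * measure lborel B"
proof -
  have "dpot e B x v - dpot e B z v = (\<integral>y. indicator B y *\<^sub>R (rfield_deriv e (x - y) v - rfield_deriv e (z - y) v) \<partial>lborel)"
    unfolding dpot_def by (simp add: integrable_dpot Bochner_Integration.integral_diff[symmetric] scaleR_diff_right[symmetric])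
  then show ?thesis
    using norm_integral_indicator_le[of B lborel "\<lambda>y. rfield_deriv e (x - y) v - rfield_deriv e (z - y) v" C] assms finB by simp
qed

lemma dpot_lipschitz:
  "norm (dpot e B x v - dpot e B z v)
    \<le> real DIM('a) * (real DIM('a) + 5) * norm v / e ^ (DIM('a) + 1) * norm (x - z) * measure lborel B"
proof (rule dpot_diff_le)
  show "norm (rfield_deriv e (x - y) v - rfield_deriv e (z - y) v)
      \<le> real DIM('a) * (real DIM('a) + 5) * norm v / e ^ (DIM('a) + 1) * norm (x - z)" for y
    using rfield_deriv_lipschitz_global[OF e, where x="x - y" and y="z - y" and v=v] by simp
qed

lemma divpot_nonneg: "divpot e B x \<ge> 0"
  unfolding divpot_def
  by (rule Bochner_Integration.integral_nonneg) (simp add: less_imp_le[OF regnorm_pos[OF e]])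

text \<open>On the ball of radius \<open>e\<close> the regularised norm is at most 2 e, so the
  kernel is at least n e^2 / (2 e)^(n+2); multiplied by the volume of the ball this is free of
  \<open>e\<close>. It is the source of the constant \<open>c\<close> on \<open>K\<close>.\<close>

lemma divpot_ge:
  assumes "cball x e \<subseteq> B"
  shows "divpot e B x \<ge> real DIM('a) * unit_ball_vol (real DIM('a)) / 2 ^ (DIM('a) + 2)"
proof -
  have "(\<integral>y. indicator (cball x e) y *\<^sub>R (real DIM('a) * e\<^sup>2 / (2 * e) ^ (DIM('a) + 2)) \<partial>lborel) \<le> divpot e B x"
    unfolding divpot_def
  proof (rule integral_mono)
    show "integrable lborel (\<lambda>y. indicator (cball x e) y *\<^sub>R (real DIM('a) * e\<^sup>2 / (2 * e) ^ (DIM('a) + 2)))"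
      using e by (intro integrable_scaleR_left integrable_real_indicator) (auto simp: emeasure_cball_euclidean)
    show "integrable lborel (\<lambda>y. indicator B y *\<^sub>R (real DIM('a) * e\<^sup>2 / regnorm e (x - y) ^ (DIM('a) + 2)))"
      by (rule integrable_divpot)
    fix y
    have r: "regnorm e (x - y) > 0" by (rule regnorm_pos[OF e])
    show "indicator (cball x e) y *\<^sub>R (real DIM('a) * e\<^sup>2 / (2 * e) ^ (DIM('a) + 2))
      \<le> indicator B y *\<^sub>R (real DIM('a) * e\<^sup>2 / regnorm e (x - y) ^ (DIM('a) + 2))"
    proof (cases "y \<in> cball x e")
      case True
      have "regnorm e (x - y) \<le> 2 * e"
        using regnorm_le[of e "x - y"] e True by (simp add: dist_norm)
      then have "real DIM('a) * e\<^sup>2 / (2 * e) ^ (DIM('a) + 2) \<le> real DIM('a) * e\<^sup>2 / regnorm e (x - y) ^ (DIM('a) + 2)"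
        using r e by (intro divide_left_mono power_mono mult_pos_pos zero_less_power) auto
      then show ?thesis using True assms by (auto simp: indicator_def)
    next
      case False
      then show ?thesis using r by (simp add: indicator_def)
    qed
  qed
  moreover have "(\<integral>y. indicator (cball x e) y *\<^sub>R (real DIM('a) * e\<^sup>2 / (2 * e) ^ (DIM('a) + 2)) \<partial>lborel)
     = real DIM('a) * unit_ball_vol (real DIM('a)) / 2 ^ (DIM('a) + 2)"
    using e by (simp add: content_cball power_mult_distrib power_add power2_eq_square)
  ultimately show ?thesis by simp
qed

text \<open>Split at distance \<rho>: the near part integrates to O(\<rho>), and the far part is at
  most the measure of \<open>B\<close> times \<rho>^(1-n). Sets of measure O(\<rho>^n) therefore
  have a field of size O(\<rho>), whatever their shape and whatever \<open>e\<close>.\<close>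

lemma norm_pot_le:
  assumes "\<rho> > 0"
  shows "norm (pot e B x) \<le> 2 ^ DIM('a) * unit_ball_vol (real DIM('a)) * \<rho> + measure lborel B / \<rho> ^ (DIM('a) - 1)"
proof -
  let ?m = "DIM('a) - 1"
  let ?f = "\<lambda>z. ennreal (1 / norm (z::'a) ^ ?m) * indicator (cball 0 \<rho>) z"
  have f: "?f \<in> borel_measurable borel"
      by (intro borel_measurable_times_ennreal borel_measurable_indicator) auto
  have w: "unit_ball_vol (real DIM('a)) \<ge> 0" by (simp add: less_imp_le)
  have pw: "norm (rfield e z) \<le> (if norm z \<le> \<rho> then 1 / norm z ^ ?m else 1 / \<rho> ^ ?m)" if "z \<noteq> 0" for z :: 'a
  proof -
    have r: "regnorm e z > 0" by (rule regnorm_pos[OF e])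
    have 1: "1 / regnorm e z ^ ?m \<le> 1 / norm z ^ ?m"
      using that r by (intro divide_left_mono power_mono norm_le_regnorm) auto
    moreover have "1 / norm z ^ ?m \<le> 1 / \<rho> ^ ?m" if "\<not> norm z \<le> \<rho>"
      using that assms by (intro divide_left_mono power_mono mult_pos_pos zero_less_power) auto
    ultimately show ?thesis using norm_rfield_le[OF e, of z] by (auto intro: order_trans)
  qed
  have "ennreal (norm (pot e B x)) \<le> (\<integral>\<^sup>+y. ennreal (norm (indicator B y *\<^sub>R rfield e (x - y))) \<partial>lborel)"
    unfolding pot_def by (rule integral_norm_bound_ennreal[OF integrable_pot])
  also have "\<dots> \<le> (\<integral>\<^sup>+y. ?f (x - y) + ennreal (1 / \<rho> ^ ?m) * indicator B y \<partial>lborel)"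
  proof (rule nn_integral_mono_AE)
    have "AE y in lborel. y \<noteq> x" by (rule AE_lborel_singleton)
    then show "AE y in lborel. ennreal (norm (indicator B y *\<^sub>R rfield e (x - y))) \<le> ?f (x - y) + ennreal (1 / \<rho> ^ ?m) * indicator B y"
    proof eventually_elim
      case (elim y)
      show ?case
      proof (cases "y \<in> B")
        case True
        have "ennreal (norm (rfield e (x - y))) \<le> ennreal (if norm (x - y) \<le> \<rho> then 1 / norm (x - y) ^ ?m else 1 / \<rho> ^ ?m)"
          using elim by (intro ennreal_leI pw) auto
        then show ?thesis using True by (auto split: if_splits intro: order_trans add_increasing2)
      qed simp
    qed
  qed
  also have "\<dots> = (\<integral>\<^sup>+y. ?f (x - y) \<partial>lborel) + ennreal (1 / \<rho> ^ ?m) * emeasure lborel B"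
  proof -
    have "(\<lambda>y. ?f (x - y)) \<in> borel_measurable borel"
      using measurable_compose[OF _ f, of "\<lambda>y. x - y" borel] by simp
    then show ?thesis by (subst nn_integral_add) (auto simp: nn_integral_cmult_indicator)
  qed
  also have "(\<integral>\<^sup>+y. ?f (x - y) \<partial>lborel) = (\<integral>\<^sup>+y. ?f y \<partial>lborel)"
    by (subst nn_integral_affine_euclidean[OF f, where c="-1" and t=x]) auto
  also have "(\<integral>\<^sup>+y. ?f y \<partial>lborel) + ennreal (1 / \<rho> ^ ?m) * emeasure lborel B
    \<le> ennreal (2 ^ DIM('a) * unit_ball_vol (real DIM('a)) * \<rho>) + ennreal (1 / \<rho> ^ ?m) * emeasure lborel B"
    by (intro add_right_mono nn_integral_inside_ball assms)
  also have "emeasure lborel B = ennreal (measure lborel B)"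
    using finB by (intro emeasure_eq_ennreal_measure) auto
  also have "ennreal (2 ^ DIM('a) * unit_ball_vol (real DIM('a)) * \<rho>) + ennreal (1 / \<rho> ^ ?m) * ennreal (measure lborel B)
     = ennreal (2 ^ DIM('a) * unit_ball_vol (real DIM('a)) * \<rho> + measure lborel B / \<rho> ^ ?m)"
    using assms w by (simp add: ennreal_mult[symmetric] ennreal_plus[symmetric] del: ennreal_plus)
  finally show ?thesis using assms w by (subst (asm) ennreal_le_iff) (auto intro!: add_nonneg_nonneg)
qed

end

section \<open>Oscillation of the gradient on balls contained in the set\<close>

lemma dpot_union:
  fixes A B :: "'a::euclidean_space set"
  assumes "e > 0" "A \<in> sets borel" "emeasure lborel A < \<infinity>" "B \<in> sets borel" "emeasure lborel B < \<infinity>" "A \<inter> B = {}"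
  shows "dpot e (A \<union> B) x v = dpot e A x v + dpot e B x v"
proof -
  have "indicator (A \<union> B) y = (indicator A y + indicator B y :: real)" for y
    using assms(6) by (auto simp: indicator_def)
  then show ?thesis
    unfolding dpot_def using integrable_dpot[OF assms(1-3)] integrable_dpot[OF assms(1,4,5)]
    by (simp add: scaleR_add_left Bochner_Integration.integral_add)
qed

lemma power_diff_le_mult:
  fixes a b c :: real
  assumes "0 \<le> b" "b \<le> a" "a \<le> c"
  shows "a ^ n - b ^ n \<le> real n * (a - b) * c ^ (n - 1)"
proof (induction n)
  case (Suc n)
  have c: "c \<ge> 0" using assms by linarith
  have "a ^ Suc n - b ^ Suc n = a * (a ^ n - b ^ n) + (a - b) * b ^ n" by (simp add: algebra_simps)
  also have "\<dots> \<le> a * (real n * (a - b) * c ^ (n - 1)) + (a - b) * c ^ n"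
    using assms Suc by (intro add_mono mult_left_mono power_mono) auto
  also have "\<dots> \<le> real n * (a - b) * c ^ n + (a - b) * c ^ n"
  proof (cases n)
    case (Suc m)
    have "a * (real n * (a - b) * c ^ m) \<le> c * (real n * (a - b) * c ^ m)"
      using assms c by (intro mult_right_mono) auto
    then show ?thesis using Suc by (simp add: mult_ac)
  qed simp
  also have "\<dots> = real (Suc n) * (a - b) * c ^ (Suc n - 1)" by (simp add: algebra_simps)
  finally show ?case .
qed simp

text \<open>Kernel bound (2 / s)^(n-1) on a shell, times the shell volume, at most n (3 s)^(n-1)
  times the thickness 2 |h| and the volume of the unit ball; the radius cancels.\<close>

definition lip_ball :: "'a::euclidean_space itself \<Rightarrow> real"
  where "lip_ball _ = 2 * real DIM('a) * unit_ball_vol (real DIM('a)) * 6 ^ (DIM('a) - 1)"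

text \<open>Moving the point is the same as moving the ball, which only changes the domain of integration
  in a thin shell, where the kernel is not singular.\<close>

lemma norm_dpot_cball_le:
  fixes c :: "'a::euclidean_space"
  assumes e: "e > 0" and s: "s > 0" and x: "norm (x - c) \<le> s"
  shows "norm (dpot e (cball c (2 * s)) x v) \<le> lip_ball TYPE('a) * norm v"
proof (rule norm_derivative_le_local_lipschitz)
  let ?B = "cball c (2 * s)" and ?w = "unit_ball_vol (real DIM('a))"
  have w: "?w \<ge> 0" by (simp add: less_imp_le)
  have B: "?B \<in> sets borel" "emeasure lborel ?B < \<infinity>"
    using s by (simp_all add: emeasure_cball_euclidean)
  show "(pot e ?B has_derivative dpot e ?B x) (at x)"
    by (rule has_derivative_pot[OF e B])
  show "s / 2 > 0" using s by simp
  fix h :: 'a assume h: "norm h \<le> s / 2"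
  let ?f = "\<lambda>y. indicator ?B y *\<^sub>R rfield e (x + h - y)"
  have m: "?f \<in> borel_measurable borel"
    by (intro borel_measurable_scaleR borel_measurable_indicator) (auto intro!: measurable_compose[OF _ borel_measurable_rfield])
  have i: "integrable lborel (\<lambda>y. ?f (h + 1 *\<^sub>R y))"
    by (subst lborel_integrable_isometry[OF m]) (use integrable_pot[OF e B] in auto)
  \<comment> \<open>Translating the variable by \<open>h\<close> restores the kernel
    \<open>rfield e (x - y)\<close> and moves the shift into the indicator.\<close>
  have "pot e ?B (x + h) = (\<integral>y. ?f (h + 1 *\<^sub>R y) \<partial>lborel)"
    unfolding pot_def by (subst lborel_integral_isometry[OF m]) auto
  then have "pot e ?B (x + h) - pot e ?B x
     = (\<integral>y. ?f (h + 1 *\<^sub>R y) - indicator ?B y *\<^sub>R rfield e (x - y) \<partial>lborel)"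
    unfolding pot_def using i integrable_pot[OF e B, of x] by (simp add: Bochner_Integration.integral_diff)
  \<comment> \<open>Off this shell the indicators of the ball and of its translate agree. On it the
    distance to \<open>x\<close> is at least 2 s - s / 2 - s = s / 2, by the restriction on
    \<open>h\<close>.\<close>
  define S where "S = cball c (2 * s + norm h) - ball c (2 * s - norm h)"
  have S1: "S \<in> sets borel" unfolding S_def by simp
  have "emeasure lborel S \<le> emeasure lborel (cball c (2 * s + norm h))"
    unfolding S_def by (rule emeasure_mono) auto
  also have "\<dots> < \<infinity>" using s by (simp add: emeasure_cball_euclidean)
  finally have S: "S \<in> sets borel" "emeasure lborel S < \<infinity>" using S1 by auto
  have eq: "?f (h + 1 *\<^sub>R y) - indicator ?B y *\<^sub>R rfield e (x - y)
     = indicator S y *\<^sub>R ((indicator ?B (h + y) - indicator ?B y) *\<^sub>R rfield e (x - y))" for y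
  proof -
    have "(indicator ?B (h + y) :: real) = indicator ?B y" if "y \<notin> S"
    proof -
      have "y \<notin> cball c (2 * s + norm h) \<or> y \<in> ball c (2 * s - norm h)"
        using that unfolding S_def by blast
      then consider "norm (y - c) > 2 * s + norm h" | "norm (y - c) < 2 * s - norm h"
        unfolding mem_cball mem_ball dist_norm norm_minus_commute[of c y] by linarith
      then show ?thesis
      proof cases
        case 1
        have "norm (y - c) \<le> norm (h + y - c) + norm h"
          using norm_triangle_ineq4[of "h + y - c" h] by (simp add: algebra_simps)
        with 1 have "h + y \<notin> ?B" "y \<notin> ?B" using norm_ge_zero[of h]
          unfolding mem_cball dist_norm norm_minus_commute[of c] by linarith+
        then show ?thesis by (simp only: indicator_def)
      next
        case 2
        have "norm (h + y - c) \<le> norm (y - c) + norm h"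
          using norm_triangle_ineq[of "y - c" h] by (simp add: algebra_simps)
        with 2 have "h + y \<in> ?B" "y \<in> ?B" using norm_ge_zero[of h]
          unfolding mem_cball dist_norm norm_minus_commute[of c] by linarith+
        then show ?thesis by (simp only: indicator_def)
      qed
    qed
    then show ?thesis by (cases "y \<in> S") (simp_all add: scaleR_diff_left)
  qed
  have 1: "norm (pot e ?B (x + h) - pot e ?B x) \<le> (2 / s) ^ (DIM('a) - 1) * measure lborel S"
    unfolding \<open>pot e ?B (x + h) - pot e ?B x = _\<close> eq
  proof (rule norm_integral_indicator_le)
    fix y assume "y \<in> S"
    then have "norm (y - c) \<ge> 2 * s - norm h" by (auto simp: S_def dist_norm norm_minus_commute)
    moreover have "norm (y - c) \<le> norm (x - y) + norm (x - c)"
      using norm_triangle_ineq4[of "x - c" "x - y"] by simp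
    ultimately have "norm (x - y) \<ge> s / 2" using x h by linarith
    then have r: "regnorm e (x - y) \<ge> s / 2" using norm_le_regnorm[of "x - y" e] by linarith
    have "norm ((indicator ?B (h + y) - indicator ?B y :: real) *\<^sub>R rfield e (x - y)) \<le> norm (rfield e (x - y))"
      by (auto simp: indicator_def)
    also have "\<dots> \<le> 1 / regnorm e (x - y) ^ (DIM('a) - 1)" by (rule norm_rfield_le[OF e])
    also have "\<dots> \<le> 1 / (s / 2) ^ (DIM('a) - 1)"
      using r s by (intro divide_left_mono power_mono mult_pos_pos zero_less_power) auto
    finally show "norm ((indicator ?B (h + y) - indicator ?B y :: real) *\<^sub>R rfield e (x - y)) \<le> (2 / s) ^ (DIM('a) - 1)"
      by (simp add: power_divide)
  qed (use S in auto)
  have "measure lborel S = measure lborel (cball c (2 * s + norm h)) - measure lborel (ball c (2 * s - norm h))"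
  proof -
    have "ball c (2 * s - norm h) \<subseteq> cball c (2 * s + norm h)"
      using norm_ge_zero[of h] by (intro order_trans[OF ball_subset_cball subset_cball]) linarith
    then show ?thesis unfolding S_def using h s by (intro measure_Diff) (simp_all add: emeasure_cball_euclidean)
  qed
  also have "\<dots> = ?w * ((2 * s + norm h) ^ DIM('a) - (2 * s - norm h) ^ DIM('a))"
    using h s by (simp add: content_cball content_ball algebra_simps)
  also have "\<dots> \<le> ?w * (real DIM('a) * ((2 * s + norm h) - (2 * s - norm h)) * (3 * s) ^ (DIM('a) - 1))"
    using h s w by (intro mult_left_mono power_diff_le_mult) auto
  finally have 2: "measure lborel S \<le> ?w * (real DIM('a) * (2 * norm h) * (3 * s) ^ (DIM('a) - 1))" by simp
  have "(2 / s) ^ (DIM('a) - 1) * measure lborel S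
      \<le> (2 / s) ^ (DIM('a) - 1) * (?w * (real DIM('a) * (2 * norm h) * (3 * s) ^ (DIM('a) - 1)))"
    using s by (intro mult_left_mono[OF 2]) simp
  also have "\<dots> = ((2 / s) ^ (DIM('a) - 1) * (3 * s) ^ (DIM('a) - 1)) * (2 * real DIM('a) * ?w * norm h)"
    by (simp only: mult_ac)
  also have "(2 / s) ^ (DIM('a) - 1) * (3 * s) ^ (DIM('a) - 1) = 6 ^ (DIM('a) - 1)"
  proof -
    have "(2 / s) * (3 * s) = 6" using s by simp
    then show ?thesis by (simp only: power_mult_distrib[symmetric])
  qed
  also have "6 ^ (DIM('a) - 1) * (2 * real DIM('a) * ?w * norm h) = lip_ball TYPE('a) * norm h"
    by (simp add: lip_ball_def)
  finally show "norm (pot e ?B (x + h) - pot e ?B x) \<le> lip_ball TYPE('a) * norm h"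
    using 1 by linarith
qed

definition osc_far :: "'a::euclidean_space itself \<Rightarrow> real"
  where "osc_far _ = real DIM('a) * (real DIM('a) + 5) * 2 ^ (DIM('a) + 1) * (2 ^ (DIM('a) + 1) * decay_integral TYPE('a))"

text \<open>The Hormander smoothness condition for the gradient kernel: a displacement of at most 2
  s changes it by O(s / |y - c|^(n+1)), and integrating this outside the ball of radius 2 s cancels
  \<open>s\<close>.\<close>

lemma dpot_far_osc:
  fixes c :: "'a::euclidean_space"
  assumes e: "e > 0" and s: "s > 0" and x: "norm (x - c) \<le> s" and z: "norm (z - c) \<le> s"
    and B: "B \<in> sets borel" "emeasure lborel B < \<infinity>" and far: "\<And>y. y \<in> B \<Longrightarrow> 2 * s \<le> norm (y - c)"
  shows "norm (dpot e B x v - dpot e B z v) \<le> osc_far TYPE('a) * norm v"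
proof -
  let ?n = "DIM('a)"
  define K where "K = real ?n * (real ?n + 5) * norm v * 2 ^ (?n + 1) * (2 * s)"
  have K: "K \<ge> 0" using s by (simp add: K_def)
  have pw: "norm (rfield_deriv e (x - y) v - rfield_deriv e (z - y) v) \<le> K * (1 / norm (y - c) ^ (?n + 1))" if y: "y \<in> B" for y
  proof -
    have yp: "norm (y - c) > 0" using far[OF y] s by linarith
    have "norm (rfield_deriv e (x - y) v - rfield_deriv e (z - y) v)
      \<le> real ?n * (real ?n + 5) * norm v / (norm (y - c) / 2) ^ (?n + 1) * norm ((x - y) - (z - y))"
    proof (rule rfield_deriv_lipschitz[OF e])
      show "norm (y - c) / 2 > 0" using yp by simp
      fix p assume p: "p \<in> closed_segment (x - y) (z - y)"
      \<comment> \<open>The segment between \<open>x\<close> and \<open>z\<close> stays within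
        \<open>s\<close> of \<open>c\<close>, while \<open>y\<close> is at least 2 s away; so |p| is
        at least half of |y - c|.\<close>
      have "p + y \<in> closed_segment x z"
        using p closed_segment_translation[of y "x - y" "z - y"] by (force simp: add.commute)
      moreover have "closed_segment x z \<subseteq> cball c s"
        using x z by (intro closed_segment_subset) (auto simp: dist_norm norm_minus_commute)
      ultimately have "norm (p + y - c) \<le> s" by (auto simp: dist_norm norm_minus_commute)
      moreover have "norm (y - c) \<le> norm (p + y - c) + norm p"
        using norm_triangle_ineq4[of "p + y - c" p] by (simp add: algebra_simps)
      ultimately show "norm (y - c) / 2 \<le> regnorm e p"
        using far[OF y] norm_le_regnorm[of p e] by linarith
    qed
    also have "\<dots> \<le> real ?n * (real ?n + 5) * norm v / (norm (y - c) / 2) ^ (?n + 1) * (2 * s)"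
    proof (intro mult_left_mono)
      show "norm ((x - y) - (z - y)) \<le> 2 * s"
        using norm_triangle_ineq4[of "x - c" "z - c"] x z by simp
    qed auto
    also have "\<dots> = K * (1 / norm (y - c) ^ (?n + 1))"
      by (simp add: K_def power_divide)
    finally show ?thesis .
  qed
  have meas: "(\<lambda>y::'a. ennreal (1 / norm (y - c) ^ (?n + 1)) * indicator {y. 2 * s \<le> norm (y - c)} y) \<in> borel_measurable borel"
    by (intro borel_measurable_times_ennreal borel_measurable_indicator) auto
  have "dpot e B x v - dpot e B z v = (\<integral>y. indicator B y *\<^sub>R (rfield_deriv e (x - y) v - rfield_deriv e (z - y) v) \<partial>lborel)"
    unfolding dpot_def by (simp add: integrable_dpot[OF e B] Bochner_Integration.integral_diff[symmetric] scaleR_diff_right[symmetric])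
  moreover have "integrable lborel (\<lambda>y. indicator B y *\<^sub>R (rfield_deriv e (x - y) v - rfield_deriv e (z - y) v))"
    unfolding scaleR_diff_right by (intro Bochner_Integration.integrable_diff integrable_dpot[OF e B])
  ultimately have "ennreal (norm (dpot e B x v - dpot e B z v))
      \<le> (\<integral>\<^sup>+y. ennreal (norm (indicator B y *\<^sub>R (rfield_deriv e (x - y) v - rfield_deriv e (z - y) v))) \<partial>lborel)"
    using integral_norm_bound_ennreal by metis
  also have "\<dots> \<le> (\<integral>\<^sup>+y. ennreal K * (ennreal (1 / norm (y - c) ^ (?n + 1)) * indicator {y. 2 * s \<le> norm (y - c)} y) \<partial>lborel)"
  proof (rule nn_integral_mono)
    fix y
    show "ennreal (norm (indicator B y *\<^sub>R (rfield_deriv e (x - y) v - rfield_deriv e (z - y) v)))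
       \<le> ennreal K * (ennreal (1 / norm (y - c) ^ (?n + 1)) * indicator {y. 2 * s \<le> norm (y - c)} y)"
    proof (cases "y \<in> B")
      case True
      then show ?thesis using ennreal_leI[OF pw[OF True]] far[OF True] K
        by (simp add: ennreal_mult[symmetric])
    qed simp
  qed
  also have "\<dots> = ennreal K * (\<integral>\<^sup>+y. ennreal (1 / norm (y - c) ^ (?n + 1)) * indicator {y. 2 * s \<le> norm (y - c)} y \<partial>lborel)"
    by (rule nn_integral_cmult) (use meas in simp)
  also have "\<dots> \<le> ennreal K * ennreal (2 ^ (?n + 1) * decay_integral TYPE('a) / (2 * s))"
    by (intro mult_left_mono nn_integral_outside_ball) (use s in auto)
  also have "\<dots> = ennreal (osc_far TYPE('a) * norm v)"
    using K s decay_integral_nonneg[where 'a='a]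
    by (simp add: ennreal_mult[symmetric] K_def osc_far_def mult_ac)
  finally show ?thesis
    using decay_integral_nonneg[where 'a='a] by (subst (asm) ennreal_le_iff) (auto simp: osc_far_def)
qed

definition osc_const :: "'a::euclidean_space itself \<Rightarrow> real"
  where "osc_const _ = 2 * lip_ball TYPE('a) + osc_far TYPE('a)"

lemma lip_ball_nonneg: "lip_ball TYPE('a::euclidean_space) \<ge> 0"
  by (simp add: lip_ball_def less_imp_le)

lemma osc_far_nonneg: "osc_far TYPE('a::euclidean_space) \<ge> 0"
  by (simp add: osc_far_def decay_integral_nonneg)

lemma osc_const_nonneg: "osc_const TYPE('a::euclidean_space) \<ge> 0"
  by (simp add: osc_const_def lip_ball_nonneg osc_far_nonneg)

text \<open>The part of \<open>B\<close> in the ball of radius 2 s contributes a bounded gradient at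
  both points, the rest a bounded difference. The gradient itself may be large, but its oscillation
  is bounded by a dimensional constant wherever \<open>B\<close> contains the doubled ball.\<close>

lemma dpot_osc:
  fixes c :: "'a::euclidean_space"
  assumes e: "e > 0" and s: "s > 0" and x: "norm (x - c) \<le> s" and z: "norm (z - c) \<le> s"
    and B: "B \<in> sets borel" "emeasure lborel B < \<infinity>" and sub: "cball c (2 * s) \<subseteq> B"
  shows "norm (dpot e B x v - dpot e B z v) \<le> osc_const TYPE('a) * norm v"
proof -
  let ?A = "cball c (2 * s)"
  have A: "?A \<in> sets borel" "emeasure lborel ?A < \<infinity>"
    using s by (simp_all add: emeasure_cball_euclidean)
  have C: "B - ?A \<in> sets borel" "emeasure lborel (B - ?A) < \<infinity>"
    using B A le_less_trans[OF emeasure_mono[of "B - ?A" B lborel]] by auto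
  have eq: "dpot e B p v = dpot e ?A p v + dpot e (B - ?A) p v" for p
    using dpot_union[OF e A C, of p v] sub by (simp add: Un_absorb1)
  have far: "2 * s \<le> norm (y - c)" if "y \<in> B - ?A" for y
    using that by (simp add: dist_norm norm_minus_commute)
  have "dpot e B x v - dpot e B z v
    = (dpot e ?A x v - dpot e ?A z v) + (dpot e (B - ?A) x v - dpot e (B - ?A) z v)"
    using eq[of x] eq[of z] by (simp only: add_diff_add)
  then have "norm (dpot e B x v - dpot e B z v)
     \<le> norm (dpot e ?A x v - dpot e ?A z v) + norm (dpot e (B - ?A) x v - dpot e (B - ?A) z v)"
    by (simp only: norm_triangle_ineq)
  also have "\<dots> \<le> (norm (dpot e ?A x v) + norm (dpot e ?A z v)) + osc_far TYPE('a) * norm v"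
    by (rule add_mono[OF norm_triangle_ineq4 dpot_far_osc[OF e s x z C far]])
  also have "\<dots> \<le> (lip_ball TYPE('a) * norm v + lip_ball TYPE('a) * norm v) + osc_far TYPE('a) * norm v"
    by (intro add_right_mono add_mono norm_dpot_cball_le[OF e s x] norm_dpot_cball_le[OF e s z])
  finally show ?thesis by (simp add: osc_const_def algebra_simps)
qed

section \<open>The energy identity\<close>

lemma integrable_decay_power:
  assumes "DIM('a) + 1 \<le> m"
  shows "integrable lborel (\<lambda>x::'a::euclidean_space. C / (1 + norm x) ^ m)"
proof -
  have "integrable lborel (\<lambda>x::'a. 1 / (1 + norm x) ^ m)"
  proof (rule Bochner_Integration.integrable_bound[OF integrable_decay])
    have "(1 + norm x) ^ (DIM('a) + 1) \<le> (1 + norm x) ^ m" for x :: 'a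
      by (rule power_increasing[OF assms]) simp
    then have "1 / (1 + norm x) ^ m \<le> 1 / (1 + norm x) ^ (DIM('a) + 1)" for x :: 'a
      by (intro divide_left_mono mult_pos_pos zero_less_power add_pos_nonneg) auto
    then show "AE x::'a in lborel. norm (1 / (1 + norm x) ^ m) \<le> norm (1 / (1 + norm x) ^ (DIM('a) + 1))"
      by (intro AE_I2) (simp del: power_Suc)
  qed measurable
  then show ?thesis using integrable_mult_right[of C lborel "\<lambda>x::'a. 1 / (1 + norm x) ^ m"] by simp
qed

definition shift_diff :: "('a::real_normed_vector \<Rightarrow> real) \<Rightarrow> 'a \<Rightarrow> 'a \<Rightarrow> real"
  where "shift_diff a s x = a (x + s) - a x"

text \<open>The decay rates are those of a Newtonian field and its gradient. A product of a function
  and a derivative decays like |x|^(1-2n), which is integrable at infinity when n is at least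
  2.\<close>

locale decaying =
  fixes a :: "'a::euclidean_space \<Rightarrow> real" and a' :: "'a \<Rightarrow> 'a \<Rightarrow> real" and P :: real
  assumes deriv: "(a has_derivative a' x) (at x)"
    and meas': "(\<lambda>x. a' x v) \<in> borel_measurable borel"
    and P: "P \<ge> 0"
    and bound: "\<bar>a x\<bar> \<le> P / (1 + norm x) ^ (DIM('a) - 1)"
    and bound': "\<bar>a' x v\<bar> \<le> P * norm v / (1 + norm x) ^ DIM('a)"
begin

lemma meas: "a \<in> borel_measurable borel"
  by (rule borel_measurable_continuous_onI)
    (meson continuous_at_imp_continuous_on deriv has_derivative_continuous)

lemma meas_diff: "shift_diff a s \<in> borel_measurable borel"
  unfolding shift_diff_def[abs_def]
  by (intro borel_measurable_diff measurable_compose[OF _ meas]) auto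

text \<open>A shift of length at most 1 changes 1 + |x| by a factor of at most 2, which costs 2^n in
  the decay of the derivative along the segment.\<close>

lemma shift_diff_bound:
  assumes "norm s \<le> 1"
  shows "\<bar>shift_diff a s x\<bar> \<le> P * 2 ^ DIM('a) * norm s / (1 + norm x) ^ DIM('a)"
proof -
  let ?K = "P * 2 ^ DIM('a) / (1 + norm x) ^ DIM('a)"
  have "norm (a (x + s) - a x) \<le> ?K * norm ((x + s) - x)"
  proof (rule differentiable_bound[where S="closed_segment x (x + s)" and f'=a'])
    fix z :: 'a assume "z \<in> closed_segment x (x + s)"
    then have "norm (z - x) \<le> 1" using segment_bound(1)[of z x "x + s"] assms by simp
    then have "norm x \<le> 1 + norm z" using norm_triangle_ineq4[of z "z - x"] by simp
    then have "1 + norm x \<le> 2 + norm z" by simp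
    also have "\<dots> \<le> 2 * (1 + norm z)" by simp
    finally have "1 + norm x \<le> 2 * (1 + norm z)" .
    then have k: "(1 + norm x) ^ DIM('a) \<le> 2 ^ DIM('a) * (1 + norm z) ^ DIM('a)"
      unfolding power_mult_distrib[symmetric] by (intro power_mono) auto
    show "onorm (a' z) \<le> ?K"
    proof (rule onorm_le)
      fix v :: 'a
      have "1 / (1 + norm z) ^ DIM('a) \<le> 2 ^ DIM('a) / (1 + norm x) ^ DIM('a)"
        using k by (intro one_divide_le zero_less_power add_pos_nonneg) auto
      then have "P * norm v * (1 / (1 + norm z) ^ DIM('a)) \<le> P * norm v * (2 ^ DIM('a) / (1 + norm x) ^ DIM('a))"
        using P by (intro mult_left_mono) auto
      then show "norm (a' z v) \<le> ?K * norm v" using bound'[of z v] by (simp add: mult_ac)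
    qed
  qed (auto intro: has_derivative_at_withinI deriv)
  then show ?thesis by (simp add: shift_diff_def)
qed

lemma shift_diff_bound1:
  assumes "norm s \<le> 1"
  shows "\<bar>shift_diff a s x\<bar> \<le> P * 2 ^ DIM('a) / (1 + norm x) ^ DIM('a)"
proof -
  have "P * 2 ^ DIM('a) * norm s / (1 + norm x) ^ DIM('a) \<le> P * 2 ^ DIM('a) * 1 / (1 + norm x) ^ DIM('a)"
    using assms P by (intro divide_right_mono mult_left_mono) auto
  then show ?thesis using shift_diff_bound[OF assms, of x] by simp
qed

lemma shift_diff_tendsto:
  "(\<lambda>m. shift_diff a ((1 / real (Suc m)) *\<^sub>R v) x / (1 / real (Suc m))) \<longlonglongrightarrow> a' x v"
proof -
  have lin: "linear (a' x)" using deriv has_derivative_linear by blast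
  have "((\<lambda>t. a (x + t *\<^sub>R v)) has_derivative (\<lambda>t. a' x (t *\<^sub>R v))) (at 0)"
  proof -
    have 1: "((\<lambda>t. x + t *\<^sub>R v) has_derivative (\<lambda>t. t *\<^sub>R v)) (at 0)"
      by (auto intro!: derivative_eq_intros)
    have 2: "(a has_derivative a' x) (at (x + 0 *\<^sub>R v))" using deriv by simp
    show ?thesis using has_derivative_compose[OF 1 2] .
  qed
  then have "((\<lambda>t. a (x + t *\<^sub>R v)) has_field_derivative a' x v) (at 0)"
    unfolding has_field_derivative_def by (simp add: linear_scale[OF lin] mult_commute_abs)
  then have "((\<lambda>h. (a (x + (0 + h) *\<^sub>R v) - a (x + 0 *\<^sub>R v)) / h) \<longlongrightarrow> a' x v) (at 0)"
    by (rule DERIV_D)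
  moreover have "filterlim (\<lambda>m. 1 / real (Suc m)) (at 0) sequentially"
    unfolding filterlim_at using LIMSEQ_inverse_real_of_nat by (simp add: inverse_eq_divide)
  ultimately have "(\<lambda>m. (a (x + (0 + 1 / real (Suc m)) *\<^sub>R v) - a (x + 0 *\<^sub>R v)) / (1 / real (Suc m))) \<longlonglongrightarrow> a' x v"
    by (rule filterlim_compose)
  then show ?thesis by (simp add: shift_diff_def)
qed

end

lemma integrable_product_bound:
  fixes f g :: "'a::euclidean_space \<Rightarrow> real"
  assumes "f \<in> borel_measurable borel" "g \<in> borel_measurable borel"
    and f: "\<And>x. \<bar>f x\<bar> \<le> C / (1 + norm x) ^ k" and g: "\<And>x. \<bar>g x\<bar> \<le> D / (1 + norm x) ^ l"
    and kl: "DIM('a) + 1 \<le> k + l"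
  shows "integrable lborel (\<lambda>x. f x * g x)"
proof (rule Bochner_Integration.integrable_bound[OF integrable_decay_power[OF kl, of "C * D"]])
  show "AE x in lborel. norm (f x * g x) \<le> norm (C * D / (1 + norm x) ^ (k + l))"
  proof (intro AE_I2)
    fix x
    have "norm (f x * g x) \<le> (C / (1 + norm x) ^ k) * (D / (1 + norm x) ^ l)"
      unfolding real_norm_def abs_mult
      by (intro mult_mono f g) (auto intro: order_trans[OF abs_ge_zero f])
    also have "\<dots> = C * D / (1 + norm x) ^ (k + l)" by (simp add: power_add)
    also have "\<dots> \<le> norm (C * D / (1 + norm x) ^ (k + l))" unfolding real_norm_def by (rule abs_ge_self)
    finally show "norm (f x * g x) \<le> norm (C * D / (1 + norm x) ^ (k + l))" .
  qed
qed (use assms in measurable)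

text \<open>Summation by parts with finite differences: only translation invariance is used, so no second
  derivatives are needed.\<close>

lemma integral_shift_diff_swap:
  fixes a b :: "'a::euclidean_space \<Rightarrow> real"
  assumes "decaying a a' P" "decaying b b' P" and n: "DIM('a) \<ge> 2" and s: "norm s \<le> 1" and t: "norm t \<le> 1"
  shows "(\<integral>x. shift_diff a s x * shift_diff b t x \<partial>lborel) = (\<integral>x. shift_diff a (- t) x * shift_diff b (- s) x \<partial>lborel)"
proof -
  interpret A: decaying a a' P by fact
  interpret B: decaying b b' P by fact
  have 1: "integrable lborel (\<lambda>x. shift_diff a u x * b x)" if "norm u \<le> 1" for u
    by (rule integrable_product_bound[OF A.meas_diff B.meas A.shift_diff_bound1[OF that] B.bound]) (use n in auto)
  have 2: "integrable lborel (\<lambda>x. shift_diff a u x * shift_diff b w x)" if "norm u \<le> 1" "norm w \<le> 1" for u w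
    by (rule integrable_product_bound[OF A.meas_diff B.meas_diff A.shift_diff_bound1[OF that(1)] B.shift_diff_bound1[OF that(2)]]) (use n in auto)
  \<comment> \<open>Translation invariance moves the increment \<open>w\<close> from
    \<open>b\<close> to \<open>a\<close>, where it forms a second difference.\<close>
  have key: "(\<integral>x. shift_diff a u x * shift_diff b w x \<partial>lborel)
     = (\<integral>x. (shift_diff a u (x - w) - shift_diff a u x) * b x \<partial>lborel)" if u: "norm u \<le> 1" and w: "norm w \<le> 1" for u w
  proof -
    have 3: "integrable lborel (\<lambda>x. shift_diff a u x * b (x + w))"
      using Bochner_Integration.integrable_add[OF 2[OF u w] 1[OF u]] by (simp add: shift_diff_def algebra_simps)
    have m: "(\<lambda>x. shift_diff a u x * b (x + w)) \<in> borel_measurable borel"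
      using A.meas_diff B.meas by (intro borel_measurable_times measurable_compose[OF _ B.meas]) auto
    have 4: "integrable lborel (\<lambda>x. shift_diff a u (x - w) * b x)"
      using 3 lborel_integrable_isometry[OF m, of 1 "- w"] by simp
    have "(\<integral>x. shift_diff a u x * b (x + w) \<partial>lborel) = (\<integral>x. shift_diff a u (x - w) * b x \<partial>lborel)"
      using lborel_integral_isometry[OF m, of 1 "- w"] by simp
    moreover have "(\<integral>x. shift_diff a u x * shift_diff b w x \<partial>lborel)
       = (\<integral>x. shift_diff a u x * b (x + w) \<partial>lborel) - (\<integral>x. shift_diff a u x * b x \<partial>lborel)"
      by (subst Bochner_Integration.integral_diff[symmetric]) (use 1[OF u] 3 in \<open>auto simp: shift_diff_def algebra_simps\<close>)
    moreover have "(\<integral>x. (shift_diff a u (x - w) - shift_diff a u x) * b x \<partial>lborel)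
       = (\<integral>x. shift_diff a u (x - w) * b x \<partial>lborel) - (\<integral>x. shift_diff a u x * b x \<partial>lborel)"
      by (subst Bochner_Integration.integral_diff[symmetric]) (use 1[OF u] 4 in \<open>auto simp: algebra_simps\<close>)
    ultimately show ?thesis by simp
  qed
  \<comment> \<open>Both sides are the same second difference a(x + s - t) - a(x - t) - a(x + s) +
    a(x): the discrete symmetry of mixed derivatives.\<close>
  have "shift_diff a s (x - t) - shift_diff a s x = shift_diff a (- t) (x - - s) - shift_diff a (- t) x" for x
    by (simp add: shift_diff_def algebra_simps)
  then show ?thesis using key[OF s t] key[of "- t" "- s"] s t by simp
qed

text \<open>Divide the discrete identity by the squared step and pass to the limit; the integrable
  majorant decays like |x|^(-2n). Directions of norm at most 1 keep all shifts admissible.\<close>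

lemma integral_derivative_swap:
  fixes a b :: "'a::euclidean_space \<Rightarrow> real"
  assumes ab: "decaying a a' P" "decaying b b' P" and n: "DIM('a) \<ge> 2" and i: "norm i \<le> 1" and j: "norm j \<le> 1"
  shows "(\<integral>x. a' x i * b' x j \<partial>lborel) = (\<integral>x. a' x j * b' x i \<partial>lborel)"
proof -
  interpret A: decaying a a' P by fact
  interpret B: decaying b b' P by fact
  let ?t = "\<lambda>m. 1 / real (Suc m)"
  let ?I = "\<lambda>u w m x. (shift_diff a (?t m *\<^sub>R u) x / ?t m) * (shift_diff b (?t m *\<^sub>R w) x / ?t m)"
  have lim: "(\<lambda>m. \<integral>x. ?I u w m x \<partial>lborel) \<longlonglongrightarrow> (\<integral>x. a' x u * b' x w \<partial>lborel)"
    if u: "norm u \<le> 1" and w: "norm w \<le> 1" for u w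
  proof (rule integral_dominated_convergence)
    show "integrable lborel (\<lambda>x::'a. (P * 2 ^ DIM('a)) * (P * 2 ^ DIM('a)) / (1 + norm x) ^ (DIM('a) + DIM('a)))"
      by (rule integrable_decay_power) (use n in simp)
    show "AE x in lborel. (\<lambda>m. ?I u w m x) \<longlonglongrightarrow> a' x u * b' x w"
      by (intro AE_I2 tendsto_mult A.shift_diff_tendsto B.shift_diff_tendsto)
    show "(\<lambda>x. a' x u * b' x w) \<in> borel_measurable lborel"
      using A.meas' B.meas' by simp
    show "?I u w m \<in> borel_measurable lborel" for m
      using A.meas_diff B.meas_diff by simp
    fix m
    have q: "\<bar>f / ?t m\<bar> \<le> Q / (1 + norm x) ^ DIM('a)"
      if "\<bar>f\<bar> \<le> Q * norm (?t m *\<^sub>R v) / (1 + norm x) ^ DIM('a)" "norm v \<le> 1" "Q \<ge> 0" for f Q and v x :: 'a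
    proof -
      have "\<bar>f / ?t m\<bar> = \<bar>f\<bar> / ?t m" by (simp add: abs_mult)
      also have "\<dots> \<le> (Q * norm (?t m *\<^sub>R v) / (1 + norm x) ^ DIM('a)) / ?t m"
        using that(1) by (intro divide_right_mono) auto
      also have "\<dots> = Q * norm v / (1 + norm x) ^ DIM('a)" by simp
      also have "\<dots> \<le> Q * 1 / (1 + norm x) ^ DIM('a)"
        using that(2,3) by (intro divide_right_mono mult_left_mono) auto
      finally show ?thesis by simp
    qed
    have nt: "norm (?t m *\<^sub>R v) \<le> 1" if "norm v \<le> 1" for v :: 'a
    proof -
      have "norm (?t m *\<^sub>R v) = ?t m * norm v" by simp
      also have "\<dots> \<le> 1 * 1" using that by (intro mult_mono) auto
      finally show ?thesis by simp
    qed
    show "AE x in lborel. norm (?I u w m x) \<le> (P * 2 ^ DIM('a)) * (P * 2 ^ DIM('a)) / (1 + norm x) ^ (DIM('a) + DIM('a))"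
    proof (intro AE_I2)
      fix x
      have "norm (?I u w m x) \<le> (P * 2 ^ DIM('a) / (1 + norm x) ^ DIM('a)) * (P * 2 ^ DIM('a) / (1 + norm x) ^ DIM('a))"
        unfolding real_norm_def abs_mult
        by (intro mult_mono q[OF A.shift_diff_bound[OF nt[OF u]] u] q[OF B.shift_diff_bound[OF nt[OF w]] w])
          (use A.P in auto)
      then show "norm (?I u w m x) \<le> (P * 2 ^ DIM('a)) * (P * 2 ^ DIM('a)) / (1 + norm x) ^ (DIM('a) + DIM('a))"
        by (simp add: power_add)
    qed
  qed
  have "(\<integral>x. ?I i j m x \<partial>lborel) = (\<integral>x. ?I (- j) (- i) m x \<partial>lborel)" for m
  proof -
    have "norm (?t m *\<^sub>R i) \<le> 1" "norm (?t m *\<^sub>R j) \<le> 1"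
      using i j by (auto simp: divide_simps intro: order_trans)
    note swap = integral_shift_diff_swap[OF ab n this]
    have sc: "(\<integral>x. ?I u w m x \<partial>lborel)
       = (real (Suc m) * real (Suc m)) * (\<integral>x. shift_diff a (?t m *\<^sub>R u) x * shift_diff b (?t m *\<^sub>R w) x \<partial>lborel)" for u w
      unfolding integral_mult_right_zero[symmetric] by (rule Bochner_Integration.integral_cong) (simp_all add: mult_ac)
    show ?thesis unfolding sc using swap by simp
  qed
  then have "(\<lambda>m. \<integral>x. ?I i j m x \<partial>lborel) \<longlonglongrightarrow> (\<integral>x. a' x (- j) * b' x (- i) \<partial>lborel)"
    using lim[of "- j" "- i"] i j by simp
  \<comment> \<open>The discrete swap also reverses both directions; the two signs cancel in the
    product.\<close>
  moreover have "a' x (- v) = - a' x v" "b' x (- v) = - b' x v" for x v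
    using A.deriv[of x] B.deriv[of x] by (auto intro!: linear_neg has_derivative_linear)
  ultimately show ?thesis using lim[OF i j] LIMSEQ_unique by fastforce
qed

section \<open>Global estimates for the potential of a bounded set\<close>

definition trace_mass :: "'a::euclidean_space itself \<Rightarrow> real"
  where "trace_mass _ = real DIM('a) * 2 ^ (DIM('a) + 2) * decay_integral TYPE('a)"

lemma trace_mass_nonneg: "trace_mass TYPE('a::euclidean_space) \<ge> 0"
  by (simp add: trace_mass_def decay_integral_nonneg)

text \<open>For sources in a fixed ball, the regularised distance is comparable from below with 1 +
  |x|. The factor degenerates with \<open>e\<close>, which is harmless: it serves only to establish
  decay at infinity.\<close>

lemma regnorm_decay:
  assumes e: "e > 0" and y: "norm y \<le> R"
  shows "e / (1 + R + e) * (1 + norm x) \<le> regnorm e (x - y)"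
proof -
  have R: "R \<ge> 0" using y norm_ge_zero order_trans by blast
  have 1: "norm x \<le> R + regnorm e (x - y)"
    using norm_triangle_ineq[of "x - y" y] norm_le_regnorm[of "x - y" e] y by simp
  have "e * (1 + norm x) \<le> e * (1 + (R + regnorm e (x - y)))"
    using 1 e by (intro mult_left_mono) auto
  also have "\<dots> = (1 + R) * e + e * regnorm e (x - y)" by (simp add: algebra_simps)
  also have "\<dots> \<le> (1 + R) * regnorm e (x - y) + e * regnorm e (x - y)"
    using R e_le_regnorm[of e "x - y"] by (intro add_right_mono mult_left_mono) auto
  finally show ?thesis using R e by (simp add: divide_simps algebra_simps)
qed

lemma emeasure_bounded_finite:
  fixes B :: "'a::euclidean_space set"
  assumes "B \<subseteq> cball 0 R" "R \<ge> 0"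
  shows "emeasure lborel B < \<infinity>"
proof -
  have "emeasure lborel B \<le> emeasure lborel (cball (0::'a) R)"
    by (rule emeasure_mono[OF assms(1)]) simp
  then show ?thesis using assms(2) by (simp add: emeasure_cball_euclidean le_less_trans)
qed

context
  fixes e R :: real and B :: "'a::euclidean_space set"
  assumes e: "e > 0" and B [measurable]: "B \<in> sets borel" and sub: "B \<subseteq> cball 0 R" and R: "R \<ge> 0"
begin

text \<open>Here \<open>P\<close> may depend on \<open>e\<close>, \<open>R\<close> and
  \<open>B\<close>: it only justifies the interchange of derivatives under the integral and leaves
  no trace in the energy bound.\<close>

lemma decaying_pot:
  "\<exists>P. \<forall>j\<in>Basis. decaying (\<lambda>x. pot e B x \<bullet> j) (\<lambda>x v. dpot e B x v \<bullet> j) P"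
proof -
  let ?n = "DIM('a)"
  note fin = emeasure_bounded_finite[OF sub R]
  define k where "k = e / (1 + R + e)"
  have k: "k > 0" using e R by (simp add: k_def)
  define P where "P = max (1 / k ^ (?n - 1) * measure lborel B) ((real ?n + 1) / k ^ ?n * measure lborel B)"
  have P1: "1 / k ^ (?n - 1) * measure lborel B \<le> P" and P2: "(real ?n + 1) / k ^ ?n * measure lborel B \<le> P"
    by (simp_all add: P_def)
  have P0: "P \<ge> 0" using k by (intro order_trans[OF _ P1]) simp
  have r: "1 / regnorm e (x - y) ^ m \<le> 1 / (k * (1 + norm x)) ^ m" if "y \<in> B" for x y m
  proof -
    have "norm y \<le> R" using that sub by auto
    from regnorm_decay[OF e this, of x] have "k * (1 + norm x) \<le> regnorm e (x - y)" by (simp add: k_def)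
    moreover have "k * (1 + norm x) > 0" using k by (simp add: add_pos_nonneg)
    ultimately show ?thesis using regnorm_pos[OF e, of "x - y"]
      by (intro divide_left_mono power_mono mult_pos_pos[OF zero_less_power zero_less_power]) simp_all
  qed
  have b: "norm (pot e B x) \<le> P / (1 + norm x) ^ (?n - 1)" for x
  proof -
    have "norm (pot e B x) \<le> 1 / (k * (1 + norm x)) ^ (?n - 1) * measure lborel B"
      unfolding pot_def
    proof (rule norm_integral_indicator_le)
      show "norm (rfield e (x - y)) \<le> 1 / (k * (1 + norm x)) ^ (?n - 1)" if "y \<in> B" for y
        using norm_rfield_le[OF e, of "x - y"] r[OF that, of x "?n - 1"] by linarith
    qed (use fin in auto)
    also have "\<dots> = (1 / k ^ (?n - 1) * measure lborel B) / (1 + norm x) ^ (?n - 1)"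
      by (simp add: power_mult_distrib)
    also have "\<dots> \<le> P / (1 + norm x) ^ (?n - 1)" by (rule divide_right_mono[OF P1]) simp
    finally show ?thesis .
  qed
  have b': "norm (dpot e B x v) \<le> P * norm v / (1 + norm x) ^ ?n" for x v
  proof -
    have "norm (dpot e B x v) \<le> ((real ?n + 1) * norm v * (1 / (k * (1 + norm x)) ^ ?n)) * measure lborel B"
      unfolding dpot_def
    proof (rule norm_integral_indicator_le)
      fix y assume y: "y \<in> B"
      have "norm (rfield_deriv e (x - y) v) \<le> (real ?n + 1) * norm v * (1 / regnorm e (x - y) ^ ?n)"
        using norm_rfield_deriv_le[OF e, of "x - y" v] by simp
      also have "\<dots> \<le> (real ?n + 1) * norm v * (1 / (k * (1 + norm x)) ^ ?n)"
        using r[OF y] by (intro mult_left_mono) auto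
      finally show "norm (rfield_deriv e (x - y) v) \<le> (real ?n + 1) * norm v * (1 / (k * (1 + norm x)) ^ ?n)" .
    qed (use fin in auto)
    also have "\<dots> = ((real ?n + 1) / k ^ ?n * measure lborel B) * norm v / (1 + norm x) ^ ?n"
      by (simp add: power_mult_distrib)
    also have "\<dots> \<le> P * norm v / (1 + norm x) ^ ?n"
      by (intro divide_right_mono mult_right_mono P2) auto
    finally show ?thesis .
  qed
  have "decaying (\<lambda>x. pot e B x \<bullet> j) (\<lambda>x v. dpot e B x v \<bullet> j) P" if j: "j \<in> Basis" for j :: 'a
  proof
    show "((\<lambda>x. pot e B x \<bullet> j) has_derivative (\<lambda>v. dpot e B x v \<bullet> j)) (at x)" for x
      by (intro has_derivative_inner_left has_derivative_pot e B fin)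
    show "\<bar>pot e B x \<bullet> j\<bar> \<le> P / (1 + norm x) ^ (?n - 1)" for x
      using b[of x] Basis_le_norm[OF j, of "pot e B x"] by simp
    show "\<bar>dpot e B x v \<bullet> j\<bar> \<le> P * norm v / (1 + norm x) ^ ?n" for x v
      using b'[of x v] Basis_le_norm[OF j, of "dpot e B x v"] by simp
    have "continuous_on UNIV (\<lambda>x. dpot e B x v)" for v
    proof (rule lipschitz_on_continuous_on[OF lipschitz_onI])
      show "0 \<le> real ?n * (real ?n + 5) * norm v / e ^ (?n + 1) * measure lborel B" using e by simp
      show "dist (dpot e B x v) (dpot e B y v) \<le> real ?n * (real ?n + 5) * norm v / e ^ (?n + 1) * measure lborel B * dist x y" for x y
        using dpot_lipschitz[OF e B fin, of x v y] by (simp add: dist_norm mult_ac)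
    qed
    then show "(\<lambda>x. dpot e B x v \<bullet> j) \<in> borel_measurable borel" for v
      by (intro borel_measurable_continuous_onI continuous_on_inner continuous_on_const) auto
  qed (rule P0)
  then show ?thesis by blast
qed

lemma divpot_nn:
  "ennreal (divpot e B x) = (\<integral>\<^sup>+y. ennreal (indicator B y * (real DIM('a) * e\<^sup>2 / regnorm e (x - y) ^ (DIM('a) + 2))) \<partial>lborel)"
  unfolding divpot_def real_scaleR_def
proof (rule nn_integral_eq_integral[symmetric])
  show "integrable lborel (\<lambda>y. indicator B y * (real DIM('a) * e\<^sup>2 / regnorm e (x - y) ^ (DIM('a) + 2)))"
    using integrable_divpot[OF e B emeasure_bounded_finite[OF sub R], of x] by simp
qed (auto intro!: AE_I2 simp: less_imp_le[OF regnorm_pos[OF e]])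

lemma nn_integral_trace_translate:
  "(\<integral>\<^sup>+y. ennreal (real DIM('a) * e\<^sup>2 / regnorm e (x - y) ^ (DIM('a) + 2)) \<partial>lborel) \<le> ennreal (trace_mass TYPE('a))"
  "(\<integral>\<^sup>+y. ennreal (real DIM('a) * e\<^sup>2 / regnorm e (y - x) ^ (DIM('a) + 2)) \<partial>lborel) \<le> ennreal (trace_mass TYPE('a))"
  for x :: 'a
proof -
  have m: "(\<lambda>y::'a. ennreal (real DIM('a) * e\<^sup>2 / regnorm e y ^ (DIM('a) + 2))) \<in> borel_measurable borel"
    by measurable
  show "(\<integral>\<^sup>+y. ennreal (real DIM('a) * e\<^sup>2 / regnorm e (x - y) ^ (DIM('a) + 2)) \<partial>lborel) \<le> ennreal (trace_mass TYPE('a))"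
    using nn_integral_trace_le[OF e, where 'a='a] nn_integral_affine_euclidean[OF m, of "-1" x]
    by (simp add: trace_mass_def)
  show "(\<integral>\<^sup>+y. ennreal (real DIM('a) * e\<^sup>2 / regnorm e (y - x) ^ (DIM('a) + 2)) \<partial>lborel) \<le> ennreal (trace_mass TYPE('a))"
    using nn_integral_trace_le[OF e, where 'a='a] nn_integral_affine_euclidean[OF m, of "1" "- x"]
    by (simp add: trace_mass_def)
qed

text \<open>An indicator is at most 1, so the mass of the kernel bounds the convolution everywhere.
  Together with the L^1 bound below it yields the L^2 bound of the divergence.\<close>

lemma divpot_le: "divpot e B x \<le> trace_mass TYPE('a)"
proof -
  have "ennreal (divpot e B x) \<le> (\<integral>\<^sup>+y. ennreal (real DIM('a) * e\<^sup>2 / regnorm e (x - y) ^ (DIM('a) + 2)) \<partial>lborel)"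
    unfolding divpot_nn
    by (intro nn_integral_mono ennreal_leI) (auto simp: indicator_def less_imp_le[OF regnorm_pos[OF e]])
  also have "\<dots> \<le> ennreal (trace_mass TYPE('a))" by (rule nn_integral_trace_translate)
  finally show ?thesis using trace_mass_nonneg[where 'a='a] by (simp add: ennreal_le_iff)
qed

text \<open>Fubini for nonnegative functions: integrating in \<open>x\<close> first gives at most
  the kernel mass for each point of \<open>B\<close>.\<close>

lemma nn_integral_divpot_le:
  "(\<integral>\<^sup>+x. ennreal (divpot e B x) \<partial>lborel) \<le> ennreal (trace_mass TYPE('a) * measure lborel B)"
proof -
  let ?h = "\<lambda>x y. ennreal (indicator B y * (real DIM('a) * e\<^sup>2 / regnorm e (x - y :: 'a) ^ (DIM('a) + 2)))"
  have m: "(\<lambda>(x, y). ?h x y) \<in> borel_measurable (lborel \<Otimes>\<^sub>M lborel)"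
  proof -
    have 1: "(\<lambda>p::'a \<times> 'a. regnorm e (fst p - snd p)) \<in> borel_measurable (lborel \<Otimes>\<^sub>M lborel)"
      by (intro measurable_compose[OF _ borel_measurable_regnorm] borel_measurable_diff) auto
    have 2: "(\<lambda>p::'a \<times> 'a. indicator B (snd p) :: real) \<in> borel_measurable (lborel \<Otimes>\<^sub>M lborel)"
      by (intro measurable_compose[OF measurable_snd] borel_measurable_indicator) (use B in simp)
    show ?thesis unfolding case_prod_beta using 1 2 by measurable
  qed
  have "(\<integral>\<^sup>+x. ennreal (divpot e B x) \<partial>lborel) = (\<integral>\<^sup>+x. (\<integral>\<^sup>+y. ?h x y \<partial>lborel) \<partial>lborel)"
    by (simp only: divpot_nn)
  also have "\<dots> = (\<integral>\<^sup>+y. (\<integral>\<^sup>+x. ?h x y \<partial>lborel) \<partial>lborel)"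
    by (rule lborel_pair.Fubini'[OF m, symmetric])
  also have "\<dots> \<le> (\<integral>\<^sup>+y. ennreal (trace_mass TYPE('a)) * indicator B y \<partial>lborel)"
  proof (rule nn_integral_mono)
    fix y
    show "(\<integral>\<^sup>+x. ?h x y \<partial>lborel) \<le> ennreal (trace_mass TYPE('a)) * indicator B y"
      using nn_integral_trace_translate(2)[of y] by (cases "y \<in> B") auto
  qed
  also have "\<dots> = ennreal (trace_mass TYPE('a)) * emeasure lborel B"
    by (simp add: nn_integral_cmult_indicator)
  also have "emeasure lborel B = ennreal (measure lborel B)"
    using emeasure_bounded_finite[OF sub R] by (intro emeasure_eq_ennreal_measure) auto
  finally show ?thesis using trace_mass_nonneg[where 'a='a] by (simp add: ennreal_mult)
qed

text \<open>The field is a gradient, so the square integrals of its full derivative and of its divergence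
  agree.\<close>

lemma dpot_energy:
  shows "integrable lborel (\<lambda>x. \<Sum>i\<in>Basis. \<Sum>j\<in>Basis. (dpot e B x i \<bullet> j)\<^sup>2)"
    and "(\<integral>x. (\<Sum>i\<in>Basis. \<Sum>j\<in>Basis. (dpot e B x i \<bullet> j)\<^sup>2) \<partial>lborel) \<le> (trace_mass TYPE('a))\<^sup>2 * measure lborel B"
proof -
  let ?n = "DIM('a)" and ?q = "\<lambda>i j x. dpot e B x i \<bullet> j"
  obtain P where P: "\<And>j. j \<in> Basis \<Longrightarrow> decaying (\<lambda>x. pot e B x \<bullet> j) (\<lambda>x v. dpot e B x v \<bullet> j) P"
    using decaying_pot by blast
  have n1: "?n + 1 \<le> ?n + ?n" using DIM_positive[where 'a='a] by linarith
  have int: "integrable lborel (\<lambda>x. ?q i j x * ?q k l x)" if "i \<in> Basis" "j \<in> Basis" "k \<in> Basis" "l \<in> Basis" for i j k l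
  proof (rule integrable_product_bound[OF _ _ _ _ n1])
    show "?q i j \<in> borel_measurable borel" "?q k l \<in> borel_measurable borel"
      using decaying.meas'[OF P] that by auto
    show "\<bar>?q i j x\<bar> \<le> P / (1 + norm x) ^ ?n" "\<bar>?q k l x\<bar> \<le> P / (1 + norm x) ^ ?n" for x
      using decaying.bound'[OF P, of j x i] decaying.bound'[OF P, of l x k] that by simp_all
  qed
  show int1: "integrable lborel (\<lambda>x. \<Sum>i\<in>Basis. \<Sum>j\<in>Basis. (?q i j x)\<^sup>2)"
    unfolding power2_eq_square by (intro Bochner_Integration.integrable_sum int)
  \<comment> \<open>Distinct basis vectors force dimension at least 2, as the swap lemma requires;
    in dimension one only the trivial case \<open>i = j\<close> occurs.\<close>
  have swap: "(\<integral>x. ?q i j x * ?q j i x \<partial>lborel) = (\<integral>x. ?q i i x * ?q j j x \<partial>lborel)" if ij: "i \<in> Basis" "j \<in> Basis" for i j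
  proof (cases "i = j")
    case False
    then have "card {i, j} \<le> ?n" using ij by (intro card_mono) auto
    then have n2: "?n \<ge> 2" using False by simp
    have "(\<integral>x. ?q i j x * ?q j i x \<partial>lborel) = (\<integral>x. ?q j j x * ?q i i x \<partial>lborel)"
      using integral_derivative_swap[OF P[OF ij(2)] P[OF ij(1)] n2, of i j] ij by simp
    then show ?thesis by (simp add: mult.commute)
  qed simp
  \<comment> \<open>By symmetry the square is a product of mirrored entries; swapping derivatives
    turns its integral into that of a product of diagonal entries, and these sum to the squared
    divergence.\<close>
  have sq: "(?q i j x)\<^sup>2 = ?q i j x * ?q j i x" for i j x
    using dpot_sym[OF e B emeasure_bounded_finite[OF sub R], of x i j] by (simp add: power2_eq_square)
  have "(\<integral>x. (\<Sum>i\<in>Basis. \<Sum>j\<in>Basis. (?q i j x)\<^sup>2) \<partial>lborel)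
     = (\<Sum>i\<in>Basis. \<Sum>j\<in>Basis. (\<integral>x. ?q i j x * ?q j i x \<partial>lborel))"
    unfolding sq by (subst Bochner_Integration.integral_sum, intro Bochner_Integration.integrable_sum int; simp?)
      (intro sum.cong refl Bochner_Integration.integral_sum int; simp)
  also have "\<dots> = (\<Sum>i\<in>Basis. \<Sum>j\<in>Basis. (\<integral>x. ?q i i x * ?q j j x \<partial>lborel))"
    by (intro sum.cong refl swap)
  also have "\<dots> = (\<integral>x. (\<Sum>i\<in>Basis. \<Sum>j\<in>Basis. ?q i i x * ?q j j x) \<partial>lborel)"
    by (subst Bochner_Integration.integral_sum, intro Bochner_Integration.integrable_sum int; simp?)
      (intro sum.cong refl Bochner_Integration.integral_sum[symmetric] int; simp)
  also have "\<dots> = (\<integral>x. divpot e B x * divpot e B x \<partial>lborel)"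
    by (simp add: dpot_trace[OF e B emeasure_bounded_finite[OF sub R], symmetric] sum_product)
  finally have eq: "(\<integral>x. (\<Sum>i\<in>Basis. \<Sum>j\<in>Basis. (?q i j x)\<^sup>2) \<partial>lborel) = (\<integral>x. divpot e B x * divpot e B x \<partial>lborel)" .
  have dp: "integrable lborel (\<lambda>x. divpot e B x * divpot e B x)"
    unfolding dpot_trace[OF e B emeasure_bounded_finite[OF sub R], symmetric] sum_product
    by (intro Bochner_Integration.integrable_sum int)
  have nonneg: "divpot e B x \<ge> 0" for x by (rule divpot_nonneg[OF e B emeasure_bounded_finite[OF sub R]])
  have meas: "divpot e B \<in> borel_measurable borel"
    unfolding dpot_trace[OF e B emeasure_bounded_finite[OF sub R], symmetric, abs_def]
    using decaying.meas'[OF P] by (intro borel_measurable_sum) auto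
  \<comment> \<open>The squared divergence is at most its sup bound times itself, so its integral is
    at most the product of the sup and L^1 bounds.\<close>
  have "ennreal (\<integral>x. divpot e B x * divpot e B x \<partial>lborel) = (\<integral>\<^sup>+x. ennreal (divpot e B x * divpot e B x) \<partial>lborel)"
    by (rule nn_integral_eq_integral[OF dp, symmetric]) (simp add: nonneg)
  also have "\<dots> \<le> (\<integral>\<^sup>+x. ennreal (trace_mass TYPE('a)) * ennreal (divpot e B x) \<partial>lborel)"
    by (intro nn_integral_mono) (simp add: ennreal_mult[symmetric] nonneg trace_mass_nonneg ennreal_leI mult_right_mono divpot_le)
  also have "\<dots> = ennreal (trace_mass TYPE('a)) * (\<integral>\<^sup>+x. ennreal (divpot e B x) \<partial>lborel)"
    by (rule nn_integral_cmult) (use meas in simp)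
  also have "\<dots> \<le> ennreal (trace_mass TYPE('a)) * ennreal (trace_mass TYPE('a) * measure lborel B)"
    by (intro mult_left_mono nn_integral_divpot_le) simp
  also have "\<dots> = ennreal ((trace_mass TYPE('a))\<^sup>2 * measure lborel B)"
    by (simp add: ennreal_mult[symmetric] trace_mass_nonneg power2_eq_square mult_ac)
  finally show "(\<integral>x. (\<Sum>i\<in>Basis. \<Sum>j\<in>Basis. (?q i j x)\<^sup>2) \<partial>lborel) \<le> (trace_mass TYPE('a))\<^sup>2 * measure lborel B"
    unfolding eq by (subst (asm) ennreal_le_iff) auto
qed

end

section \<open>Multiplicative weights\<close>

lemma exp_le_quadratic:
  fixes x :: real
  assumes "\<bar>x\<bar> \<le> 1"
  shows "exp x \<le> 1 + x + x\<^sup>2"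
proof (cases "x \<ge> 0")
  case True
  then show ?thesis using exp_bound[of x] assms by simp
next
  case False
  define y where "y = - x"
  have y: "0 \<le> y" "y \<le> 1" using False assms by (auto simp: y_def)
  have "1 + y + y\<^sup>2 / 2 \<le> exp y" using exp_lower_Taylor_quadratic[OF y(1)] .
  moreover have p: "1 - y + y\<^sup>2 > 0" 
  proof -
    have "1 - y + y\<^sup>2 = (y - 1 / 2)\<^sup>2 + 3 / 4" by (simp add: power2_eq_square algebra_simps)
    then show ?thesis by (simp add: add_nonneg_pos)
  qed
  moreover have "1 \<le> (1 - y + y\<^sup>2) * (1 + y + y\<^sup>2 / 2)"
  proof -
    have "(1 - y + y\<^sup>2) * (1 + y + y\<^sup>2 / 2) = 1 + y\<^sup>2 / 2 + y ^ 3 / 2 + y ^ 4 / 2"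
      by (simp add: power2_eq_square power3_eq_cube power4_eq_xxxx field_simps)
    then show ?thesis using y by simp
  qed
  ultimately have "1 \<le> (1 - y + y\<^sup>2) * exp y"
    by (meson less_imp_le mult_left_mono order_trans)
  then have "exp (- y) \<le> 1 - y + y\<^sup>2"
    by (simp add: exp_minus divide_simps mult.commute)
  then show ?thesis by (simp add: y_def)
qed

text \<open>This replaces a minimax theorem: the weights grow exponentially with the accumulated payoff, so
  a large total payoff at one index would contradict the slow growth of the total weight.\<close>

lemma multiplicative_weights:
  fixes p :: "'b \<Rightarrow> 'i \<Rightarrow> real"
  assumes I: "finite I" and M: "\<And>b i. b \<in> S \<Longrightarrow> i \<in> I \<Longrightarrow> \<bar>p b i\<bar> \<le> M" and C: "C \<ge> 0"
    and response: "\<And>w. (\<And>i. i \<in> I \<Longrightarrow> w i > 0) \<Longrightarrow> \<exists>b\<in>S. (\<Sum>i\<in>I. w i * p b i) \<le> C * (\<Sum>i\<in>I. w i)"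
  shows "\<exists>n>0. \<exists>b. (\<forall>t<n. b t \<in> S) \<and> (\<forall>i\<in>I. (\<Sum>t<n. p (b t) i) / real n \<le> C + 1)"
proof -
  define K where "K = max 1 M"
  have K: "K \<ge> 1" "M \<le> K" by (simp_all add: K_def)
  \<comment> \<open>This rate makes |\<eta> p| at most 1, as the quadratic bound of
    \<open>exp\<close> requires, and its square at most \<eta> / 2, which uses half of the slack 1
    in the conclusion.\<close>
  define \<eta> where "\<eta> = 1 / (2 * K\<^sup>2)"
  have \<eta>: "\<eta> > 0" "\<eta> * K \<le> 1" "\<eta> * K\<^sup>2 = 1 / 2"
    using K by (simp_all add: \<eta>_def field_simps power2_eq_square mult_le_one)
  define pick where "pick w = (SOME b. b \<in> S \<and> (\<Sum>i\<in>I. w i * p b i) \<le> C * (\<Sum>i\<in>I. w i))" for w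
  have pick: "pick w \<in> S" "(\<Sum>i\<in>I. w i * p (pick w) i) \<le> C * (\<Sum>i\<in>I. w i)" if "\<And>i. i \<in> I \<Longrightarrow> w i > 0" for w
    using someI_ex[OF response[OF that, unfolded Bex_def]] by (auto simp: pick_def)
  define w where "w = rec_nat (\<lambda>i. 1) (\<lambda>t u i. u i * exp (\<eta> * p (pick u) i))"
  have w0: "w 0 i = 1" and wS: "w (Suc t) i = w t i * exp (\<eta> * p (pick (w t)) i)" for t i
    by (simp_all add: w_def)
  have wpos: "w t i > 0" for t i by (induction t) (simp_all add: w0 wS)
  define b where "b t = pick (w t)" for t
  have b: "b t \<in> S" "(\<Sum>i\<in>I. w t i * p (b t) i) \<le> C * (\<Sum>i\<in>I. w t i)" for t
    using pick[of "w t"] wpos by (simp_all add: b_def)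
  have w_eq: "w t i = exp (\<eta> * (\<Sum>s<t. p (b s) i))" for t i
    by (induction t) (simp_all add: w0 wS b_def exp_add distrib_left)
  \<comment> \<open>The growth factor of the total weight in one round: the response keeps the
    linear term below \<eta> C, and \<eta> / 2 bounds the quadratic term.\<close>
  define L where "L = 1 + \<eta> * C + \<eta> / 2"
  have step: "(\<Sum>i\<in>I. w (Suc t) i) \<le> L * (\<Sum>i\<in>I. w t i)" for t
  proof -
    have "w (Suc t) i \<le> w t i * (1 + \<eta> / 2) + \<eta> * (w t i * p (b t) i)" if i: "i \<in> I" for i
    proof -
      have pK: "\<bar>p (b t) i\<bar> \<le> K" using M[OF b(1) i, of t] K by linarith
      have 1: "\<bar>\<eta> * p (b t) i\<bar> \<le> \<eta> * K" using pK \<eta>(1) by (simp add: abs_mult)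
      have "(\<eta> * p (b t) i)\<^sup>2 = \<eta> * (\<eta> * (p (b t) i)\<^sup>2)" by (simp add: power2_eq_square)
      also have "(p (b t) i)\<^sup>2 \<le> K\<^sup>2" using pK K by (intro abs_le_square_iff[THEN iffD1]) simp
      then have "\<eta> * (\<eta> * (p (b t) i)\<^sup>2) \<le> \<eta> * (\<eta> * K\<^sup>2)" using \<eta>(1) by (intro mult_left_mono) auto
      finally have 2: "(\<eta> * p (b t) i)\<^sup>2 \<le> \<eta> / 2" using \<eta>(3) by simp
      have "exp (\<eta> * p (b t) i) \<le> 1 + \<eta> * p (b t) i + \<eta> / 2"
        using exp_le_quadratic[of "\<eta> * p (b t) i"] 1 2 \<eta>(2) by linarith
      then have "w (Suc t) i \<le> w t i * (1 + \<eta> * p (b t) i + \<eta> / 2)"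
        unfolding wS b_def[symmetric] using wpos[of t i] by (intro mult_left_mono) auto
      then show ?thesis by (simp add: algebra_simps)
    qed
    then have "(\<Sum>i\<in>I. w (Suc t) i) \<le> (\<Sum>i\<in>I. w t i * (1 + \<eta> / 2) + \<eta> * (w t i * p (b t) i))"
      by (rule sum_mono)
    also have "\<dots> = (1 + \<eta> / 2) * (\<Sum>i\<in>I. w t i) + \<eta> * (\<Sum>i\<in>I. w t i * p (b t) i)"
      unfolding sum.distrib sum_distrib_right[symmetric] sum_distrib_left[symmetric] by (simp only: mult.commute)
    also have "\<dots> \<le> (1 + \<eta> / 2) * (\<Sum>i\<in>I. w t i) + \<eta> * (C * (\<Sum>i\<in>I. w t i))"
      using \<eta>(1) b(2) by (intro add_left_mono mult_left_mono) auto
    finally show ?thesis by (simp add: L_def algebra_simps)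
  qed
  have L: "L > 0" using \<eta> C by (simp add: L_def add_pos_nonneg)
  have total: "(\<Sum>i\<in>I. w t i) \<le> L ^ t * real (card I)" for t
  proof (induction t)
    case (Suc t)
    have "(\<Sum>i\<in>I. w (Suc t) i) \<le> L * (L ^ t * real (card I))"
      using step[of t] mult_left_mono[OF Suc, of L] L by linarith
    then show ?case by simp
  qed (simp add: w0)
  have Lexp: "L \<le> exp (\<eta> * (C + 1 / 2))"
    using exp_ge_add_one_self[of "\<eta> * (C + 1 / 2)"] by (simp add: L_def algebra_simps)
  \<comment> \<open>The initial total weight, raised by 1 to stay positive when \<open>I\<close> is
    empty.\<close>
  define N where "N = real (card I) + 1"
  have N: "N > 0" by (simp add: N_def)
  \<comment> \<open>After this many rounds the initial weight contributes at most 1 / 2 per round,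
    the other half of the slack.\<close>
  obtain n :: nat where n: "real n > max 1 (2 * ln N / \<eta>)" using reals_Archimedean2 by blast
  then have n0: "real n > 0" "2 * ln N / \<eta> < real n" by auto
  have "(\<Sum>t<n. p (b t) i) / real n \<le> C + 1" if i: "i \<in> I" for i
  proof -
    have "exp (\<eta> * (\<Sum>s<n. p (b s) i)) = w n i" by (simp add: w_eq)
    also have "\<dots> \<le> (\<Sum>i\<in>I. w n i)" using I i wpos by (intro member_le_sum) (auto simp: less_imp_le)
    also have "\<dots> \<le> L ^ n * real (card I)" by (rule total)
    also have "\<dots> \<le> exp (\<eta> * (C + 1 / 2)) ^ n * N"
      using Lexp L by (intro mult_mono power_mono) (auto simp: N_def)
    also have "\<dots> = exp (real n * (\<eta> * (C + 1 / 2)) + ln N)"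
      using N by (simp add: exp_add exp_of_nat_mult)
    finally have "\<eta> * (\<Sum>s<n. p (b s) i) \<le> real n * (\<eta> * (C + 1 / 2)) + ln N" by simp
    also have "ln N \<le> real n * (\<eta> / 2)" using n0(2) \<eta>(1) by (simp add: divide_simps mult_ac)
    finally have "\<eta> * (\<Sum>s<n. p (b s) i) \<le> \<eta> * (real n * (C + 1))" by (simp add: algebra_simps)
    then have "(\<Sum>s<n. p (b s) i) \<le> real n * (C + 1)" using \<eta>(1) by simp
    then show ?thesis using n0(1) by (simp add: divide_simps mult.commute)
  qed
  then show ?thesis using b(1) n0(1) by (intro exI[of _ n] conjI exI[of _ b]) auto
qed

section \<open>Bounding weighted averages of the derivative\<close>

text \<open>A stopping radius: here \<open>T r\<close> is the mass of a ball. The density exceeds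
  the threshold \<kappa> W at small radii because of the atom at the centre, and falls below it at
  large ones because the mass is at most \<open>W\<close>. The factor 5 between consecutive radii is
  that of the Vitali covering lemma.\<close>

lemma exists_scale_radius:
  fixes T :: "real \<Rightarrow> real"
  assumes "n > 0" "\<kappa> > 0" "W > 0" "0 < w" "w \<le> W" and T0: "\<And>r. r > 0 \<Longrightarrow> w \<le> T r" and T1: "\<And>r. T r \<le> W"
  shows "\<exists>r>0. \<kappa> * r ^ n * W \<le> T r \<and> T (5 * r) \<le> \<kappa> * (5 * r) ^ n * W \<and> r \<le> max 1 (1 / \<kappa>)"
proof -
  \<comment> \<open>Small enough that the atom \<open>w\<close> alone reaches the threshold:
    \<rho>^n is at most \<rho>, and \<kappa> \<rho> W is at most \<open>w\<close>.\<close>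
  define \<rho> where "\<rho> = min 1 (w / (\<kappa> * W))"
  have \<rho>: "\<rho> > 0" "\<rho> \<le> 1" using assms by (simp_all add: \<rho>_def)
  define Q where "Q m \<longleftrightarrow> \<kappa> * (5 ^ m * \<rho>) ^ n * W \<le> T (5 ^ m * \<rho>)" for m :: nat
  have Q0: "Q 0"
  proof -
    have "\<rho> ^ n \<le> \<rho>" using \<rho> assms(1) power_decreasing[of 1 n \<rho>] by simp
    then have "\<kappa> * \<rho> ^ n * W \<le> \<kappa> * \<rho> * W" using assms by (intro mult_right_mono mult_left_mono) auto
    also have "\<dots> \<le> \<kappa> * (w / (\<kappa> * W)) * W" using assms by (intro mult_right_mono mult_left_mono) (auto simp: \<rho>_def)
    also have "\<dots> = w" using assms by simp
    finally show ?thesis using T0[OF \<rho>(1)] by (simp add: Q_def)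
  qed
  \<comment> \<open>Beyond this radius \<kappa> r^n exceeds 1, so the threshold would exceed the
    total mass.\<close>
  have bound: "5 ^ m * \<rho> \<le> max 1 (1 / \<kappa>)" if "Q m" for m
  proof (rule ccontr)
    assume c: "\<not> ?thesis"
    then have "1 / \<kappa> < 5 ^ m * \<rho>" "1 \<le> 5 ^ m * \<rho>" by auto
    then have "1 / \<kappa> < (5 ^ m * \<rho>) ^ n" using power_increasing[of 1 n "5 ^ m * \<rho>"] assms(1) by simp
    then have "1 < \<kappa> * (5 ^ m * \<rho>) ^ n" using assms(2) by (simp add: divide_simps mult.commute)
    then have "W < \<kappa> * (5 ^ m * \<rho>) ^ n * W" using assms(3) by simp
    with that T1[of "5 ^ m * \<rho>"] show False by (simp add: Q_def)
  qed
  obtain m1 where "max 1 (1 / \<kappa>) / \<rho> < 5 ^ m1" using real_arch_pow[of 5] by auto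
  then have "max 1 (1 / \<kappa>) < 5 ^ m1 * \<rho>" using \<rho>(1) by (simp only: pos_divide_less_eq)
  then have "\<not> Q m1" using bound[of m1] by linarith
  have "\<exists>m. Q m \<and> \<not> Q (Suc m)"
    using Q0 \<open>\<not> Q m1\<close> by (metis nat_induct)
  then obtain m where m: "Q m" "\<not> Q (Suc m)" by blast
  show ?thesis
  proof (intro exI conjI)
    show "5 ^ m * \<rho> > 0" using \<rho> by simp
    show "5 ^ m * \<rho> \<le> max 1 (1 / \<kappa>)" using bound[OF m(1)] .
    show "\<kappa> * (5 ^ m * \<rho>) ^ n * W \<le> T (5 ^ m * \<rho>)" using m(1) by (simp add: Q_def)
    show "T (5 * (5 ^ m * \<rho>)) \<le> \<kappa> * (5 * (5 ^ m * \<rho>)) ^ n * W"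
      using m(2) by (simp add: Q_def mult.assoc)
  qed
qed

text \<open>Oscillation, plus 1 / 2 from |q| \<le> 1 / 2 + q^2 / 2, plus the energy term: density at
  most 5^n \<kappa> W over the unit ball volume, times half the energy of a set of measure (1 +
  10^n) / \<kappa> unit ball volumes. Both \<kappa> and the volume cancel.\<close>

definition payoff_bound :: "'a::euclidean_space itself \<Rightarrow> real"
  where "payoff_bound _ = osc_const TYPE('a) + 1 / 2 + 5 ^ DIM('a) * (trace_mass TYPE('a))\<^sup>2 * (1 + 10 ^ DIM('a)) / 2"

text \<open>Calderon-Zygmund decomposition of the atomic measure with weights \<open>w\<close>: adding
  to \<open>U\<close> the balls on which the measure is concentrated makes the derivative nearly constant
  there, so each group of atoms can be spread over its ball and the energy estimate applies.\<close>

lemma weighted_payoff_le: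
  fixes pt di dj :: "'i \<Rightarrow> 'a::euclidean_space" and w sg :: "'i \<Rightarrow> real"
  assumes e: "e > 0" and I: "finite I" and w: "\<And>k. k \<in> I \<Longrightarrow> w k > 0"
    and ij: "\<And>k. k \<in> I \<Longrightarrow> di k \<in> Basis \<and> dj k \<in> Basis \<and> \<bar>sg k\<bar> \<le> 1 \<and> norm (pt k) \<le> R"
    and l: "\<kappa> > 0" and R: "R \<ge> 0"
    and U: "U \<in> sets borel" "U \<subseteq> cball 0 R" "measure lborel U \<le> unit_ball_vol (real DIM('a)) / \<kappa>"
  shows "\<exists>B\<in>sets borel. U \<subseteq> B \<and> B \<subseteq> cball 0 (R + 10 * max 1 (1 / \<kappa>)) \<and>
    measure lborel B \<le> (1 + 10 ^ DIM('a)) * unit_ball_vol (real DIM('a)) / \<kappa> \<and>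
    (\<Sum>k\<in>I. w k * (sg k * (dpot e B (pt k) (di k) \<bullet> dj k))) \<le> payoff_bound TYPE('a) * (\<Sum>k\<in>I. w k)"
proof (cases "I = {}")
  case True
  have "unit_ball_vol (real DIM('a)) / \<kappa> \<le> (1 + 10 ^ DIM('a)) * unit_ball_vol (real DIM('a)) / \<kappa>"
    using l by (simp add: divide_right_mono less_imp_le)
  then show ?thesis using True U R by (intro bexI[of _ U]) (auto intro: order_trans)
next
  case False
  let ?n = "DIM('a)" and ?v = "unit_ball_vol (real DIM('a))"
  have v: "?v > 0" by simp
  define W where "W = (\<Sum>k\<in>I. w k)"
  have W: "W > 0" unfolding W_def using I False w by (intro sum_pos) auto
  define T where "T S = (\<Sum>k\<in>{k\<in>I. pt k \<in> S}. w k)" for S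
  have T_le: "T S \<le> W" for S unfolding T_def W_def using I w by (intro sum_mono2) (auto simp: less_imp_le)
  have "\<exists>r>0. \<kappa> * r ^ ?n * W \<le> T (cball (pt k) r) \<and> T (cball (pt k) (5 * r)) \<le> \<kappa> * (5 * r) ^ ?n * W \<and> r \<le> max 1 (1 / \<kappa>)"
    if k: "k \<in> I" for k
  proof (rule exists_scale_radius[where w="w k"])
    show "w k \<le> T (cball (pt k) r)" if "r > 0" for r
      unfolding T_def using I w k that by (intro member_le_sum) (auto simp: less_imp_le)
    show "w k \<le> W" unfolding W_def using I w k by (intro member_le_sum) (auto simp: less_imp_le)
  qed (use l W w[OF k] T_le in auto)
  then obtain r where r: "\<And>k. k \<in> I \<Longrightarrow> r k > 0" "\<And>k. k \<in> I \<Longrightarrow> \<kappa> * r k ^ ?n * W \<le> T (cball (pt k) (r k))"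
     "\<And>k. k \<in> I \<Longrightarrow> T (cball (pt k) (5 * r k)) \<le> \<kappa> * (5 * r k) ^ ?n * W" "\<And>k. k \<in> I \<Longrightarrow> r k \<le> max 1 (1 / \<kappa>)"
    by metis
  have sub: "pt ` I \<subseteq> (\<Union>k\<in>I. cball (pt k) (r k))" using r(1) by (force simp: less_imp_le)
  have r14: "0 < r k \<and> r k \<le> max 1 (1 / \<kappa>)" if "k \<in> I" for k using r(1,4)[OF that] by blast
  \<comment> \<open>The Vitali lemma selects disjoint balls, of high density, whose fivefold
    enlargements, of low density, cover all atoms.\<close>
  obtain C where "countable C" and C: "C \<subseteq> I" "pairwise (\<lambda>i j. disjnt (cball (pt i) (r i)) (cball (pt j) (r j))) C"
     "pt ` I \<subseteq> (\<Union>i\<in>C. cball (pt i) (5 * r i))"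
    by (rule Vitali_covering_lemma_cballs[OF sub r14])
  have finC: "finite C" using C(1) I finite_subset by blast
  have "\<forall>k\<in>I. \<exists>i\<in>C. pt k \<in> cball (pt i) (5 * r i)" using C(3) by blast
  \<comment> \<open>\<open>f\<close> assigns each atom to one enlarged ball, so that the weights are
    grouped without overlap.\<close>
  then obtain f where f: "\<And>k. k \<in> I \<Longrightarrow> f k \<in> C" "\<And>k. k \<in> I \<Longrightarrow> pt k \<in> cball (pt (f k)) (5 * r (f k))"
    by metis
  have CI: "i \<in> I" if "i \<in> C" for i using C(1) that by blast
  let ?P = "\<lambda>i. cball (pt i) (r i)"
  have disj: "disjoint_family_on ?P C"
    using C(2) unfolding disjoint_family_on_def pairwise_def disjnt_def by blast
  \<comment> \<open>The selected balls are disjoint and each carries mass at least \<kappa> r^n W;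
    together they carry at most \<open>W\<close>.\<close>
  have sum_r: "(\<Sum>i\<in>C. r i ^ ?n) \<le> 1 / \<kappa>"
  proof -
    have "\<kappa> * W * (\<Sum>i\<in>C. r i ^ ?n) = (\<Sum>i\<in>C. \<kappa> * r i ^ ?n * W)"
      by (simp add: sum_distrib_left mult_ac)
    also have "\<dots> \<le> (\<Sum>i\<in>C. T (?P i))" using r(2) CI by (intro sum_mono) auto
    also have "\<dots> = (\<Sum>k\<in>(\<Union>i\<in>C. {k\<in>I. pt k \<in> ?P i}). w k)"
      unfolding T_def
      by (rule sum.UNION_disjoint[symmetric]) (use finC I disj in \<open>auto simp: disjoint_family_on_def disjoint_iff\<close>)
    also have "\<dots> \<le> W" unfolding W_def using I w by (intro sum_mono2) (auto simp: less_imp_le)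
    finally show ?thesis using l W by (simp add: divide_simps mult_ac)
  qed
  \<comment> \<open>Radius 10 r is twice 5 r: the oscillation bound on a ball needs the doubled ball
    inside the set.\<close>
  define B where "B = U \<union> (\<Union>i\<in>C. cball (pt i) (10 * r i))"
  have B: "B \<in> sets borel" unfolding B_def using U(1) finC by (intro sets.Un sets.finite_UN) auto
  have UB: "U \<subseteq> B" by (auto simp: B_def)
  let ?R = "R + 10 * max 1 (1 / \<kappa>)"
  have BR: "B \<subseteq> cball 0 ?R"
  proof -
    have "cball (pt i) (10 * r i) \<subseteq> cball 0 ?R" if "i \<in> C" for i
    proof
      fix y assume "y \<in> cball (pt i) (10 * r i)"
      then have "norm (pt i - y) \<le> 10 * max 1 (1 / \<kappa>)"
        using r(4)[OF CI[OF that]] by (simp add: dist_norm)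
      then have "norm y \<le> ?R"
        using norm_triangle_ineq4[of "pt i" "pt i - y"] ij[OF CI[OF that]] by simp
      then show "y \<in> cball 0 ?R" by simp
    qed
    moreover have "U \<subseteq> cball 0 ?R" using U(2) by (rule order_trans) (simp add: subset_cball)
    ultimately show ?thesis unfolding B_def by blast
  qed
  have R': "?R \<ge> 0" using R by simp
  have finB: "emeasure lborel B < \<infinity>" by (rule emeasure_bounded_finite[OF BR R'])
  have mB: "measure lborel B \<le> (1 + 10 ^ ?n) * ?v / \<kappa>"
  proof -
    have "measure lborel B \<le> measure lborel U + measure lborel (\<Union>i\<in>C. cball (pt i) (10 * r i))"
      unfolding B_def using U(1) finC by (intro measure_Un_le) auto
    also have "\<dots> \<le> ?v / \<kappa> + (\<Sum>i\<in>C. measure lborel (cball (pt i) (10 * r i)))"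
      using U(3) finC by (intro add_mono measure_UNION_le) auto
    also have "(\<Sum>i\<in>C. measure lborel (cball (pt i) (10 * r i))) = (\<Sum>i\<in>C. ?v * 10 ^ ?n * r i ^ ?n)"
      using r(1) CI by (intro sum.cong) (auto simp: content_cball power_mult_distrib less_imp_le)
    also have "\<dots> = ?v * 10 ^ ?n * (\<Sum>i\<in>C. r i ^ ?n)" by (simp add: sum_distrib_left)
    also have "\<dots> \<le> ?v * 10 ^ ?n * (1 / \<kappa>)" using v by (intro mult_left_mono sum_r) auto
    also have "?v / \<kappa> + ?v * 10 ^ ?n * (1 / \<kappa>) = (1 + 10 ^ ?n) * ?v / \<kappa>" using l by (simp add: field_simps)
    finally show ?thesis by simp
  qed
  define q where "q i j x = dpot e B x i \<bullet> j" for i j x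
  define Q where "Q x = (\<Sum>i\<in>Basis. \<Sum>j\<in>Basis. (q i j x)\<^sup>2)" for x
  note en = dpot_energy[OF e B BR R', folded q_def, folded Q_def]
  have Q0: "Q x \<ge> 0" for x unfolding Q_def by (intro sum_nonneg) auto
  define c0 where "c0 = osc_const TYPE('a) + 1 / 2"
  have c0: "c0 \<ge> 0" by (simp add: c0_def osc_const_nonneg)
  define m where "m i = (\<integral>x. indicator (?P i) x * Q x \<partial>lborel)" for i
  have intP: "integrable lborel (\<lambda>x. indicator (?P i) x * Q x)" for i
    using integrable_mult_indicator[OF _ en(1), of "?P i"] unfolding real_scaleR_def by (metis borel_closed closed_cball sets_lborel)
  have m0: "m i \<ge> 0" for i unfolding m_def by (rule Bochner_Integration.integral_nonneg) (simp add: Q0)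
  \<comment> \<open>The value at an atom is compared with the values on the small disjoint ball of
    its group, then averaged over that ball. This is where the atom is spread out.\<close>
  have pw: "sg k * q (di k) (dj k) (pt k) \<le> c0 + m (f k) / (2 * (?v * r (f k) ^ ?n))" if k: "k \<in> I" for k
  proof -
    define i where "i = f k"
    have i: "i \<in> C" "i \<in> I" "r i > 0" using f(1)[OF k] CI r(1) by (auto simp: i_def)
    have le: "sg k * q (di k) (dj k) (pt k) \<le> c0 + Q z / 2" if z: "z \<in> ?P i" for z
    proof -
      have "norm (dpot e B (pt k) (di k) - dpot e B z (di k)) \<le> osc_const TYPE('a) * norm (di k)"
      proof (rule dpot_osc[OF e _ _ _ B finB, where c="pt i" and s="5 * r i"])
        show "norm (pt k - pt i) \<le> 5 * r i" using f(2)[OF k] by (simp add: i_def dist_norm norm_minus_commute)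
        show "norm (z - pt i) \<le> 5 * r i" using z i by (simp add: dist_norm norm_minus_commute)
        show "cball (pt i) (2 * (5 * r i)) \<subseteq> B" using i by (auto simp: B_def)
      qed (use i in simp)
      then have "\<bar>q (di k) (dj k) (pt k) - q (di k) (dj k) z\<bar> \<le> osc_const TYPE('a)"
        using Basis_le_norm[of "dj k" "dpot e B (pt k) (di k) - dpot e B z (di k)"] ij[OF k]
        by (simp add: q_def inner_diff_left)
      \<comment> \<open>From (|q| - 1)^2 \<ge> 0; passing to the square is what makes the energy
        bound applicable.\<close>
      moreover have "\<bar>q (di k) (dj k) z\<bar> \<le> 1 / 2 + Q z / 2"
      proof -
        have "(q (di k) (dj k) z)\<^sup>2 \<le> (\<Sum>j\<in>Basis. (q (di k) j z)\<^sup>2)"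
          using ij[OF k] by (intro member_le_sum) auto
        also have "\<dots> \<le> Q z" unfolding Q_def using ij[OF k]
          by (intro member_le_sum[of _ _ "\<lambda>i. \<Sum>j\<in>Basis. (q i j z)\<^sup>2"]) (auto intro: sum_nonneg)
        finally have "(q (di k) (dj k) z)\<^sup>2 \<le> Q z" .
        moreover have "0 \<le> (\<bar>q (di k) (dj k) z\<bar> - 1)\<^sup>2" by simp
        ultimately show ?thesis by (simp add: power2_eq_square algebra_simps)
      qed
      ultimately have "\<bar>q (di k) (dj k) (pt k)\<bar> \<le> c0 + Q z / 2" by (simp add: c0_def)
      moreover have "sg k * q (di k) (dj k) (pt k) \<le> 1 * \<bar>q (di k) (dj k) (pt k)\<bar>"
      proof -
        have "sg k * q (di k) (dj k) (pt k) \<le> \<bar>sg k\<bar> * \<bar>q (di k) (dj k) (pt k)\<bar>"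
          unfolding abs_mult[symmetric] by (rule abs_ge_self)
        also have "\<dots> \<le> 1 * \<bar>q (di k) (dj k) (pt k)\<bar>"
          by (rule mult_right_mono) (use ij[OF k] in simp_all)
        finally show ?thesis .
      qed
      ultimately show ?thesis by simp
    qed
    define V where "V = ?v * r i ^ ?n"
    have V: "V > 0" "measure lborel (?P i) = V" using v i by (simp_all add: V_def content_cball)
    have finP: "emeasure lborel (?P i) < \<infinity>" using i by (simp add: emeasure_cball_euclidean less_imp_le)
    have i1: "integrable lborel (\<lambda>x. indicator (?P i) x * c)" for c :: real
      using finP by (intro integrable_mult_left integrable_real_indicator) auto
    have "(\<integral>x. indicator (?P i) x * (sg k * q (di k) (dj k) (pt k)) \<partial>lborel)
       \<le> (\<integral>x. indicator (?P i) x * c0 + indicator (?P i) x * Q x * (1 / 2) \<partial>lborel)"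
    proof (rule integral_mono)
      show "integrable lborel (\<lambda>x. indicator (?P i) x * c0 + indicator (?P i) x * Q x * (1 / 2))"
        by (intro Bochner_Integration.integrable_add i1 integrable_mult_left intP)
      show "indicator (?P i) x * (sg k * q (di k) (dj k) (pt k)) \<le> indicator (?P i) x * c0 + indicator (?P i) x * Q x * (1 / 2)" for x
        using le[of x] by (cases "x \<in> ?P i") (simp_all only: indicator_simps, simp_all)
    qed (rule i1)
    also have "\<dots> = V * c0 + m i / 2"
    proof -
      have "integrable lborel (\<lambda>x. indicator (?P i) x * Q x * (1 / 2))"
        by (intro integrable_mult_left intP)
      from Bochner_Integration.integral_add[OF i1 this] show ?thesis
        using V(2) by (simp add: m_def)
    qed
    finally have "V * (sg k * q (di k) (dj k) (pt k)) \<le> V * c0 + m i / 2" using V(2) by simp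
    then have "sg k * q (di k) (dj k) (pt k) \<le> (V * c0 + m i / 2) / V"
      using V(1) by (simp add: pos_le_divide_eq mult.commute)
    also have "\<dots> = c0 + m i / (2 * V)" using V(1) by (simp add: field_simps)
    finally show ?thesis by (simp add: i_def V_def)
  qed
  have "(\<Sum>k\<in>I. w k * (sg k * q (di k) (dj k) (pt k))) \<le> (\<Sum>k\<in>I. w k * c0 + w k * (m (f k) / (2 * (?v * r (f k) ^ ?n))))"
    unfolding distrib_left[symmetric] by (intro sum_mono mult_left_mono pw) (auto simp: less_imp_le[OF w])
  also have "\<dots> = c0 * W + (\<Sum>k\<in>I. w k * (m (f k) / (2 * (?v * r (f k) ^ ?n))))"
    by (simp add: sum.distrib W_def sum_distrib_left mult.commute)
  finally have 1: "(\<Sum>k\<in>I. w k * (sg k * q (di k) (dj k) (pt k)))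
     \<le> c0 * W + (\<Sum>k\<in>I. w k * (m (f k) / (2 * (?v * r (f k) ^ ?n))))" .
  have "(\<Sum>k\<in>I. w k * (m (f k) / (2 * (?v * r (f k) ^ ?n))))
     = (\<Sum>i\<in>C. \<Sum>k\<in>{k\<in>I. f k = i}. w k * (m (f k) / (2 * (?v * r (f k) ^ ?n))))"
    by (rule sum.group[symmetric]) (use finC I f(1) in auto)
  also have "\<dots> \<le> (\<Sum>i\<in>C. \<kappa> * 5 ^ ?n * W / (2 * ?v) * m i)"
  proof (rule sum_mono)
    fix i assume i: "i \<in> C"
    have ri: "r i > 0" using r(1) CI[OF i] by blast
    \<comment> \<open>The stopping rule bounds the weight of a group by a multiple of the volume of
      its small ball, so dividing by that volume leaves a factor common to all groups.\<close>
    have "(\<Sum>k\<in>{k\<in>I. f k = i}. w k) \<le> T (cball (pt i) (5 * r i))"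
      unfolding T_def using I w f(2) by (intro sum_mono2) (auto simp: less_imp_le)
    also have "\<dots> \<le> \<kappa> * (5 * r i) ^ ?n * W" using r(3) CI[OF i] by blast
    finally have s: "(\<Sum>k\<in>{k\<in>I. f k = i}. w k) \<le> \<kappa> * (5 * r i) ^ ?n * W" .
    have "(\<Sum>k\<in>{k\<in>I. f k = i}. w k * (m (f k) / (2 * (?v * r (f k) ^ ?n))))
       = (\<Sum>k\<in>{k\<in>I. f k = i}. w k) * (m i / (2 * (?v * r i ^ ?n)))"
      unfolding sum_distrib_right by (rule sum.cong) auto
    also have "\<dots> \<le> \<kappa> * (5 * r i) ^ ?n * W * (m i / (2 * (?v * r i ^ ?n)))"
      using m0[of i] ri v by (intro mult_right_mono s) auto
    also have "\<dots> = \<kappa> * 5 ^ ?n * W / (2 * ?v) * m i" using ri by (simp add: power_mult_distrib)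
    finally show "(\<Sum>k\<in>{k\<in>I. f k = i}. w k * (m (f k) / (2 * (?v * r (f k) ^ ?n)))) \<le> \<kappa> * 5 ^ ?n * W / (2 * ?v) * m i" .
  qed
  also have "(\<Sum>i\<in>C. \<kappa> * 5 ^ ?n * W / (2 * ?v) * m i) = \<kappa> * 5 ^ ?n * W / (2 * ?v) * (\<Sum>i\<in>C. m i)"
    by (simp add: sum_distrib_left)
  also have "\<dots> \<le> \<kappa> * 5 ^ ?n * W / (2 * ?v) * ((trace_mass TYPE('a))\<^sup>2 * ((1 + 10 ^ ?n) * ?v / \<kappa>))"
  proof (rule mult_left_mono)
    \<comment> \<open>Since the small balls are disjoint, their energies add up to at most the
      global energy.\<close>
    have "(\<Sum>i\<in>C. m i) = (\<integral>x. (\<Sum>i\<in>C. indicator (?P i) x * Q x) \<partial>lborel)"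
      unfolding m_def by (rule Bochner_Integration.integral_sum[symmetric]) (rule intP)
    also have "\<dots> \<le> (\<integral>x. Q x \<partial>lborel)"
    proof (rule integral_mono[OF Bochner_Integration.integrable_sum[OF intP] en(1)])
      fix x
      have "(\<Sum>i\<in>C. indicator (?P i) x * Q x) = indicator (\<Union>i\<in>C. ?P i) x * Q x"
        by (simp only: sum_distrib_right[symmetric] indicator_UN_disjoint[OF finC disj])
      also have "\<dots> \<le> 1 * Q x" by (intro mult_right_mono Q0) (simp add: indicator_def)
      finally show "(\<Sum>i\<in>C. indicator (?P i) x * Q x) \<le> Q x" by simp
    qed
    also have "\<dots> \<le> (trace_mass TYPE('a))\<^sup>2 * measure lborel B" by (rule en(2))
    also have "\<dots> \<le> (trace_mass TYPE('a))\<^sup>2 * ((1 + 10 ^ ?n) * ?v / \<kappa>)" by (intro mult_left_mono mB) simp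
    finally show "(\<Sum>i\<in>C. m i) \<le> (trace_mass TYPE('a))\<^sup>2 * ((1 + 10 ^ ?n) * ?v / \<kappa>)" .
  qed (use l W v in simp)
  finally have 2: "(\<Sum>k\<in>I. w k * (m (f k) / (2 * (?v * r (f k) ^ ?n))))
     \<le> \<kappa> * 5 ^ ?n * W / (2 * ?v) * ((trace_mass TYPE('a))\<^sup>2 * ((1 + 10 ^ ?n) * ?v / \<kappa>))" .
  have 3: "c0 * W + \<kappa> * 5 ^ ?n * W / (2 * ?v) * ((trace_mass TYPE('a))\<^sup>2 * ((1 + 10 ^ ?n) * ?v / \<kappa>)) = payoff_bound TYPE('a) * W"
  proof -
    have key: "k * F * X / (2 * V) * (A * (G * V / k)) = F * A * G / 2 * X" if "k \<noteq> 0" "V \<noteq> 0" for k F X V A G :: real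
      using that by simp
    have eq: "\<kappa> * 5 ^ ?n * W / (2 * ?v) * ((trace_mass TYPE('a))\<^sup>2 * ((1 + 10 ^ ?n) * ?v / \<kappa>))
      = 5 ^ ?n * (trace_mass TYPE('a))\<^sup>2 * (1 + 10 ^ ?n) / 2 * W"
      by (rule key[OF less_imp_neq[OF l, symmetric] less_imp_neq[OF v, symmetric]])
    show ?thesis unfolding eq payoff_bound_def c0_def by (rule distrib_right[symmetric])
  qed
  have "(\<Sum>k\<in>I. w k * (sg k * q (di k) (dj k) (pt k))) \<le> payoff_bound TYPE('a) * W"
    using 1 2 3 by linarith
  then show ?thesis
    using B UB BR mB unfolding q_def W_def by blast
qed

section \<open>Compressing fields\<close>

lemma payoff_bound_nonneg: "payoff_bound TYPE('a::euclidean_space) \<ge> 0"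
  by (simp add: payoff_bound_def osc_const_nonneg)

text \<open>One unit is the slack of the multiplicative weights, the other pays for passing from the
  net to the whole ball.\<close>

definition grad_bound :: "'a::euclidean_space itself \<Rightarrow> real"
  where "grad_bound _ = payoff_bound TYPE('a) + 2"

text \<open>The bound of \<open>norm_pot_le\<close> for a set of measure (1 + 10^n) \<rho>^n times
  that of the unit ball.\<close>

definition size_bound :: "'a::euclidean_space itself \<Rightarrow> real"
  where "size_bound _ = (2 ^ DIM('a) + (1 + 10 ^ DIM('a))) * unit_ball_vol (real DIM('a))"

definition div_bound :: "'a::euclidean_space itself \<Rightarrow> real"
  where "div_bound _ = real DIM('a) * unit_ball_vol (real DIM('a)) / 2 ^ (DIM('a) + 2)"

text \<open>Size and divergence estimates hold for every admissible set and survive averaging. The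
  entries of the gradient are bounded only for a suitable average, supplied by the multiplicative
  weights.\<close>

lemma exists_compressing_field:
  fixes K :: "'a::euclidean_space set"
  assumes K: "compact K" "emeasure lborel K = 0" "K \<subseteq> ball 0 R" and R: "R > 0" and \<rho>: "0 < \<rho>" "\<rho> \<le> 1"
  shows "\<exists>u u'. (\<forall>x. (u has_derivative u' x) (at x)) \<and> (\<forall>v. continuous_on UNIV (\<lambda>x. u' x v)) \<and>
    (\<forall>x\<in>cball 0 R. \<forall>i\<in>Basis. \<forall>j\<in>Basis. \<bar>u' x i \<bullet> j\<bar> \<le> grad_bound TYPE('a)) \<and>
    (\<forall>x. norm (u x) \<le> size_bound TYPE('a) * \<rho>) \<and>
    (\<forall>x. 0 \<le> (\<Sum>b\<in>Basis. u' x b \<bullet> b)) \<and>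
    (\<forall>x\<in>K. div_bound TYPE('a) \<le> (\<Sum>b\<in>Basis. u' x b \<bullet> b))"
proof -
  let ?n = "DIM('a)" and ?v = "unit_ball_vol (real DIM('a))" and ?C = "payoff_bound TYPE('a)"
  have v: "?v > 0" by simp
  \<comment> \<open>All admissible sets then have measure O(\<rho>^n). \<open>K\<close> is null, so
    an open neighbourhood of measure below this order exists.\<close>
  define \<kappa> where "\<kappa> = 1 / \<rho> ^ ?n"
  have \<kappa>: "\<kappa> > 0" using \<rho> by (simp add: \<kappa>_def)
  have Kb: "K \<in> sets borel" using K(1) by (simp add: borel_compact)
  obtain V where V: "open V" "K \<subseteq> V" "emeasure lborel V < ennreal (?v / \<kappa>)"
  proof -
    have vk: "?v / \<kappa> > 0" using v \<kappa> by simp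
    obtain V where "open V" "K \<subseteq> V" "emeasure lborel (V - K) < ennreal (?v / \<kappa>)"
      by (rule outer_regular_lborel[OF Kb vk])
    moreover have "emeasure lborel V \<le> emeasure lborel (V - K) + emeasure lborel K"
      using Kb \<open>open V\<close> emeasure_subadditive[of "V - K" lborel K] \<open>K \<subseteq> V\<close>
      by (simp add: Un_absorb2 Un_Diff_cancel2 borel_open)
    ultimately show ?thesis using K(2) that by (metis add.right_neutral order_le_less_trans)
  qed
  define U where "U = V \<inter> ball 0 R"
  have U: "open U" "K \<subseteq> U" "U \<in> sets borel" "U \<subseteq> cball 0 R"
    using V K by (auto simp: U_def borel_open)
  have mU: "measure lborel U \<le> ?v / \<kappa>"
  proof -
    have "emeasure lborel U \<le> ennreal (?v / \<kappa>)"
      using V by (intro order_trans[OF emeasure_mono[of U V]]) (auto simp: U_def borel_open)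
    then show ?thesis using v \<kappa> unfolding measure_def by (intro enn2real_leI) auto
  qed
  \<comment> \<open>Every admissible set contains \<open>U\<close>, hence the \<open>e\<close>-balls
    about \<open>K\<close>, on which the lower bound of the divergence relies.\<close>
  obtain e where e: "e > 0" "(\<Union>x\<in>K. cball x e) \<subseteq> U"
    using compact_subset_open_imp_cball_epsilon_subset[OF K(1) U(1,2)] by blast
  define R' where "R' = R + 10 * max 1 (1 / \<kappa>)"
  have R': "R' \<ge> 0" using R by (simp add: R'_def)
  define m0 where "m0 = (1 + 10 ^ ?n) * ?v / \<kappa>"
  have m0: "m0 \<ge> 0" using v \<kappa> by (simp add: m0_def)
  define S where "S = {B \<in> sets borel. U \<subseteq> B \<and> B \<subseteq> cball (0::'a) R' \<and> measure lborel B \<le> m0}"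
  have S: "B \<in> sets borel" "U \<subseteq> B" "emeasure lborel B < \<infinity>" "measure lborel B \<le> m0" if "B \<in> S" for B
    using that emeasure_bounded_finite[OF _ R', of B] by (auto simp: S_def)
  \<comment> \<open>A Lipschitz constant of the gradients common to all admissible sets. It may be
    huge, as it depends on \<open>e\<close>, but it only sets the mesh \<open>\<tau>\<close> of the
    net.\<close>
  define \<Lambda> where "\<Lambda> = real ?n * (real ?n + 5) / e ^ (?n + 1) * m0"
  have \<Lambda>: "\<Lambda> \<ge> 0" using e m0 by (simp add: \<Lambda>_def)
  define \<tau> where "\<tau> = 1 / (\<Lambda> + 1)"
  have \<tau>: "\<tau> > 0" "\<Lambda> * \<tau> \<le> 1" using \<Lambda> by (simp_all add: \<tau>_def)
  obtain X where X: "finite X" "X \<subseteq> cball (0::'a) R" "cball 0 R \<subseteq> (\<Union>x\<in>X. ball x \<tau>)"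
  proof -
    have "seq_compact (cball (0::'a) R)" by (rule compact_imp_seq_compact[OF compact_cball])
    from seq_compact_imp_totally_bounded[OF this, rule_format, OF \<tau>(1)] show ?thesis using that by meson
  qed
  \<comment> \<open>Both signs are included so that one-sided payoff bounds control absolute
    values.\<close>
  define I where "I = X \<times> (Basis :: 'a set) \<times> (Basis :: 'a set) \<times> {1, - 1 :: real}"
  have I: "finite I" using X(1) by (simp add: I_def)
  define p where "p B k = (case k of (x, i, j, s) \<Rightarrow> s * (dpot e B x i \<bullet> j))" for B :: "'a set" and k
  \<comment> \<open>Each weight on \<open>I\<close> has a response in \<open>S\<close> by the
    decomposition argument, so one finite sequence of sets has small average payoff at every
    index.\<close>
  have "\<exists>n>0. \<exists>b. (\<forall>t<n. b t \<in> S) \<and> (\<forall>k\<in>I. (\<Sum>t<n. p (b t) k) / real n \<le> ?C + 1)"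
  proof (rule multiplicative_weights[OF I _ payoff_bound_nonneg])
    fix B k assume B: "B \<in> S" and k: "k \<in> I"
    obtain x i j s where k': "k = (x, i, j, s)" by (cases k)
    have ij: "i \<in> Basis" "j \<in> Basis" "\<bar>s\<bar> = 1" using k by (auto simp: I_def k')
    have "\<bar>p B k\<bar> = \<bar>dpot e B x i \<bullet> j\<bar>" using ij by (simp add: p_def k' abs_mult)
    also have "\<dots> \<le> norm (dpot e B x i)" by (rule Basis_le_norm[OF ij(2)])
    also have "\<dots> \<le> (real ?n + 1) / e ^ ?n * norm i * measure lborel B"
      by (rule norm_dpot_le[OF e(1) S(1,3)[OF B]])
    also have "\<dots> \<le> (real ?n + 1) / e ^ ?n * norm i * m0"
      using e S(4)[OF B] by (intro mult_left_mono) auto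
    finally show "\<bar>p B k\<bar> \<le> (real ?n + 1) / e ^ ?n * m0" using ij by simp
  next
    fix w :: "'a \<times> 'a \<times> 'a \<times> real \<Rightarrow> real" assume w: "\<And>k. k \<in> I \<Longrightarrow> w k > 0"
    have "\<exists>B\<in>sets borel. U \<subseteq> B \<and> B \<subseteq> cball 0 (R + 10 * max 1 (1 / \<kappa>)) \<and>
      measure lborel B \<le> (1 + 10 ^ ?n) * ?v / \<kappa> \<and>
      (\<Sum>k\<in>I. w k * (snd (snd (snd k)) * (dpot e B (fst k) (fst (snd k)) \<bullet> fst (snd (snd k))))) \<le> ?C * (\<Sum>k\<in>I. w k)"
    proof (rule weighted_payoff_le[OF e(1) I w _ \<kappa> _ U(3,4) mU])
      show "fst (snd k) \<in> Basis \<and> fst (snd (snd k)) \<in> Basis \<and> \<bar>snd (snd (snd k))\<bar> \<le> 1 \<and> norm (fst k) \<le> R" if "k \<in> I" for k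
        using that X(2) by (auto simp: I_def)
    qed (use R in auto)
    then show "\<exists>B\<in>S. (\<Sum>k\<in>I. w k * p B k) \<le> ?C * (\<Sum>k\<in>I. w k)"
      unfolding S_def R'_def m0_def p_def case_prod_beta by blast
  qed
  then obtain n b where n: "n > 0" and b: "\<And>t. t < n \<Longrightarrow> b t \<in> S"
    and pb: "\<And>k. k \<in> I \<Longrightarrow> (\<Sum>t<n. p (b t) k) / real n \<le> ?C + 1" by blast
  define u where "u x = (1 / real n) *\<^sub>R (\<Sum>t<n. pot e (b t) x)" for x
  define u' where "u' x v = (1 / real n) *\<^sub>R (\<Sum>t<n. dpot e (b t) x v)" for x v
  have der: "(u has_derivative u' x) (at x)" for x
    unfolding u_def[abs_def] u'_def[abs_def]
    by (intro has_derivative_scaleR_right has_derivative_sum has_derivative_pot e(1) S(1,3) b) auto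
  have avg: "norm ((1 / real n) *\<^sub>R (\<Sum>t<n. f t)) \<le> A" if "\<And>t. t < n \<Longrightarrow> norm (f t) \<le> A" for f :: "nat \<Rightarrow> 'a" and A
  proof -
    have "norm (\<Sum>t<n. f t) \<le> real n * A" using sum_norm_bound[of "{..<n}" f A] that by simp
    then show ?thesis using n by (simp add: divide_simps mult.commute)
  qed
  have lip: "norm (u' x v - u' z v) \<le> \<Lambda> * norm v * norm (x - z)" for x z v
  proof -
    have "u' x v - u' z v = (1 / real n) *\<^sub>R (\<Sum>t<n. dpot e (b t) x v - dpot e (b t) z v)"
      by (simp add: u'_def sum_subtractf scaleR_diff_right)
    also have "norm \<dots> \<le> \<Lambda> * norm v * norm (x - z)"
    proof (rule avg)
      fix t assume t: "t < n"
      have "norm (dpot e (b t) x v - dpot e (b t) z v)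
        \<le> real ?n * (real ?n + 5) * norm v / e ^ (?n + 1) * norm (x - z) * measure lborel (b t)"
        by (rule dpot_lipschitz[OF e(1) S(1,3)[OF b[OF t]]])
      also have "\<dots> \<le> real ?n * (real ?n + 5) * norm v / e ^ (?n + 1) * norm (x - z) * m0"
        using e S(4)[OF b[OF t]] by (intro mult_left_mono) auto
      finally show "norm (dpot e (b t) x v - dpot e (b t) z v) \<le> \<Lambda> * norm v * norm (x - z)"
        by (simp add: \<Lambda>_def mult_ac)
    qed
    finally show ?thesis .
  qed
  have cont: "continuous_on UNIV (\<lambda>x. u' x v)" for v
    by (rule lipschitz_on_continuous_on[OF lipschitz_onI[where L="\<Lambda> * norm v"]])
      (use lip \<Lambda> in \<open>auto simp: dist_norm\<close>)
  have grad: "\<bar>u' x i \<bullet> j\<bar> \<le> grad_bound TYPE('a)" if x: "x \<in> cball 0 R" and ij: "i \<in> Basis" "j \<in> Basis" for x i j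
  proof -
    obtain z where z: "z \<in> X" "norm (x - z) < \<tau>" using X(3) x by (auto simp: dist_norm norm_minus_commute)
    have "s * (u' z i \<bullet> j) \<le> ?C + 1" if "s \<in> {1, - 1}" for s
    proof -
      have "(z, i, j, s) \<in> I" using z ij that by (simp add: I_def)
      from pb[OF this] show ?thesis
        by (simp add: p_def u'_def inner_sum_left sum_distrib_left[symmetric])
    qed
    from this[of 1] this[of "- 1"] have "\<bar>u' z i \<bullet> j\<bar> \<le> ?C + 1" by simp
    moreover have "\<bar>u' x i \<bullet> j - u' z i \<bullet> j\<bar> \<le> 1"
    proof -
      have "\<bar>u' x i \<bullet> j - u' z i \<bullet> j\<bar> \<le> norm (u' x i - u' z i)"
        using Basis_le_norm[OF ij(2), of "u' x i - u' z i"] by (simp add: inner_diff_left)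
      also have "\<dots> \<le> \<Lambda> * norm (x - z)" using lip[of x i z] ij by simp
      also have "\<dots> \<le> \<Lambda> * \<tau>" using z \<Lambda> by (intro mult_left_mono) auto
      finally show ?thesis using \<tau>(2) by simp
    qed
    ultimately show ?thesis by (simp add: grad_bound_def)
  qed
  have size: "norm (u x) \<le> size_bound TYPE('a) * \<rho>" for x
    unfolding u_def
  proof (rule avg)
    fix t assume t: "t < n"
    have "norm (pot e (b t) x) \<le> 2 ^ ?n * ?v * \<rho> + measure lborel (b t) / \<rho> ^ (?n - 1)"
      by (rule norm_pot_le[OF e(1) S(1,3)[OF b[OF t]] \<rho>(1)])
    also have "\<dots> \<le> 2 ^ ?n * ?v * \<rho> + m0 / \<rho> ^ (?n - 1)"
      using S(4)[OF b[OF t]] \<rho> by (intro add_left_mono divide_right_mono) auto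
    also have "m0 / \<rho> ^ (?n - 1) = (1 + 10 ^ ?n) * ?v * \<rho>"
    proof -
      obtain m where m: "?n = Suc m" using DIM_positive[where 'a='a] by (cases ?n) auto
      show ?thesis unfolding m0_def \<kappa>_def m using \<rho> by simp
    qed
    finally show "norm (pot e (b t) x) \<le> size_bound TYPE('a) * \<rho>"
      by (simp add: size_bound_def algebra_simps)
  qed
  have div: "(\<Sum>d\<in>Basis. u' x d \<bullet> d) = (\<Sum>t<n. divpot e (b t) x) / real n" for x
  proof -
    have "(\<Sum>d\<in>Basis. u' x d \<bullet> d) = (\<Sum>d\<in>Basis. \<Sum>t<n. dpot e (b t) x d \<bullet> d) / real n"
      by (simp add: u'_def inner_sum_left sum_divide_distrib)
    also have "(\<Sum>d\<in>Basis. \<Sum>t<n. dpot e (b t) x d \<bullet> d) = (\<Sum>t<n. \<Sum>d\<in>Basis. dpot e (b t) x d \<bullet> d)"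
      by (rule sum.swap)
    also have "\<dots> = (\<Sum>t<n. divpot e (b t) x)"
      by (rule sum.cong) (auto intro!: dpot_trace e(1) S(1,3) b)
    finally show ?thesis .
  qed
  have div0: "0 \<le> (\<Sum>d\<in>Basis. u' x d \<bullet> d)" for x
    unfolding div by (intro divide_nonneg_nonneg sum_nonneg divpot_nonneg e(1) S(1,3) b) auto
  have divK: "div_bound TYPE('a) \<le> (\<Sum>d\<in>Basis. u' x d \<bullet> d)" if x: "x \<in> K" for x
  proof -
    have "real n * div_bound TYPE('a) = (\<Sum>t<n. div_bound TYPE('a))" by simp
    also have "\<dots> \<le> (\<Sum>t<n. divpot e (b t) x)"
    proof (rule sum_mono)
      fix t assume "t \<in> {..<n}"
      then have t: "b t \<in> S" using b by simp
      have "cball x e \<subseteq> b t" using e(2) x S(2)[OF t] by blast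
      from divpot_ge[OF e(1) S(1,3)[OF t] this]
      show "div_bound TYPE('a) \<le> divpot e (b t) x" unfolding div_bound_def .
    qed
    finally show ?thesis unfolding div using n by (simp add: divide_simps mult.commute)
  qed
  show ?thesis using der cont grad size div0 divK by blast
qed

text \<open>Squaring the positive part removes its kink, so the cut-off is continuously
  differentiable with an explicit derivative.\<close>

lemma has_derivative_cutoff:
  fixes x :: "'a::euclidean_space"
  shows "((\<lambda>x. (max 0 (1 - x \<bullet> x / R\<^sup>2))\<^sup>2) has_derivative
    (\<lambda>v. - (4 * max 0 (1 - x \<bullet> x / R\<^sup>2) * (x \<bullet> v) / R\<^sup>2))) (at x)"
proof -
  have "((\<lambda>t. (max 0 t)\<^sup>2) has_derivative (\<lambda>h. 2 * max 0 t * h)) (at t)" for t :: real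
  proof (rule has_derivative_quadraticI[where C=1])
    show "bounded_linear (\<lambda>h. 2 * max 0 t * h)" by (rule bounded_linear_mult_right)
    fix h :: real
    have k: "\<bar>(max 0 (t + h))\<^sup>2 - (max 0 t)\<^sup>2 - 2 * max 0 t * h\<bar> \<le> h\<^sup>2"
    proof -
      consider "t \<ge> 0" "t + h \<ge> 0" | "t \<ge> 0" "t + h < 0" | "t < 0" "t + h \<ge> 0" | "t < 0" "t + h < 0" by linarith
      then show ?thesis
      proof cases
        case 1
        then show ?thesis by (simp add: power2_eq_square algebra_simps)
      next
        case 2
        then have "0 \<le> - 2 * t * h - t\<^sup>2" "- 2 * t * h - t\<^sup>2 \<le> h\<^sup>2"
          using mult_nonneg_nonneg[of t "- (t + h)"] mult_nonneg_nonneg[of t "- h"] zero_le_power2[of "t + h"]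
          by (auto simp: power2_eq_square algebra_simps)
        then show ?thesis using 2 by (simp add: abs_if)
      next
        case 3
        then have "(t + h)\<^sup>2 \<le> h\<^sup>2" by (intro power_mono) auto
        then show ?thesis using 3 by simp
      qed simp
    qed
    then show "norm ((max 0 (t + h))\<^sup>2 - (max 0 t)\<^sup>2 - 2 * max 0 t * h) \<le> 1 * (norm h)\<^sup>2" by simp
  qed
  moreover have "((\<lambda>x. 1 - x \<bullet> x / R\<^sup>2) has_derivative (\<lambda>v. - (2 * (x \<bullet> v) / R\<^sup>2))) (at x)"
  proof -
    have "((\<lambda>x. 1 - (1 / R\<^sup>2) * (x \<bullet> x)) has_derivative (\<lambda>v. 0 - (1 / R\<^sup>2) * (x \<bullet> v + v \<bullet> x))) (at x)"
      by (intro has_derivative_diff has_derivative_const has_derivative_mult_right has_derivative_inner has_derivative_ident)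
    then show ?thesis by (simp add: inner_commute)
  qed
  ultimately show ?thesis
    using has_derivative_compose[of "\<lambda>x. 1 - x \<bullet> x / R\<^sup>2" "\<lambda>v. - (2 * (x \<bullet> v) / R\<^sup>2)" x UNIV "\<lambda>t. (max 0 t)\<^sup>2"
       "\<lambda>h. 2 * max 0 (1 - x \<bullet> x / R\<^sup>2) * h"] by (simp add: mult.assoc)
qed

text \<open>Multiplying by a cut-off makes the gradient bound global, since the field now vanishes
  outside the ball where the bound is known. The price is a factor 1 / 2 on \<open>K\<close> and a
  divergence error O(\<rho>).\<close>

lemma exists_compressing_field_compact_support:
  fixes K :: "'a::euclidean_space set"
  assumes K: "compact K" "emeasure lborel K = 0" and \<rho>: "0 < \<rho>" "\<rho> \<le> 1"
  shows "\<exists>u u'. (\<forall>x. (u has_derivative u' x) (at x)) \<and> (\<forall>v. continuous_on UNIV (\<lambda>x. u' x v)) \<and>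
    (\<forall>x. \<forall>i\<in>Basis. \<forall>j\<in>Basis. \<bar>u' x i \<bullet> j\<bar> \<le> grad_bound TYPE('a) + 4 * size_bound TYPE('a)) \<and>
    (\<forall>x. norm (u x) \<le> size_bound TYPE('a) * \<rho>) \<and>
    (\<forall>x. - (4 * size_bound TYPE('a) * \<rho>) \<le> (\<Sum>b\<in>Basis. u' x b \<bullet> b)) \<and>
    (\<forall>x\<in>K. div_bound TYPE('a) / 2 - 4 * size_bound TYPE('a) * \<rho> \<le> (\<Sum>b\<in>Basis. u' x b \<bullet> b))"
proof -
  let ?G = "grad_bound TYPE('a)" and ?D = "size_bound TYPE('a)" and ?c = "div_bound TYPE('a)"
  have G: "?G \<ge> 0" using payoff_bound_nonneg[where 'a='a] by (simp add: grad_bound_def)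
  have D: "?D \<ge> 0" by (simp add: size_bound_def less_imp_le)
  have c: "?c \<ge> 0" by (simp add: div_bound_def less_imp_le)
  obtain R0 where R0: "R0 > 0" "K \<subseteq> ball 0 R0"
    using compact_imp_bounded[OF K(1)] bounded_subset_ballD[of K 0] by blast
  \<comment> \<open>\<open>K\<close> lies within half this radius, where the cut-off is at least (3
    / 4)^2; and R \<ge> 1 bounds the derivative of the cut-off by 4.\<close>
  define R where "R = 2 * R0 + 1"
  have R: "R \<ge> 1" using R0 by (simp add: R_def)
  have KR: "K \<subseteq> ball 0 R" using R0 by (auto simp: R_def)
  have R1: "R > 0" using R by simp
  obtain u u' where uu: "\<forall>x. (u has_derivative u' x) (at x)" "\<forall>v. continuous_on UNIV (\<lambda>x. u' x v)"
    "\<forall>x\<in>cball 0 R. \<forall>i\<in>Basis. \<forall>j\<in>Basis. \<bar>u' x i \<bullet> j\<bar> \<le> ?G"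
    "\<forall>x. norm (u x) \<le> ?D * \<rho>" "\<forall>x. 0 \<le> (\<Sum>b\<in>Basis. u' x b \<bullet> b)" "\<forall>x\<in>K. ?c \<le> (\<Sum>b\<in>Basis. u' x b \<bullet> b)"
    using exists_compressing_field[OF K KR R1 \<rho>] by blast
  note u = uu[rule_format]
  define \<theta> where "\<theta> x = (max 0 (1 - x \<bullet> x / R\<^sup>2))\<^sup>2" for x :: 'a
  define \<theta>' where "\<theta>' x v = - (4 * max 0 (1 - x \<bullet> x / R\<^sup>2) * (x \<bullet> v) / R\<^sup>2)" for x v :: 'a
  have \<theta>: "0 \<le> \<theta> x" "\<theta> x \<le> 1" for x
    unfolding \<theta>_def by (auto intro!: power_le_one)
  have out: "max 0 (1 - x \<bullet> x / R\<^sup>2) = 0" if "norm x > R" for x :: 'a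
  proof -
    have "x \<bullet> x > R\<^sup>2" using that R power_strict_mono[of R "norm x" 2] by (simp add: power2_norm_eq_inner)
    then show ?thesis using R by simp
  qed
  have \<theta>'b: "\<bar>\<theta>' x v\<bar> \<le> 4 * norm v" for x v
  proof (cases "norm x > R")
    case True
    then show ?thesis using out[OF True] by (simp add: \<theta>'_def)
  next
    case False
    have "\<bar>x \<bullet> v\<bar> \<le> norm x * norm v" by (rule Cauchy_Schwarz_ineq2)
    also have "\<dots> \<le> R\<^sup>2 * norm v"
      using False R self_le_power[of R 2] by (intro mult_right_mono) auto
    finally have 1: "\<bar>x \<bullet> v\<bar> / R\<^sup>2 \<le> norm v" using R by (simp add: divide_simps mult.commute)
    have "\<bar>\<theta>' x v\<bar> = 4 * max 0 (1 - x \<bullet> x / R\<^sup>2) * (\<bar>x \<bullet> v\<bar> / R\<^sup>2)"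
      by (simp add: \<theta>'_def abs_mult)
    also have "\<dots> \<le> 4 * 1 * norm v"
      using 1 R by (intro mult_mono) auto
    finally show ?thesis by simp
  qed
  define w where "w x = \<theta> x *\<^sub>R u x" for x
  define w' where "w' x v = \<theta> x *\<^sub>R u' x v + \<theta>' x v *\<^sub>R u x" for x v
  have der: "(w has_derivative w' x) (at x)" for x
    unfolding w_def[abs_def] w'_def[abs_def]
    by (rule has_derivative_scaleR[OF has_derivative_cutoff[of R x, folded \<theta>_def \<theta>'_def] u(1)])
  have cont: "continuous_on UNIV (\<lambda>x. w' x v)" for v
  proof -
    have "continuous_on UNIV u"
      using u(1) has_derivative_continuous continuous_at_imp_continuous_on by blast
    then show ?thesis unfolding w'_def \<theta>_def \<theta>'_def
      by (intro continuous_intros u(2)) (use R in auto)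
  qed
  have \<rho>D: "?D * \<rho> \<le> ?D" using \<rho> D by (simp add: mult_left_le)
  have grad: "\<bar>w' x i \<bullet> j\<bar> \<le> ?G + 4 * ?D" if ij: "i \<in> Basis" "j \<in> Basis" for x i j
  proof (cases "norm x > R")
    case True
    then show ?thesis using out[OF True] G D by (simp add: w'_def \<theta>_def \<theta>'_def)
  next
    case False
    have "\<bar>\<theta> x * (u' x i \<bullet> j)\<bar> \<le> 1 * ?G"
      unfolding abs_mult using \<theta>[of x] False ij by (intro mult_mono u(3)) auto
    moreover have "\<bar>\<theta>' x i * (u x \<bullet> j)\<bar> \<le> 4 * ?D"
    proof -
      have "\<bar>u x \<bullet> j\<bar> \<le> ?D" using Basis_le_norm[OF ij(2), of "u x"] u(4)[of x] \<rho>D by linarith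
      moreover have "\<bar>\<theta>' x i\<bar> \<le> 4" using \<theta>'b[of x i] ij by simp
      ultimately show ?thesis unfolding abs_mult by (intro mult_mono) auto
    qed
    ultimately show ?thesis by (simp add: w'_def inner_add_left)
  qed
  have size: "norm (w x) \<le> ?D * \<rho>" for x
  proof -
    have "norm (w x) \<le> 1 * norm (u x)" unfolding w_def norm_scaleR using \<theta>[of x] by (intro mult_right_mono) auto
    then show ?thesis using u(4)[of x] by simp
  qed
  have div: "(\<Sum>b\<in>Basis. w' x b \<bullet> b) = \<theta> x * (\<Sum>b\<in>Basis. u' x b \<bullet> b) + \<theta>' x (u x)" for x
  proof -
    have "(\<Sum>b\<in>Basis. \<theta>' x b * (u x \<bullet> b)) = \<theta>' x (u x)"
    proof -
      have 1: "\<theta>' x b * (u x \<bullet> b) = - (4 * max 0 (1 - x \<bullet> x / R\<^sup>2) / R\<^sup>2) * ((x \<bullet> b) * (u x \<bullet> b))" for b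
        by (simp add: \<theta>'_def)
      show ?thesis
        unfolding 1 sum_distrib_left[symmetric] euclidean_inner[symmetric] by (simp add: \<theta>'_def)
    qed
    then show ?thesis by (simp add: w'_def inner_add_left sum.distrib sum_distrib_left)
  qed
  \<comment> \<open>The product rule adds to the divergence only the derivative of the cut-off along
    the field, which is small because the field is.\<close>
  have \<theta>'u: "- (4 * ?D * \<rho>) \<le> \<theta>' x (u x)" for x
    using \<theta>'b[of x "u x"] u(4)[of x] by simp
  have div0: "- (4 * ?D * \<rho>) \<le> (\<Sum>b\<in>Basis. w' x b \<bullet> b)" for x
    unfolding div using \<theta>'u[of x] mult_nonneg_nonneg[OF \<theta>(1)[of x] u(5)[of x]] by linarith
  have divK: "?c / 2 - 4 * ?D * \<rho> \<le> (\<Sum>b\<in>Basis. w' x b \<bullet> b)" if x: "x \<in> K" for x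
  proof -
    have "norm x \<le> R / 2" using x R0 by (auto simp: R_def)
    then have "x \<bullet> x \<le> (R / 2)\<^sup>2" using power_mono[of "norm x" "R / 2" 2] by (simp add: power2_norm_eq_inner)
    then have "x \<bullet> x / R\<^sup>2 \<le> 1 / 4" using R by (simp add: divide_simps power_divide)
    then have "3 / 4 \<le> max 0 (1 - x \<bullet> x / R\<^sup>2)" by linarith
    then have "(3 / 4)\<^sup>2 \<le> \<theta> x" unfolding \<theta>_def by (rule power_mono) simp
    then have "1 / 2 \<le> \<theta> x" by (simp add: power2_eq_square)
    then have "1 / 2 * ?c \<le> \<theta> x * (\<Sum>b\<in>Basis. u' x b \<bullet> b)" using u(6)[OF x] c \<theta> by (intro mult_mono) auto
    then show ?thesis unfolding div using \<theta>'u[of x] by simp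
  qed
  show ?thesis using der cont grad size div0 divK by blast
qed

section \<open>From fields to maps\<close>

text \<open>By induction: a new factor adds the cross term -t a_k (P - 1), where the previous
  product differs from 1 by O(t); so the error stays O(t^2) uniformly in the bounded numbers
  a_i.\<close>

lemma prod_one_minus_approx:
  assumes "finite I" and L: "L \<ge> 0"
  shows "\<exists>C\<ge>0. \<forall>a t. (\<forall>i\<in>I. \<bar>a i\<bar> \<le> L) \<longrightarrow> 0 \<le> t \<longrightarrow> t \<le> 1 \<longrightarrow>
    \<bar>(\<Prod>i\<in>I. 1 - t * a i) - (1 - t * (\<Sum>i\<in>I. a i))\<bar> \<le> C * (t::real)\<^sup>2"
  using assms(1)
proof (induction I rule: finite_induct)
  case (insert k I)
  then obtain C where C: "C \<ge> 0" and IH: "\<And>a t. (\<forall>i\<in>I. \<bar>a i\<bar> \<le> L) \<Longrightarrow> 0 \<le> t \<Longrightarrow> t \<le> 1 \<Longrightarrow>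
    \<bar>(\<Prod>i\<in>I. 1 - t * a i) - (1 - t * (\<Sum>i\<in>I. a i))\<bar> \<le> C * (t::real)\<^sup>2" by blast
  define n where "n = real (card I)"
  show ?case
  proof (intro exI[of _ "C + L * (n * L + C)"] conjI allI impI)
    show "0 \<le> C + L * (n * L + C)" using C L by (simp add: n_def)
    fix a and t :: real assume a: "\<forall>i\<in>insert k I. \<bar>a i\<bar> \<le> L" and t: "0 \<le> t" "t \<le> 1"
    define P where "P = (\<Prod>i\<in>I. 1 - t * a i)"
    define s where "s = (\<Sum>i\<in>I. a i)"
    have 1: "\<bar>P - (1 - t * s)\<bar> \<le> C * t\<^sup>2" using IH[of a t] a t by (simp add: P_def s_def)
    have s: "\<bar>s\<bar> \<le> n * L"
      unfolding s_def n_def using sum_norm_bound[of I a L] a by simp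
    have tt: "t\<^sup>2 \<le> t" using t by (simp add: power2_eq_square mult_left_le)
    have "\<bar>P - 1\<bar> \<le> \<bar>P - (1 - t * s)\<bar> + \<bar>t * s\<bar>" by linarith
    also have "\<dots> \<le> C * t + t * (n * L)"
      using 1 mult_left_mono[OF tt C] mult_left_mono[OF s t(1)] t by (simp add: abs_mult)
    finally have 2: "\<bar>P - 1\<bar> \<le> t * (n * L + C)" by (simp add: algebra_simps)
    have "\<bar>t * a k * (P - 1)\<bar> = t * (\<bar>a k\<bar> * \<bar>P - 1\<bar>)" using t by (simp add: abs_mult)
    also have "\<dots> \<le> t * (L * (t * (n * L + C)))"
      using 2 a t L by (intro mult_left_mono mult_mono) auto
    finally have 3: "\<bar>t * a k * (P - 1)\<bar> \<le> L * (n * L + C) * t\<^sup>2" by (simp add: power2_eq_square mult_ac)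
    have "(\<Prod>i\<in>insert k I. 1 - t * a i) - (1 - t * (\<Sum>i\<in>insert k I. a i))
       = (P - (1 - t * s)) - t * a k * (P - 1)"
      using insert(1,2) by (simp add: P_def s_def algebra_simps)
    then show "\<bar>(\<Prod>i\<in>insert k I. 1 - t * a i) - (1 - t * (\<Sum>i\<in>insert k I. a i))\<bar> \<le> (C + L * (n * L + C)) * t\<^sup>2"
      using 1 3 by (simp add: distrib_right)
  qed
qed (auto intro: exI[of _ 0])

text \<open>A nontrivial permutation moves at least two indices, so it contributes only to second order.\<close>

lemma det_one_minus_approx:
  assumes L: "L \<ge> 0"
  shows "\<exists>C\<ge>0. \<forall>(A::real^'n^'n) t. (\<forall>i j. \<bar>A $ i $ j\<bar> \<le> L) \<longrightarrow> 0 \<le> t \<longrightarrow> t \<le> 1 \<longrightarrow>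
    \<bar>det (mat 1 - t *\<^sub>R A) - (1 - t * trace A)\<bar> \<le> C * t\<^sup>2"
proof -
  obtain C where C: "C \<ge> 0" and prod: "\<And>(a :: 'n \<Rightarrow> real) t. (\<forall>i. \<bar>a i\<bar> \<le> L) \<Longrightarrow> 0 \<le> t \<Longrightarrow> t \<le> 1 \<Longrightarrow>
    \<bar>(\<Prod>i\<in>UNIV. 1 - t * a i) - (1 - t * (\<Sum>i\<in>UNIV. a i))\<bar> \<le> C * t\<^sup>2"
    using prod_one_minus_approx[of "UNIV :: 'n set" L] L by auto
  let ?Q = "{p. p permutes (UNIV :: 'n set)}"
  define D where "D = real (card ?Q) * (1 + L) ^ CARD('n)"
  have D: "D \<ge> 0" using L by (simp add: D_def)
  show ?thesis
  proof (intro exI[of _ "C + D"] conjI allI impI)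
    fix A :: "real^'n^'n" and t :: real
    assume A: "\<forall>i j. \<bar>A $ i $ j\<bar> \<le> L" and t: "0 \<le> t" "t \<le> 1"
    define M where "M = mat 1 - t *\<^sub>R A"
    have M: "M $ i $ j = (if i = j then 1 - t * A $ i $ j else - (t * A $ i $ j))" for i j
      by (simp add: M_def mat_def)
    let ?T = "\<lambda>p. of_int (sign p) * (\<Prod>i\<in>UNIV. M $ i $ p i)"
    have T: "\<bar>?T p\<bar> \<le> (1 + L) ^ CARD('n) * t\<^sup>2" if p: "p \<in> ?Q - {id}" for p
    proof -
      \<comment> \<open>If \<open>i\<close> is moved, then so is \<open>p i\<close> by injectivity;
        hence at least two indices are moved.\<close>
      define S where "S = {i. p i \<noteq> i}"
      obtain i where i: "p i \<noteq> i" using p by (auto simp: fun_eq_iff)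
      have inj: "inj p" using p permutes_inj by blast
      have "p (p i) \<noteq> p i" using i inj by (auto dest: injD)
      then have "card {i, p i} \<le> card S" using i by (intro card_mono) (auto simp: S_def)
      then have S2: "card S \<ge> 2" using i by (simp add: card_insert_if)
      have "\<bar>?T p\<bar> = (\<Prod>i\<in>UNIV. \<bar>M $ i $ p i\<bar>)"
        by (simp add: abs_mult abs_prod sign_def)
      \<comment> \<open>Every factor is at most 1 + L, and off-diagonal ones carry an additional
        \<open>t\<close>.\<close>
      also have "\<dots> \<le> (\<Prod>i\<in>UNIV. (1 + L) * (if i \<in> S then t else 1))"
      proof (rule prod_mono, intro conjI)
        fix i
        have a: "t * \<bar>A $ i $ p i\<bar> \<le> t * L" using A t by (intro mult_left_mono) auto
        have b: "t * L \<le> L" using t L by (simp add: mult_left_le_one_le)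
        show "\<bar>M $ i $ p i\<bar> \<le> (1 + L) * (if i \<in> S then t else 1)"
        proof (cases "p i = i")
          case True
          have "\<bar>1 - t * A $ i $ i\<bar> \<le> 1 + t * \<bar>A $ i $ i\<bar>" using t abs_triangle_ineq4[of 1 "t * A $ i $ i"] by (simp add: abs_mult)
          then show ?thesis using True a b by (simp add: M S_def)
        next
          case False
          then show ?thesis using a t by (simp add: M S_def abs_mult algebra_simps)
        qed
      qed simp
      also have "\<dots> = (1 + L) ^ CARD('n) * t ^ card S"
        by (simp add: prod.distrib prod.If_cases)
      also have "\<dots> \<le> (1 + L) ^ CARD('n) * t\<^sup>2"
        using L t S2 by (intro mult_left_mono power_decreasing) auto
      finally show ?thesis .
    qed
    have fin: "finite ?Q" by (simp add: finite_permutations)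
    have idQ: "id \<in> ?Q" by (simp add: permutes_id)
    have "det M = ?T id + (\<Sum>p\<in>?Q - {id}. ?T p)"
      unfolding det_def by (rule sum.remove[OF fin idQ])
    also have "?T id = (\<Prod>i\<in>UNIV. 1 - t * A $ i $ i)" by (simp add: M)
    finally have det: "det M = (\<Prod>i\<in>UNIV. 1 - t * A $ i $ i) + (\<Sum>p\<in>?Q - {id}. ?T p)" .
    have "\<bar>\<Sum>p\<in>?Q - {id}. ?T p\<bar> \<le> real (card (?Q - {id})) * ((1 + L) ^ CARD('n) * t\<^sup>2)"
      using sum_norm_bound[of "?Q - {id}" ?T "(1 + L) ^ CARD('n) * t\<^sup>2"] T by simp
    also have "\<dots> \<le> real (card ?Q) * ((1 + L) ^ CARD('n) * t\<^sup>2)"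
      using L fin by (intro mult_right_mono) (auto intro: card_mono)
    finally have "\<bar>\<Sum>p\<in>?Q - {id}. ?T p\<bar> \<le> D * t\<^sup>2" by (simp add: D_def mult.assoc)
    moreover have "\<bar>(\<Prod>i\<in>UNIV. 1 - t * A $ i $ i) - (1 - t * (\<Sum>i\<in>UNIV. A $ i $ i))\<bar> \<le> C * t\<^sup>2"
      using prod[of "\<lambda>i. A $ i $ i" t] A t by blast
    ultimately show "\<bar>det (mat 1 - t *\<^sub>R A) - (1 - t * trace A)\<bar> \<le> (C + D) * t\<^sup>2"
      unfolding M_def[symmetric] det trace_def distrib_right by linarith
  qed (use C D in simp)
qed

lemma norm_linear_le_entries:
  fixes f :: "'a::euclidean_space \<Rightarrow> 'b::euclidean_space"
  assumes f: "linear f" and L: "\<And>i j. i \<in> Basis \<Longrightarrow> j \<in> Basis \<Longrightarrow> \<bar>f i \<bullet> j\<bar> \<le> L"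
  shows "norm (f v) \<le> real DIM('a) * real DIM('b) * L * norm v"
proof -
  have 1: "norm (f i) \<le> real DIM('b) * L" if "i \<in> Basis" for i
    using norm_le_l1[of "f i"] sum_bounded_above[of Basis "\<lambda>j. \<bar>f i \<bullet> j\<bar>" L] L[OF that] by simp
  have fv: "f v = (\<Sum>i\<in>Basis. (v \<bullet> i) *\<^sub>R f i)"
    by (subst euclidean_representation[of v, symmetric]) (simp add: linear_sum[OF f] linear_scale[OF f])
  have "norm (f v) \<le> (\<Sum>i\<in>Basis. norm ((v \<bullet> i) *\<^sub>R f i))" unfolding fv by (rule norm_sum)
  also have "\<dots> \<le> (\<Sum>i\<in>(Basis::'a set). norm v * (real DIM('b) * L))"
    unfolding norm_scaleR by (intro sum_mono mult_mono) (auto simp: Basis_le_norm 1)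
  finally show ?thesis by (simp add: mult_ac)
qed

section \<open>Matrix form of the derivative, and the maps themselves\<close>

lemma Basis_cart: "(Basis :: (real^'n) set) = (\<lambda>i. axis i 1) ` UNIV"
  by (auto simp: Basis_vec_def)

lemma sum_Basis_cart:
  fixes f :: "real^'n \<Rightarrow> 'b::comm_monoid_add"
  shows "(\<Sum>b\<in>Basis. f b) = (\<Sum>i\<in>UNIV. f (axis i 1))"
  unfolding Basis_cart by (subst sum.reindex) (auto simp: inj_on_def axis_eq_axis)

lemma jacobian_id_minus:
  fixes w :: "real^'n \<Rightarrow> real^'n"
  assumes "(w has_derivative w') (at x)"
  shows "jacobian (\<lambda>x. x - t *\<^sub>R w x) (at x) = mat 1 - t *\<^sub>R matrix w'"
proof -
  have d: "((\<lambda>x. x - t *\<^sub>R w x) has_derivative (\<lambda>v. v - t *\<^sub>R w' v)) (at x)"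
    by (intro has_derivative_diff has_derivative_ident has_derivative_scaleR_right assms)
  show ?thesis
    unfolding jacobian_def frechet_derivative_at[OF d, symmetric]
    by (simp add: matrix_def vec_eq_iff mat_def axis_def)
qed

text \<open>Some Lebesgue-null Borel set has positive measure; by inner regularity of finite Borel
  measures it contains a compact set of positive measure.\<close>

lemma exists_compact_of_not_absolutely_continuous:
  fixes \<mu> :: "'a::euclidean_space measure"
  assumes s: "sets \<mu> = sets borel" and "finite_measure \<mu>" and "\<not> absolutely_continuous lborel \<mu>"
  shows "\<exists>K. compact K \<and> emeasure lborel K = 0 \<and> measure \<mu> K > 0"
proof -
  interpret finite_measure \<mu> by fact
  obtain N where N: "N \<in> null_sets lborel" "N \<notin> null_sets \<mu>"
    using assms(3) unfolding absolutely_continuous_def by blast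
  then have "N \<in> sets borel" "emeasure \<mu> N > 0"
    using s by (auto simp: null_sets_def zero_less_iff_neq_zero)
  moreover have "emeasure \<mu> N = (SUP K \<in> {K. K \<subseteq> N \<and> compact K}. emeasure \<mu> K)"
    by (rule inner_regular[OF s _ \<open>N \<in> sets borel\<close>]) (simp add: emeasure_finite)
  ultimately obtain K where K: "K \<subseteq> N" "compact K" "emeasure \<mu> K > 0"
    by (auto simp: less_SUP_iff)
  have "emeasure lborel K \<le> emeasure lborel N"
    using K N by (intro emeasure_mono) auto
  then have "emeasure lborel K = 0" using N by (simp add: null_sets_def)
  then show ?thesis using K by (auto simp: emeasure_eq_measure intro!: exI[of _ K])
qed

theorem theorem1p3:
  fixes \<mu> :: "(real ^ 'n) measure"
  assumes "sets \<mu> = sets borel"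
    and "finite_measure \<mu>"
    and "\<not> absolutely_continuous lborel \<mu>"
  shows "\<exists>g :: nat \<Rightarrow> real ^ 'n \<Rightarrow> real ^ 'n.
    (\<forall>h. continuously_differentiable (g h)) \<and>
    (\<exists>L. \<forall>h. L-lipschitz_on UNIV (g h)) \<and>
    (\<forall>x. (\<lambda>h. g h x) \<longlonglongrightarrow> x) \<and>
    limsup (\<lambda>h. ereal (\<integral>x. det (jacobian (g h) (at x)) \<partial>\<mu>)) < ereal (measure \<mu> UNIV)"
proof -
  interpret finite_measure \<mu> by fact
  note s = assms(1)
  have space: "space \<mu> = UNIV" using sets_eq_imp_space_eq[OF s] by simp
  let ?G = "grad_bound TYPE(real^'n)" and ?D = "size_bound TYPE(real^'n)" and ?c = "div_bound TYPE(real^'n)"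
  have G: "?G \<ge> 0" using payoff_bound_nonneg[where 'a="real^'n"] by (simp add: grad_bound_def)
  have D: "?D \<ge> 0" by (simp add: size_bound_def less_imp_le)
  have c: "?c > 0" by (simp add: div_bound_def)
  obtain K where K: "compact K" "emeasure lborel K = 0" "measure \<mu> K > 0"
    using exists_compact_of_not_absolutely_continuous[OF assms] by blast
  have Ks: "K \<in> sets \<mu>" using K(1) s by (simp add: borel_compact)
  define M where "M = measure \<mu> UNIV"
  define m where "m = measure \<mu> K"
  have m: "m > 0" "M \<ge> 0" using K by (simp_all add: m_def M_def)
  \<comment> \<open>The same entry bound for all \<open>h\<close>. It yields the common Lipschitz
    constant and, through \<open>C\<close>, the admissible step \<open>t\<close>.\<close>
  define L where "L = ?G + 4 * ?D"
  have L: "L \<ge> 0" using G D by (simp add: L_def)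
  obtain C where C: "C \<ge> 0" and det: "\<And>(A::real^'n^'n) t. (\<forall>i j. \<bar>A $ i $ j\<bar> \<le> L) \<Longrightarrow> 0 \<le> t \<Longrightarrow> t \<le> 1 \<Longrightarrow>
    \<bar>det (mat 1 - t *\<^sub>R A) - (1 - t * trace A)\<bar> \<le> C * t\<^sup>2"
    using det_one_minus_approx[OF L] by blast
  define \<rho> where "\<rho> h = 1 / real (Suc h)" for h
  have \<rho>: "0 < \<rho> h" "\<rho> h \<le> 1" for h by (simp_all add: \<rho>_def)
  have \<rho>0: "\<rho> \<longlonglongrightarrow> 0" unfolding \<rho>_def using LIMSEQ_inverse_real_of_nat by (simp add: inverse_eq_divide)
  define P where "P h u u' \<longleftrightarrow> (\<forall>x. (u has_derivative u' x) (at x)) \<and> (\<forall>v. continuous_on UNIV (\<lambda>x. u' x v)) \<and>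
    (\<forall>x. \<forall>i\<in>Basis. \<forall>j\<in>Basis. \<bar>u' x i \<bullet> j\<bar> \<le> L) \<and>
    (\<forall>x. norm (u x) \<le> ?D * \<rho> h) \<and>
    (\<forall>x. - (4 * ?D * \<rho> h) \<le> (\<Sum>b\<in>Basis. u' x b \<bullet> b)) \<and>
    (\<forall>x\<in>K. ?c / 2 - 4 * ?D * \<rho> h \<le> (\<Sum>b\<in>Basis. u' x b \<bullet> b))"
    for h and u :: "real^'n \<Rightarrow> real^'n" and u' :: "real^'n \<Rightarrow> real^'n \<Rightarrow> real^'n"
  have "\<forall>h. \<exists>u u'. P h u u'"
    using exists_compressing_field_compact_support[OF K(1,2) \<rho>] unfolding L_def P_def by blast
  then obtain u u' where P: "\<And>h. P h (u h) (u' h)" by metis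
  have u: "(u h has_derivative u' h x) (at x)" for h x using P[of h] unfolding P_def by blast
  have u_cont: "continuous_on UNIV (\<lambda>x. u' h x v)" for h v using P[of h] unfolding P_def by blast
  have u_grad: "\<bar>u' h x i \<bullet> j\<bar> \<le> L" if "i \<in> Basis" "j \<in> Basis" for h x i j
    using P[of h] that unfolding P_def by blast
  have u_size: "norm (u h x) \<le> ?D * \<rho> h" for h x using P[of h] unfolding P_def by blast
  have u_div: "- (4 * ?D * \<rho> h) \<le> (\<Sum>b\<in>Basis. u' h x b \<bullet> b)" for h x using P[of h] unfolding P_def by blast
  have u_divK: "?c / 2 - 4 * ?D * \<rho> h \<le> (\<Sum>b\<in>Basis. u' h x b \<bullet> b)" if "x \<in> K" for h x
    using P[of h] that unfolding P_def by blast
  \<comment> \<open>Chosen so that the quadratic error C t^2 M is at most a quarter of the gain t (c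
    / 2) m on \<open>K\<close>; the 1 keeps the denominator positive when C M = 0.\<close>
  define t where "t = min 1 (?c * m / (8 * (C * M + 1)))"
  have CM: "C * M \<ge> 0" using C m by simp
  have t: "0 < t" "t \<le> 1" using c m CM by (simp_all add: t_def add_nonneg_pos)
  have tC: "t * (C * M) \<le> ?c * m / 8"
  proof -
    have "t * (C * M) \<le> t * (C * M + 1)" using t by simp
    also have "\<dots> \<le> ?c * m / (8 * (C * M + 1)) * (C * M + 1)"
      using CM by (intro mult_right_mono) (auto simp: t_def)
    also have "\<dots> = ?c * m / 8" using CM by (simp add: divide_simps)
    finally show ?thesis .
  qed
  define g where "g h x = x - t *\<^sub>R u h x" for h x
  have g': "(g h has_derivative (\<lambda>v. v - t *\<^sub>R u' h x v)) (at x)" for h x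
    unfolding g_def by (intro has_derivative_diff has_derivative_ident has_derivative_scaleR_right u)
  have jac: "jacobian (g h) (at x) = mat 1 - t *\<^sub>R matrix (u' h x)" for h x
    unfolding g_def using jacobian_id_minus[OF u] .
  have entry: "matrix (u' h x) $ i $ j = u' h x (axis j 1) \<bullet> axis i 1" for h x i j
    by (simp add: matrix_def inner_axis)
  have jac_cont: "continuous_on UNIV (\<lambda>x. jacobian (g h) (at x))" for h
    unfolding jac matrix_def by (intro continuous_intros continuous_on_vec_lambda u_cont)
  have "continuously_differentiable (g h)" for h
    unfolding continuously_differentiable_def using jac_cont g' differentiableI by blast
  moreover have "(1 + real CARD('n) * real CARD('n) * L)-lipschitz_on UNIV (g h)" for h
  proof (rule bounded_derivative_imp_lipschitz)
    show "(g h has_derivative (\<lambda>v. v - t *\<^sub>R u' h x v)) (at x within UNIV)" for x using g' by simp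
    show "onorm (\<lambda>v. v - t *\<^sub>R u' h x v) \<le> 1 + real CARD('n) * real CARD('n) * L" for x
    proof (rule onorm_le)
      fix v
      have "norm (u' h x v) \<le> real DIM(real^'n) * real DIM(real^'n) * L * norm v"
        by (rule norm_linear_le_entries[OF has_derivative_linear[OF u] u_grad])
      moreover have "norm (t *\<^sub>R u' h x v) \<le> norm (u' h x v)" using t by (simp add: mult_left_le_one_le)
      ultimately show "norm (v - t *\<^sub>R u' h x v) \<le> (1 + real CARD('n) * real CARD('n) * L) * norm v"
        using norm_triangle_ineq4[of v "t *\<^sub>R u' h x v"] by (simp add: algebra_simps)
    qed
  qed (use L in auto)
  moreover have "(\<lambda>h. g h x) \<longlonglongrightarrow> x" for x
  proof -
    have "(\<lambda>h. ?D * \<rho> h) \<longlonglongrightarrow> 0" using tendsto_mult_right_zero[OF \<rho>0] by simp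
    then have "(\<lambda>h. u h x) \<longlonglongrightarrow> 0" by (rule Lim_null_comparison[rotated]) (use u_size in simp)
    from tendsto_diff[OF tendsto_const[of x] tendsto_scaleR[OF tendsto_const[of t] this]]
    show ?thesis by (simp add: g_def)
  qed
  moreover have "limsup (\<lambda>h. ereal (\<integral>x. det (jacobian (g h) (at x)) \<partial>\<mu>)) < ereal (measure \<mu> UNIV)"
  proof -
    define b where "b h = (1 + t * (4 * ?D * \<rho> h) + C * t\<^sup>2) * M - t * (?c / 2) * m" for h
    have b: "(\<integral>x. det (jacobian (g h) (at x)) \<partial>\<mu>) \<le> b h" for h
    proof -
      let ?d = "\<lambda>x. det (jacobian (g h) (at x))" and ?div = "\<lambda>x. \<Sum>b\<in>Basis. u' h x b \<bullet> b"
      have tr: "trace (matrix (u' h x)) = ?div x" for x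
        unfolding trace_def sum_Basis_cart entry ..
      have app: "\<bar>?d x - (1 - t * ?div x)\<bar> \<le> C * t\<^sup>2" for x
      proof -
        have "\<forall>i j. \<bar>matrix (u' h x) $ i $ j\<bar> \<le> L" unfolding entry by (auto intro!: u_grad)
        from det[OF this, of t] t show ?thesis unfolding jac tr by simp
      qed
      have div_le: "\<bar>?div x\<bar> \<le> real CARD('n) * L" for x
        using sum_norm_bound[of Basis "\<lambda>b. u' h x b \<bullet> b" L] u_grad by simp
      have int: "integrable \<mu> ?d"
      proof (rule integrable_const_bound)
        have "\<bar>?d x\<bar> \<le> 1 + real CARD('n) * L + C * t\<^sup>2" for x
        proof -
          have "\<bar>t * ?div x\<bar> \<le> 1 * \<bar>?div x\<bar>" unfolding abs_mult using t by (intro mult_right_mono) auto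
          then show ?thesis using app[of x] div_le[of x] by linarith
        qed
        then show "AE x in \<mu>. norm (?d x) \<le> 1 + real CARD('n) * L + C * t\<^sup>2" by simp
        have "continuous_on UNIV ?d"
          unfolding det_def
          by (intro continuous_intros continuous_on_component jac_cont)
        then have "?d \<in> borel_measurable borel" by (rule borel_measurable_continuous_onI)
        then show "?d \<in> borel_measurable \<mu>" using measurable_cong_sets[OF s refl] by blast
      qed
      have pw: "?d x \<le> (1 + t * (4 * ?D * \<rho> h) + C * t\<^sup>2) - t * (?c / 2) * indicator K x" for x
      proof -
        have "?c / 2 * indicator K x - 4 * ?D * \<rho> h \<le> ?div x"
          using u_div[of h x] u_divK[of x h] by (cases "x \<in> K") auto
        then have "t * (?c / 2 * indicator K x - 4 * ?D * \<rho> h) \<le> t * ?div x" using t by (intro mult_left_mono) auto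
        then show ?thesis using app[of x] by (simp add: algebra_simps)
      qed
      have iK: "integrable \<mu> (\<lambda>x. t * (?c / 2) * indicator K x)"
        using Ks by (intro integrable_mult_right integrable_real_indicator) (auto simp: less_top[symmetric] emeasure_finite)
      have "(\<integral>x. ?d x \<partial>\<mu>) \<le> (\<integral>x. (1 + t * (4 * ?D * \<rho> h) + C * t\<^sup>2) - t * (?c / 2) * indicator K x \<partial>\<mu>)"
        by (rule integral_mono[OF int _ pw]) (intro Bochner_Integration.integrable_diff integrable_const iK)
      also have "\<dots> = b h"
        by (subst Bochner_Integration.integral_diff[OF integrable_const iK])
          (use Ks in \<open>simp add: b_def M_def m_def space mult.commute\<close>)
      finally show ?thesis .
    qed
    define B where "B = (1 + t * (4 * ?D * 0) + C * t\<^sup>2) * M - t * (?c / 2) * m"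
    have "b \<longlonglongrightarrow> B"
      unfolding b_def B_def by (intro tendsto_intros \<rho>0)
    then have l1: "limsup (\<lambda>h. ereal (b h)) = ereal B"
      by (intro lim_imp_Limsup) auto
    have l2: "limsup (\<lambda>h. ereal (\<integral>x. det (jacobian (g h) (at x)) \<partial>\<mu>)) \<le> limsup (\<lambda>h. ereal (b h))"
      by (intro Limsup_mono always_eventually allI) (simp add: b)
    have "B < M"
    proof -
      have "B = M + t * (t * (C * M)) - t * (?c * m) / 2" by (simp add: B_def power2_eq_square algebra_simps)
      also have "\<dots> \<le> M + t * (?c * m / 8) - t * (?c * m) / 2"
        using mult_left_mono[OF tC, of t] t by linarith
      also have "\<dots> < M" using t c m by simp
      finally show ?thesis .
    qed
    then have "ereal B < ereal (measure \<mu> UNIV)" by (simp add: M_def)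
    with l2 show ?thesis unfolding l1 by (rule order_le_less_trans)
  qed
  ultimately show ?thesis by blast
qed

end
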